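(* Let $1 \le p \le \infty$ and suppose that the Banach lattice $X = \left(\oplus_{n=1}^\infty X_n\right)_p$ is an order Pelczyński decomposition of $X$. Let $Y$ be a Banach lattice with the property that there exist positive operators $S : Y \to X$ and $T : X \to Y$ such that $\|S\| = 1$ and $TS$ is the identity operator on $Y$. If $C$ is a positive operator on $(Y \oplus X)_p$, then $C$ is a commutator between two positive operators, i.e. $C = AB - BA$ for some positive operators $A$ and $B$ on $(Y \oplus X)_p$, in each of the following cases: (a) $C$ is semi-compact, and $X$ and $X^*$ have order continuous norms. (b) $C$ is semi-compact, $C^*$ is AM-compact and $X$ has order continuous norm. (c) $C$ is AM-compact, $C^*$ is semi-compact and $X^*$ has order continuous norm. (d) $C$ is compact, and either $X$ or $X^*$ has order continuous norm.
   Context: For Banach lattices $X_1, X_2, \ldots$ and $1 \le p < \infty$, the $l^p$-direct sum $\left(\oplus_{n=1}^\infty X_n\right)_p$ is the Banach lattice of all sequences $x = (x_1, x_2, \ldots)$ with $x_n \in X_n$ and $\|x\|^p = \sum_{n=1}^\infty \|x_n\|^p < \infty$; for $p = \infty$ it consists of all such sequences with $\|x\| = \sup_n \|x_n\| < \infty$. Order is coordinatewise. Finite direct sums such as $(Y \oplus X)_p$ are defined in the same way. A Banach lattice $X$ admits an order Pelczyński decomposition $X = \left(\oplus_{n=1}^\infty X_n\right)_p$ ($1 \le p \le \infty$) if this equality holds and, for each $n$, $X_n$ is a band of $X$ that is isometric and order isomorphic to $X$ (i.e. there is an isometric lattice isomorphism between $X_n$ and $X$). $B_Z$ denotes the closed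 unit ball of a Banach lattice $Z$. $Z$ has order continuous norm if $x_\alpha \downarrow 0$ in $Z$ implies $\|x_\alpha\| \downarrow 0$. A subset $A$ of $Z$ is almost order bounded if for every $\epsilon > 0$ there is $u \ge 0$ in $Z$ with $A \subseteq [-u,u] + \epsilon B_Z$. An operator $R$ on $Z$ is semi-compact if $R(B_Z)$ is almost order bounded in $Z$. An order bounded operator on $Z$ is AM-compact if it maps order bounded sets to relatively (norm) compact sets. $R^*$ denotes the adjoint operator on the Banach lattice dual $Z^*$. *)

theory Defs
  imports "HOL-Analysis.Analysis" "HOL-Library.Lattice_Algebras" "HOL-Library.Product_Order"
begin

section \<open>Banach lattices\<close>

class banach_lattice = banach + ordered_real_vector + lattice_ab_group_add_abs +
  assumes norm_mono_abs: "\<bar>x\<bar> \<le> \<bar>y\<bar> \<Longrightarrow> norm x \<le> norm y"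

instance real :: banach_lattice
  by standard simp

text \<open>The dual of a Banach lattice: bounded functionals with the operator norm, ordered by
  their values on the positive cone.\<close>

instantiation blinfun :: ("{real_normed_vector, preorder}", "{real_normed_vector, preorder}") preorder
begin

definition less_eq_blinfun :: "('a \<Rightarrow>\<^sub>L 'b) \<Rightarrow> ('a \<Rightarrow>\<^sub>L 'b) \<Rightarrow> bool"
  where "less_eq_blinfun f g \<longleftrightarrow> (\<forall>x\<ge>0. blinfun_apply f x \<le> blinfun_apply g x)"

definition less_blinfun :: "('a \<Rightarrow>\<^sub>L 'b) \<Rightarrow> ('a \<Rightarrow>\<^sub>L 'b) \<Rightarrow> bool"
  where "less_blinfun f g \<longleftrightarrow> f \<le> g \<and> \<not> g \<le> f"

instance
  by standard (auto simp: less_eq_blinfun_def less_blinfun_def intro: order_trans)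

end

text \<open>Order closed ideals; for an ideal, closure under order limits is the same as closure under
  those suprema that exist in the whole space.\<close>

definition band :: "'a::banach_lattice set \<Rightarrow> bool"
  where "band B \<longleftrightarrow> subspace B
    \<and> (\<forall>x y. y \<in> B \<and> \<bar>x\<bar> \<le> \<bar>y\<bar> \<longrightarrow> x \<in> B)
    \<and> (\<forall>D s. D \<subseteq> B \<and> D \<noteq> {} \<and> (\<forall>d\<in>D. d \<le> s) \<and> (\<forall>u. (\<forall>d\<in>D. d \<le> u) \<longrightarrow> s \<le> u) \<longrightarrow> s \<in> B)"

text \<open>Positive operators between Banach lattices are automatically bounded, so only linearity is
  required.\<close>

definition positive_operator ::
    "('a::{real_vector, ord} \<Rightarrow> 'b::{real_vector, ord}) \<Rightarrow> bool"
  where "positive_operator R \<longleftrightarrow> linear R \<and> (\<forall>x\<ge>0. 0 \<le> R x)"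

section \<open>Direct sums and order Pelczynski decompositions\<close>

text \<open>The exponent ranges over \<open>1 \<le> p \<le> \<infinity>\<close> in \<^typ>\<open>ennreal\<close>. The sum of bands \<open>Xs n\<close> of one space
  is a set of sequences, ordered by the pointwise order of functions; indices start at \<open>0\<close>.\<close>

definition lp_sum :: "ennreal \<Rightarrow> (nat \<Rightarrow> 'a::real_normed_vector set) \<Rightarrow> (nat \<Rightarrow> 'a) set"
  where "lp_sum p Xs = {x. (\<forall>n. x n \<in> Xs n) \<and>
    (if p = \<infinity> then bdd_above (range (\<lambda>n. norm (x n)))
     else summable (\<lambda>n. norm (x n) powr enn2real p))}"

definition lp_sum_norm :: "ennreal \<Rightarrow> (nat \<Rightarrow> 'a::real_normed_vector) \<Rightarrow> real"
  where "lp_sum_norm p x =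
    (if p = \<infinity> then (SUP n. norm (x n))
     else (\<Sum>n. norm (x n) powr enn2real p) powr (1 / enn2real p))"

text \<open>The sum \<open>(Y \<oplus> X)\<^sub>p\<close> is the product type with the componentwise order of
  \<^theory>\<open>HOL-Library.Product_Order\<close> and the following norm. The norm of the product type itself is
  the case \<open>p = 2\<close>. All these norms are equivalent, so the bounded functionals on \<open>(Y \<oplus> X)\<^sub>p\<close> are
  the elements of the \<open>blinfun\<close> type for every \<open>p\<close>; only their norm depends on \<open>p\<close>
  (see \<open>dual_norm\<close> below).\<close>

definition psum_norm :: "ennreal \<Rightarrow> 'a::real_normed_vector \<times> 'b::real_normed_vector \<Rightarrow> real"
  where "psum_norm p z =
    (if p = \<infinity> then max (norm (fst z)) (norm (snd z))
     else (norm (fst z) powr enn2real p + norm (snd z) powr enn2real p) powr (1 / enn2real p))"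

definition isometric_lattice_iso_onto ::
    "('a::banach_lattice \<Rightarrow> 'b::banach_lattice) \<Rightarrow> 'b set \<Rightarrow> bool"
  where "isometric_lattice_iso_onto U B \<longleftrightarrow> linear U \<and> bij_betw U UNIV B
    \<and> (\<forall>x. norm (U x) = norm x)
    \<and> (\<forall>x y. U (sup x y) = sup (U x) (U y)) \<and> (\<forall>x y. U (inf x y) = inf (U x) (U y))"

text \<open>\<open>\<Phi>\<close> is the identification of \<open>X\<close> with the direct sum of its bands \<open>Xs n\<close>: it is an isometric
  lattice isomorphism that sends \<open>x \<in> Xs n\<close> to the sequence with the single entry \<open>x\<close> at
  position \<open>n\<close>.\<close>

definition order_pelczynski_decomposition ::
    "ennreal \<Rightarrow> (nat \<Rightarrow> 'a::banach_lattice set) \<Rightarrow> bool"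
  where "order_pelczynski_decomposition p Xs \<longleftrightarrow>
    (\<forall>n. band (Xs n) \<and> (\<exists>U :: 'a \<Rightarrow> 'a. isometric_lattice_iso_onto U (Xs n)))
    \<and> (\<exists>\<Phi> :: 'a \<Rightarrow> nat \<Rightarrow> 'a.
         (\<forall>n. linear (\<lambda>x. \<Phi> x n))
       \<and> bij_betw \<Phi> UNIV (lp_sum p Xs)
       \<and> (\<forall>x. lp_sum_norm p (\<Phi> x) = norm x)
       \<and> (\<forall>x y. \<Phi> (sup x y) = sup (\<Phi> x) (\<Phi> y)) \<and> (\<forall>x y. \<Phi> (inf x y) = inf (\<Phi> x) (\<Phi> y))
       \<and> (\<forall>n. \<forall>x\<in>Xs n. \<Phi> x = (\<lambda>m. if m = n then x else 0)))"

section \<open>Notions relative to a norm\<close>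

text \<open>The following take the norm \<open>N\<close> as an argument, to be used with \<^const>\<open>norm\<close>, with
  \<^const>\<open>psum_norm\<close> and with the corresponding dual norms.\<close>

definition dual_norm :: "('a::real_normed_vector \<Rightarrow> real) \<Rightarrow> ('a \<Rightarrow>\<^sub>L real) \<Rightarrow> real"
  where "dual_norm N f = (SUP z\<in>{z. N z \<le> 1}. \<bar>blinfun_apply f z\<bar>)"

text \<open>A net decreasing to \<open>0\<close> is given by its range \<open>D\<close>, a downward directed set with infimum \<open>0\<close>
  that serves as its own index set. This covers nets over arbitrary index types, over which a
  definition could not quantify.\<close>

definition order_continuous_norm :: "('a::{zero, preorder} \<Rightarrow> real) \<Rightarrow> bool"
  where "order_continuous_norm N \<longleftrightarrow>
    (\<forall>D. D \<noteq> {} \<and> (\<forall>x\<in>D. \<forall>y\<in>D. \<exists>z\<in>D. z \<le> x \<and> z \<le> y)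
       \<and> (\<forall>x\<in>D. 0 \<le> x) \<and> (\<forall>l. (\<forall>x\<in>D. l \<le> x) \<longrightarrow> l \<le> 0)
     \<longrightarrow> (\<forall>\<epsilon>>0. \<exists>x\<in>D. \<forall>y\<in>D. y \<le> x \<longrightarrow> N y < \<epsilon>))"

definition almost_order_bounded :: "('a::{real_vector, preorder} \<Rightarrow> real) \<Rightarrow> 'a set \<Rightarrow> bool"
  where "almost_order_bounded N A \<longleftrightarrow>
    (\<forall>\<epsilon>>0. \<exists>u\<ge>0. A \<subseteq> {v + \<epsilon> *\<^sub>R b |v b. v \<in> {- u..u} \<and> N b \<le> 1})"

definition relatively_compact :: "('a::real_vector \<Rightarrow> real) \<Rightarrow> 'a set \<Rightarrow> bool"
  where "relatively_compact N A \<longleftrightarrow>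
    (let T = Metric_space.mtopology UNIV (\<lambda>x y. N (x - y)) in compactin T (T closure_of A))"

definition order_bounded :: "'a::ord set \<Rightarrow> bool"
  where "order_bounded A \<longleftrightarrow> (\<exists>a b. A \<subseteq> {a..b})"

definition semi_compact ::
    "('a::{real_vector, preorder} \<Rightarrow> real) \<Rightarrow> ('a \<Rightarrow> 'a) \<Rightarrow> bool"
  where "semi_compact N R \<longleftrightarrow> almost_order_bounded N (R ` {z. N z \<le> 1})"

definition AM_compact ::
    "('a::{real_vector, preorder} \<Rightarrow> real) \<Rightarrow> ('a \<Rightarrow> 'a) \<Rightarrow> bool"
  where "AM_compact N R \<longleftrightarrow>
    (\<forall>A. order_bounded A \<longrightarrow> order_bounded (R ` A)) \<and>
    (\<forall>A. order_bounded A \<longrightarrow> relatively_compact N (R ` A))"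

definition compact_operator :: "('a::real_vector \<Rightarrow> real) \<Rightarrow> ('a \<Rightarrow> 'a) \<Rightarrow> bool"
  where "compact_operator N R \<longleftrightarrow> relatively_compact N (R ` {z. N z \<le> 1})"

text \<open>\<open>Blinfun\<close> is meaningful only for bounded functionals; this is the case for bounded \<open>R\<close>, in
  particular for positive operators.\<close>

definition adjoint_operator ::
    "('a::real_normed_vector \<Rightarrow> 'a) \<Rightarrow> ('a \<Rightarrow>\<^sub>L real) \<Rightarrow> ('a \<Rightarrow>\<^sub>L real)"
  where "adjoint_operator R f = Blinfun (\<lambda>z. blinfun_apply f (R z))"

lemma adjoint_operator_apply:
  "bounded_linear R \<Longrightarrow> blinfun_apply (adjoint_operator R f) z = blinfun_apply f (R z)"
  unfolding adjoint_operator_def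
  by (subst bounded_linear_Blinfun_apply)
    (auto intro: bounded_linear_compose[OF blinfun.bounded_linear_right])

lemma psum_norm_2: "psum_norm 2 z = norm z"
  by (simp add: psum_norm_def norm_prod_def powr_half_sqrt)

end

theory Submission
  imports Defs
begin

text \<open>
Let \<open>Z = Y \<oplus> X\<close>. Composing \<open>X = (\<oplus> X\<^sub>n)\<^sub>p\<close> with the isomorphisms \<open>X\<^sub>n \<cong> X\<close> identifies \<open>X\<close> with the
space of \<open>p\<close>-summable sequences in \<open>X\<close>; write \<open>\<sigma>\<^sub>n x\<close> for the entries. An element \<open>z = (y, x)\<close> of \<open>Z\<close>
then becomes the sequence \<open>(S y, \<sigma>\<^sub>0 x, \<sigma>\<^sub>1 x, \<dots>)\<close> in \<open>X\<close>, from which \<open>y = T (S y)\<close> is recovered.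
On such sequences there is a weighted forward shift \<open>V\<close> and a weighted backward shift \<open>W\<close>, which
carries the entry with index \<open>1\<close> back to \<open>Y\<close> by \<open>T\<close>; both are positive and \<open>W V = I\<close>. Put
\<open>B = V C + V\<^sup>2 C W + V\<^sup>3 C W\<^sup>2 + \<dots>\<close>. Then \<open>W B = C + V C W + V\<^sup>2 C W\<^sup>2 + \<dots>\<close>
and \<open>B W = V C W + V\<^sup>2 C W\<^sup>2 + \<dots>\<close>, so that \<open>W B - B W = C\<close>.

No convergence has to be discussed for this identity, because each entry of \<open>B z\<close> is a
finite sum. The point of the proof is that \<open>B z\<close> belongs to the space at all, that is, that its entries
are \<open>p\<close>-summable. Without weights this fails even for operators of rank one, for example for
\<open>x \<mapsto> (\<Sum>n. x\<^sub>n) e\<^sub>0\<close> in \<open>l\<^sup>1\<close>. With the weight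
\<open>1 / (n + 1)\<^sup>2\<close> at index \<open>n\<close> it holds whenever the rows of the matrix of \<open>C\<close> are small, and with
the weight \<open>(n + 1)\<^sup>2\<close> whenever its columns are small (lemma \<open>commutator_if_rows_decay\<close>,
lemma \<open>commutator_if_columns_decay\<close>). In both cases the weights produce the factor
\<open>((i + k + 2) / ((i + 1) (k + 1)))\<^sup>2 \<le> 2 / (i + 1)\<^sup>2 + 2 / (k + 1)\<^sup>2\<close>,
which turns the series into convolutions of summable with \<open>p\<close>-summable sequences, and these are
controlled by Minkowski's inequality.

Smallness of one of the two kinds is arranged by regrouping. The index set is partitioned into infinitely
many infinite sets, and \<open>\<sigma>\<^sub>n x\<close> is redefined as the part of \<open>x\<close> with indices in the \<open>n\<close>-th set; since
each set is infinite, this again identifies \<open>X\<close> with sequences in \<open>X\<close>. The sets may be chosen one after the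
other inside any given infinite set, so it suffices that \<open>C\<close> is small on, or maps into elements that
are small on, suitable subsets of every infinite set.
If \<open>C\<close> is semi-compact or compact and the norm of \<open>X\<close> is order continuous, then up to \<open>\<epsilon>\<close> the range of the
unit ball is dominated by one element \<open>u\<close>, and the tails of \<open>u\<close> tend to \<open>0\<close> in norm. This gives small rows.
If \<open>C\<close> is compact or its adjoint is semi-compact, then on positive \<open>z\<close> in the unit ball
\<open>\<parallel>C z\<parallel> \<le> \<phi> z + \<epsilon>\<close> for one positive functional \<open>\<phi>\<close>; the existence of positive functionals that attain the norm
is a Hahn-Banach theorem, proved here with minimal sublinear functionals. If the norm of the dual is order
continuous, \<open>\<phi>\<close> is small in norm on all but finitely many of any sequence of disjoint parts of \<open>X\<close>, which gives
small columns.
\<close>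

section \<open>Banach lattices and positive operators\<close>

text \<open>With the Euclidean norm, the product of two Banach lattices is a Banach lattice. The superclasses are
instantiated one by one, each at its own sort: the product already belongs to them for Euclidean
spaces, and the arities stay coherent only if each class gets its most general one.\<close>

instance prod :: (ordered_ab_semigroup_add, ordered_ab_semigroup_add) ordered_ab_semigroup_add
  by standard (simp add: less_eq_prod_def add_left_mono)

instance prod :: (ordered_cancel_ab_semigroup_add, ordered_cancel_ab_semigroup_add)
  ordered_cancel_ab_semigroup_add ..

instance prod :: (ordered_comm_monoid_add, ordered_comm_monoid_add) ordered_comm_monoid_add ..

instance prod :: (ordered_cancel_comm_monoid_add, ordered_cancel_comm_monoid_add)
  ordered_cancel_comm_monoid_add ..

instance prod :: (ordered_ab_semigroup_add_imp_le, ordered_ab_semigroup_add_imp_le)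
  ordered_ab_semigroup_add_imp_le
  by standard (simp add: less_eq_prod_def)

instance prod :: (ordered_ab_semigroup_monoid_add_imp_le, ordered_ab_semigroup_monoid_add_imp_le)
  ordered_ab_semigroup_monoid_add_imp_le ..

instance prod :: (ordered_ab_group_add, ordered_ab_group_add) ordered_ab_group_add ..

instance prod :: (ordered_real_vector, ordered_real_vector) ordered_real_vector
  by standard (simp_all add: less_eq_prod_def scaleR_left_mono scaleR_right_mono)

instance prod :: (ordered_ab_group_add_abs, ordered_ab_group_add_abs) ordered_ab_group_add_abs
  by standard (auto simp: less_eq_prod_def abs_prod_def abs_triangle_ineq abs_ge_self intro: abs_leI)

instance prod :: (banach_lattice, banach_lattice) banach_lattice
proof
  fix x y :: "'a \<times> 'b"
  show "\<bar>x\<bar> = sup x (- x)"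
    by (simp add: abs_prod_def abs_lattice prod_eq_iff)
  show "norm x \<le> norm y" if "\<bar>x\<bar> \<le> \<bar>y\<bar>"
    using that unfolding norm_prod_def
    by (intro real_sqrt_le_mono add_mono power_mono norm_mono_abs)
       (auto simp: abs_prod_def less_eq_prod_def)
qed

lemma norm_abs_banach_lattice: "norm \<bar>x\<bar> = norm x" for x :: "'a::banach_lattice"
  by (simp add: norm_mono_abs order.antisym)

lemma norm_mono_pos: "0 \<le> x \<Longrightarrow> x \<le> y \<Longrightarrow> norm x \<le> norm y" for x y :: "'a::banach_lattice"
  by (rule norm_mono_abs) (metis abs_of_nonneg order_trans)

lemma norm_le_if_abs_le: "\<bar>x\<bar> \<le> y \<Longrightarrow> norm x \<le> norm y" for x y :: "'a::banach_lattice"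
  by (metis norm_abs_banach_lattice norm_mono_pos abs_ge_zero)

lemma pprt_add_le: "pprt (x + y) \<le> pprt x + pprt y" for x y :: "'a::banach_lattice"
  by (simp add: pprt_def add_mono add_nonneg_nonneg)

lemma pprt_le_abs: "pprt x \<le> \<bar>x\<bar>" for x :: "'a::banach_lattice"
  by (simp add: pprt_def abs_ge_self)

lemma norm_pprt_le: "norm (pprt x) \<le> norm x" for x :: "'a::banach_lattice"
  using norm_mono_pos[OF zero_le_pprt pprt_le_abs, of x] by (simp add: norm_abs_banach_lattice)

lemma pprt_scaleR_le: "0 \<le> t \<Longrightarrow> pprt (t *\<^sub>R x) \<le> t *\<^sub>R pprt x" for x :: "'a::banach_lattice"
  by (simp add: pprt_def scaleR_left_mono scaleR_nonneg_nonneg)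

text \<open>The map \<open>x \<mapsto> pprt x\<close> is a contraction and fixes positive elements, so replacing an approximation of a positive
element by its positive part does not make it worse.\<close>

lemma norm_pprt_diff_le: "norm (pprt x - y) \<le> norm (x - y)" if "0 \<le> y" for x y :: "'a::banach_lattice"
proof (rule norm_mono_abs, rule abs_leI)
  have "pprt x \<le> pprt y + pprt (x - y)" using pprt_add_le[of y "x - y"] by simp
  also have "\<dots> \<le> y + \<bar>x - y\<bar>" using that by (intro add_mono pprt_le_abs) simp
  finally show "pprt x - y \<le> \<bar>x - y\<bar>" by (simp add: algebra_simps)
  have "y - x \<le> \<bar>x - y\<bar>" using abs_ge_minus_self[of "x - y"] by simp
  moreover have "x \<le> pprt x" by (simp add: pprt_def)
  ultimately show "- (pprt x - y) \<le> \<bar>x - y\<bar>"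
    by (metis diff_left_mono minus_diff_eq order_trans)
qed

text \<open>The positive cone is closed, because \<open>pprt (- x)\<close> is dominated by the distance of \<open>x\<close> to any positive element.\<close>

lemma nonneg_limit:
  fixes x :: "'a::banach_lattice"
  assumes "X \<longlonglongrightarrow> x" "\<And>n. 0 \<le> X n"
  shows "0 \<le> x"
proof -
  have "norm (pprt (- x)) \<le> norm (X n - x)" for n
  proof -
    have "- x \<le> X n - x" using assms(2)[of n] by simp
    also have "\<dots> \<le> \<bar>X n - x\<bar>" by (rule abs_ge_self)
    finally have "pprt (- x) \<le> \<bar>X n - x\<bar>"
      by (simp add: pprt_def)
    then show ?thesis
      using norm_mono_pos[OF zero_le_pprt] by (metis norm_abs_banach_lattice)
  qed
  moreover have "(\<lambda>n. norm (X n - x)) \<longlonglongrightarrow> 0"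
    using assms(1) by (simp add: LIM_zero tendsto_norm_zero)
  ultimately have "norm (pprt (- x)) \<le> 0"
    by (intro LIMSEQ_le_const[where X = "\<lambda>n. norm (X n - x)"]) auto
  then have "- x \<le> 0" by (simp add: le_zero_iff_zero_pprt)
  then show ?thesis by simp
qed

lemma summand_le_suminf:
  fixes f :: "nat \<Rightarrow> 'a::banach_lattice"
  assumes "summable f" "\<And>n. 0 \<le> f n"
  shows "f k \<le> suminf f"
proof -
  have "(\<lambda>n. sum f {..<n + Suc k} - f k) \<longlonglongrightarrow> suminf f - f k"
    by (intro tendsto_diff tendsto_const LIMSEQ_ignore_initial_segment summable_LIMSEQ assms(1))
  moreover have "0 \<le> sum f {..<n + Suc k} - f k" for n
    using sum_mono2[of "{..<n + Suc k}" "{k}" f] assms(2) by simp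
  ultimately have "0 \<le> suminf f - f k" by (rule nonneg_limit)
  then show ?thesis by simp
qed

lemma positive_operatorD:
  assumes "positive_operator R"
  shows "linear R" "0 \<le> x \<Longrightarrow> 0 \<le> R x"
  using assms by (auto simp: positive_operator_def)

lemma positive_operator_mono:
  fixes R :: "'a::banach_lattice \<Rightarrow> 'b::banach_lattice"
  assumes "positive_operator R" "x \<le> y"
  shows "R x \<le> R y"
  using positive_operatorD(2)[OF assms(1), of "y - x"] assms(2)
  by (simp add: linear_diff[OF positive_operatorD(1)[OF assms(1)]])

lemma abs_positive_operator_le:
  fixes R :: "'a::banach_lattice \<Rightarrow> 'b::banach_lattice"
  assumes "positive_operator R"
  shows "\<bar>R x\<bar> \<le> R \<bar>x\<bar>"
proof (rule abs_leI)
  show "R x \<le> R \<bar>x\<bar>" by (rule positive_operator_mono[OF assms abs_ge_self])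
  have "R (- x) \<le> R \<bar>x\<bar>" by (rule positive_operator_mono[OF assms abs_ge_minus_self])
  then show "- R x \<le> R \<bar>x\<bar>"
    by (simp add: linear_neg[OF positive_operatorD(1)[OF assms(1)]])
qed

lemma norm_positive_operator_le:
  fixes R :: "'a::banach_lattice \<Rightarrow> 'b::banach_lattice"
  assumes "positive_operator R"
  shows "norm (R x) \<le> norm (R \<bar>x\<bar>)"
  by (rule norm_le_if_abs_le) (rule abs_positive_operator_le[OF assms])

text \<open>If \<open>R\<close> is unbounded, there are positive \<open>y n\<close> of norm \<open>2\<^sup>-\<^sup>n\<close> with \<open>\<parallel>R (y n)\<parallel> > n\<close>. Their sum exists by
completeness and dominates each of them, so that the norm of its image exceeds every \<open>n\<close>.\<close>

lemma positive_operator_bounded: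
  fixes R :: "'a::banach_lattice \<Rightarrow> 'b::banach_lattice"
  assumes R: "positive_operator R"
  shows "bounded_linear R"
proof -
  note lin = positive_operatorD(1)[OF R]
  have "\<exists>K. \<forall>x. norm (R x) \<le> norm x * K"
  proof (rule ccontr)
    assume "\<not> ?thesis"
    then have "\<forall>n::nat. \<exists>x. norm x * (real n * 2 ^ n) < norm (R x)"
      by (meson not_le)
    then obtain x where x: "\<And>n::nat. norm (x n) * (real n * 2 ^ n) < norm (R (x n))"
      by metis
    have nz: "x n \<noteq> 0" for n
      using x[of n] linear_0[OF lin] by auto
    define y where "y n = (1 / (2 ^ n * norm (x n))) *\<^sub>R \<bar>x n\<bar>" for n
    have ynorm: "norm (y n) = (1/2) ^ n" for n
      using nz[of n] by (simp add: y_def norm_abs_banach_lattice power_divide)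
    have ypos: "0 \<le> y n" for n
      by (simp add: y_def scaleR_nonneg_nonneg)
    have "summable (\<lambda>n. norm (y n))" by (simp add: ynorm summable_geometric)
    then have sy: "summable y" by (rule summable_norm_cancel)
    have Ry: "real n < norm (R (y n))" for n
    proof -
      have "norm (x n) * (real n * 2 ^ n) < norm (R \<bar>x n\<bar>)"
        using x[of n] norm_positive_operator_le[OF R, of "x n"] by linarith
      also have "R \<bar>x n\<bar> = (2 ^ n * norm (x n)) *\<^sub>R R (y n)"
        using nz[of n] by (simp add: y_def linear_scale[OF lin])
      finally show ?thesis
        using nz[of n] by (simp add: mult.assoc mult.left_commute)
    qed
    have "norm (R (y n)) \<le> norm (R (suminf y))" for n
      by (rule norm_mono_pos[OF positive_operatorD(2)[OF R ypos]
            positive_operator_mono[OF R summand_le_suminf[OF sy ypos]]])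
    then have "real n < norm (R (suminf y))" for n
      using Ry[of n] by (meson less_le_trans)
    then show False
      by (meson reals_Archimedean2 not_less_iff_gr_or_eq)
  qed
  then show ?thesis
    using lin by (intro bounded_linear.intro bounded_linear_axioms.intro) auto
qed

lemma positive_operator_fst: "positive_operator (fst :: 'a::banach_lattice \<times> 'b::banach_lattice \<Rightarrow> 'a)"
  by (auto simp: positive_operator_def less_eq_prod_def linear_fst)

lemma positive_operator_snd: "positive_operator (snd :: 'a::banach_lattice \<times> 'b::banach_lattice \<Rightarrow> 'b)"
  by (auto simp: positive_operator_def less_eq_prod_def linear_snd)

lemma positive_operator_comp:
  fixes f :: "'a::{real_vector,ord} \<Rightarrow> 'b::{real_vector,ord}" and g :: "'b \<Rightarrow> 'c::{real_vector,ord}"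
  assumes "positive_operator f" "positive_operator g"
  shows "positive_operator (\<lambda>x. g (f x))"
  using assms linear_compose[of f g] by (auto simp: positive_operator_def o_def)

lemma positive_operator_scale:
  fixes f :: "'a::{real_vector,ord} \<Rightarrow> 'b::banach_lattice"
  assumes "positive_operator f" "0 \<le> c"
  shows "positive_operator (\<lambda>x. c *\<^sub>R f x)"
  using assms by (auto simp: positive_operator_def scaleR_nonneg_nonneg intro: linear_compose_scale_right)

lemma positive_operator_sum:
  fixes f :: "'i \<Rightarrow> 'a::{real_vector,ord} \<Rightarrow> 'b::banach_lattice"
  assumes "\<And>i. i \<in> I \<Longrightarrow> positive_operator (f i)"
  shows "positive_operator (\<lambda>x. \<Sum>i\<in>I. f i x)"
  using assms by (auto simp: positive_operator_def intro!: sum_nonneg linear_compose_sum)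

lemma positive_operator_Pair:
  fixes f :: "'a::{real_vector,ord} \<Rightarrow> 'b::banach_lattice" and g :: "'a \<Rightarrow> 'c::banach_lattice"
  assumes "positive_operator f" "positive_operator g"
  shows "positive_operator (\<lambda>x. (f x, g x))"
  using assms
  by (auto simp: positive_operator_def less_eq_prod_def linear_iff)

lemma positive_operator_zero: "positive_operator (\<lambda>x::'a::{real_vector,ord}. 0::'b::banach_lattice)"
  by (simp add: positive_operator_def linear_zero)

lemma positive_operator_power:
  fixes f :: "'a::{real_vector,ord} \<Rightarrow> 'a"
  assumes "positive_operator f"
  shows "positive_operator (f ^^ k)"
proof (induction k)
  case 0
  then show ?case by (simp add: positive_operator_def linearI)
next
  case (Suc k)
  then show ?case using positive_operator_comp[OF Suc assms] by (simp add: o_def)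
qed

lemma norm_components_le: "norm (fst z) \<le> norm z" "norm (snd z) \<le> norm z"
  by (metis norm_fst_le prod.collapse, metis norm_snd_le prod.collapse)

section \<open>A positive Hahn-Banach theorem\<close>

definition sublinear :: "('a::real_vector \<Rightarrow> real) \<Rightarrow> bool"
  where "sublinear q \<longleftrightarrow> (\<forall>x y. q (x + y) \<le> q x + q y) \<and> q 0 = 0 \<and> (\<forall>t>0. \<forall>x. q (t *\<^sub>R x) \<le> t * q x)"

lemma sublinearD:
  assumes "sublinear q"
  shows "q (x + y) \<le> q x + q y" "q 0 = 0" "t > 0 \<Longrightarrow> q (t *\<^sub>R x) = t * q x"
    "- q (- x) \<le> q x"
proof -
  show sub: "q (x + y) \<le> q x + q y" for x y using assms by (simp add: sublinear_def)
  show zero: "q 0 = 0" using assms by (simp add: sublinear_def)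
  show "q (t *\<^sub>R x) = t * q x" if "t > 0"
  proof (rule antisym)
    show "q (t *\<^sub>R x) \<le> t * q x" using assms that by (simp add: sublinear_def)
    have "q ((1/t) *\<^sub>R (t *\<^sub>R x)) \<le> (1/t) * q (t *\<^sub>R x)"
      using assms that unfolding sublinear_def by (meson zero_less_divide_1_iff)
    then show "t * q x \<le> q (t *\<^sub>R x)" using that by (simp add: field_simps)
  qed
  show "- q (- x) \<le> q x" using sub[of x "- x"] zero by simp
qed

text \<open>If \<open>q\<close> is not already odd in the direction \<open>y\<close>, this functional \<open>r\<close> is strictly smaller than \<open>q\<close>. Hence a
minimal sublinear functional is odd, and being subadditive it is then linear.\<close>

lemma sublinear_reduce:
  fixes q :: "'a::real_vector \<Rightarrow> real"
  assumes q: "sublinear q"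
  shows "\<exists>r. sublinear r \<and> (\<forall>x. r x \<le> q x) \<and> r (- y) \<le> - q y"
proof -
  define r where "r x = (INF t\<in>{0..}. q (x + t *\<^sub>R y) - t * q y)" for x
  have qt: "q (t *\<^sub>R y) = t * q y" if "t \<ge> 0" for t
    using that sublinearD(2,3)[OF q] by (cases "t = 0") auto
  have lower: "- q (- x) \<le> q (x + t *\<^sub>R y) - t * q y" if "t \<ge> 0" for x t
    using sublinearD(1)[OF q, of "x + t *\<^sub>R y" "- x"] qt[OF that] by simp
  have bdd: "bdd_below ((\<lambda>t. q (x + t *\<^sub>R y) - t * q y) ` {0..})" for x
    by (rule bdd_belowI[where m = "- q (- x)"]) (use lower in auto)
  have le: "r x \<le> q (x + t *\<^sub>R y) - t * q y" if "t \<ge> 0" for x t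
    unfolding r_def by (rule cINF_lower[OF bdd]) (use that in auto)
  have ge: "c \<le> r x" if "\<And>t. t \<ge> 0 \<Longrightarrow> c \<le> q (x + t *\<^sub>R y) - t * q y" for c x
    unfolding r_def by (rule cINF_greatest) (use that in auto)
  have "sublinear r"
    unfolding sublinear_def
  proof (intro conjI allI impI)
    fix u v
    have *: "r (u + v) \<le> (q (u + s *\<^sub>R y) - s * q y) + (q (v + t *\<^sub>R y) - t * q y)"
      if "s \<ge> 0" "t \<ge> 0" for s t
      using le[of "s + t" "u + v"] sublinearD(1)[OF q, of "u + s *\<^sub>R y" "v + t *\<^sub>R y"] that
      by (simp add: algebra_simps)
    have "r (u + v) - (q (u + s *\<^sub>R y) - s * q y) \<le> r v" if "s \<ge> 0" for s
      by (rule ge) (use *[OF that] in \<open>simp add: algebra_simps\<close>)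
    then have "r (u + v) - r v \<le> r u"
      by (intro ge) (simp add: algebra_simps)
    then show "r (u + v) \<le> r u + r v" by simp
  next
    have "0 \<le> r 0" by (rule ge) (simp add: qt)
    then show "r 0 = 0" using le[of 0 0] sublinearD(2)[OF q] by simp
  next
    fix s :: real and x
    assume s: "s > 0"
    have "r (s *\<^sub>R x) / s \<le> r x"
    proof (rule ge)
      fix t :: real assume t: "t \<ge> 0"
      have "r (s *\<^sub>R x) \<le> q (s *\<^sub>R x + (s * t) *\<^sub>R y) - (s * t) * q y"
        by (rule le) (use s t in simp)
      also have "s *\<^sub>R x + (s * t) *\<^sub>R y = s *\<^sub>R (x + t *\<^sub>R y)" by (simp add: algebra_simps)
      finally have "r (s *\<^sub>R x) \<le> (q (x + t *\<^sub>R y) - t * q y) * s"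
        by (simp only: sublinearD(3)[OF q s]) (simp add: algebra_simps del: scaleR_right_distrib)
      then show "r (s *\<^sub>R x) / s \<le> q (x + t *\<^sub>R y) - t * q y"
        by (simp only: pos_divide_le_eq[OF s])
    qed
    then show "r (s *\<^sub>R x) \<le> s * r x" using s by (simp add: field_simps)
  qed
  moreover have "r x \<le> q x" for x using le[of 0 x] by simp
  moreover have "r (- y) \<le> - q y" using le[of 1 "- y"] sublinearD(2)[OF q] by simp
  ultimately show ?thesis by blast
qed

lemma minimal_sublinear_below:
  fixes p :: "'a::real_vector \<Rightarrow> real"
  assumes p: "sublinear p"
  obtains m where "sublinear m" "m \<le> p" "\<And>q. sublinear q \<Longrightarrow> q \<le> m \<Longrightarrow> q = m"
proof -
  define A where "A = {q. sublinear q \<and> q \<le> p}"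
  have "\<exists>m\<in>A. \<forall>a\<in>A. a \<le> m \<longrightarrow> a = m"
  proof (rule predicate_Zorn)
    show "partial_order_on A (relation_of (\<lambda>a b. b \<le> a) A)"
      by (auto simp: partial_order_on_def preorder_on_def refl_on_def trans_def antisym_def
          relation_of_def)
    fix C assume C: "C \<in> Chains (relation_of (\<lambda>a b. b \<le> a) A)"
    then have CA: "C \<subseteq> A" and chain: "\<And>a b. a \<in> C \<Longrightarrow> b \<in> C \<Longrightarrow> a \<le> b \<or> b \<le> a"
      by (auto simp: Chains_def relation_of_def)
    show "\<exists>u\<in>A. \<forall>a\<in>C. u \<le> a"
    proof (cases "C = {}")
      case True
      then show ?thesis using p by (auto simp: A_def)
    next
      case False
      define u where "u x = (INF q\<in>C. q x)" for x
      have lower: "- p (- x) \<le> q x" if "q \<in> C" for q x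
      proof -
        have "sublinear q" "q (- x) \<le> p (- x)" using that CA by (auto simp: A_def le_fun_def)
        then show ?thesis using sublinearD(4)[of q x] by linarith
      qed
      have le: "u x \<le> q x" if "q \<in> C" for q x
        unfolding u_def using that lower by (intro cINF_lower bdd_belowI[where m = "- p (- x)"]) auto
      have ge: "c \<le> u x" if "\<And>q. q \<in> C \<Longrightarrow> c \<le> q x" for c x
        unfolding u_def using False that by (intro cINF_greatest) auto
      have sl: "sublinear q" if "q \<in> C" for q using CA that by (auto simp: A_def)
      have "sublinear u"
        unfolding sublinear_def
      proof (intro conjI allI impI)
        fix x y
        have *: "u (x + y) \<le> q1 x + q2 y" if qs: "q1 \<in> C" "q2 \<in> C" for q1 q2
        proof -
          obtain q where q: "q \<in> C" "q \<le> q1" "q \<le> q2"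
            using chain[OF qs] qs by blast
          have "u (x + y) \<le> q x + q y"
            using le[OF q(1), of "x + y"] sublinearD(1)[OF sl[OF q(1)], of x y] by linarith
          also have "\<dots> \<le> q1 x + q2 y" using q(2,3) by (auto simp: le_fun_def intro: add_mono)
          finally show ?thesis .
        qed
        have "u (x + y) - q1 x \<le> u y" if "q1 \<in> C" for q1
          by (rule ge) (use *[OF that] in \<open>simp add: algebra_simps\<close>)
        then have "u (x + y) - u y \<le> u x"
          by (intro ge) (simp add: algebra_simps)
        then show "u (x + y) \<le> u x + u y" by simp
      next
        obtain q where "q \<in> C" using False by auto
        then have "u 0 \<le> 0" using le[of q 0] sublinearD(2)[OF sl[of q]] by linarith
        moreover have "0 \<le> u 0" by (rule ge) (simp add: sublinearD(2)[OF sl])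
        ultimately show "u 0 = 0" by simp
      next
        fix t :: real and x assume t: "t > 0"
        have "u (t *\<^sub>R x) / t \<le> u x"
        proof (rule ge)
          fix q assume "q \<in> C"
          then show "u (t *\<^sub>R x) / t \<le> q x"
            using le[of q "t *\<^sub>R x"] sublinearD(3)[OF sl t, of q x] t by (simp add: field_simps)
        qed
        then show "u (t *\<^sub>R x) \<le> t * u x" using t by (simp add: field_simps)
      qed
      moreover have "u \<le> p"
      proof -
        obtain q where "q \<in> C" using False by auto
        then have "q \<le> p" "u \<le> q" using le CA by (auto simp: A_def le_fun_def)
        then show ?thesis by simp
      qed
      ultimately have "u \<in> A" by (simp add: A_def)
      then show ?thesis using le by (auto simp: le_fun_def)
    qed
  qed
  then obtain m where m: "m \<in> A" "\<forall>a\<in>A. a \<le> m \<longrightarrow> a = m" by blast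
  show ?thesis
  proof (rule that)
    show "sublinear m" "m \<le> p" using m(1) by (auto simp: A_def)
    show "q = m" if "sublinear q" "q \<le> m" for q
      using m that order_trans[of q m p] by (auto simp: A_def)
  qed
qed

text \<open>The Hahn-Banach theorem. One reduction in the direction \<open>g\<close> forces the value at \<open>g\<close>; a minimal
sublinear functional below the result is linear and still has this value.\<close>

lemma sublinear_supporting_functional:
  fixes p :: "'a::real_vector \<Rightarrow> real"
  assumes p: "sublinear p"
  shows "\<exists>f. linear f \<and> (\<forall>x. f x \<le> p x) \<and> f g = p g"
proof -
  \<comment> \<open>Below \<open>r\<close> the value at \<open>- g\<close> is at most \<open>- p g\<close>, so a linear functional below \<open>r\<close> is at least \<open>p g\<close> at \<open>g\<close>.\<close>
  obtain r where r: "sublinear r" "\<And>x. r x \<le> p x" "r (- g) \<le> - p g"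
    using sublinear_reduce[OF p] by blast
  obtain m where m: "sublinear m" "m \<le> r" "\<And>q. sublinear q \<Longrightarrow> q \<le> m \<Longrightarrow> q = m"
    using minimal_sublinear_below[OF r(1)] by blast
  have neg: "m (- y) = - m y" for y
  proof -
    obtain r' where r': "sublinear r'" "\<forall>x. r' x \<le> m x" "r' (- y) \<le> - m y"
      using sublinear_reduce[OF m(1)] by blast
    then have "r' = m" by (intro m(3)) (auto simp: le_fun_def)
    then show ?thesis using r'(3) sublinearD(4)[OF m(1), of "- y"] by simp
  qed
  have add: "m (x + y) = m x + m y" for x y
    using sublinearD(1)[OF m(1), of x y] sublinearD(1)[OF m(1), of "x + y" "- y"] neg[of y]
    by simp
  have scale: "m (t *\<^sub>R x) = t * m x" for t x
  proof (cases "t = 0" "t > 0" rule: bool.exhaust[case_product bool.exhaust])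
    case False_False
    then have "m ((- t) *\<^sub>R x) = (- t) * m x" by (intro sublinearD(3)[OF m(1)]) auto
    then show ?thesis using neg[of "t *\<^sub>R x"] by simp
  qed (use sublinearD(2,3)[OF m(1)] in auto)
  have "linear m" by (rule linearI) (simp_all add: add scale)
  moreover have le: "m x \<le> p x" for x using m(2) r(2)[of x] by (meson le_fun_def order_trans)
  moreover have "m g = p g"
    using le[of g] neg[of g] le_funD[OF m(2), of "- g"] r(3) by linarith
  ultimately show ?thesis by blast
qed

text \<open>Domination by \<open>\<parallel>pprt x\<parallel>\<close> instead of \<open>\<parallel>x\<parallel>\<close> makes the functional positive, since \<open>pprt (- x) = 0\<close> for \<open>x \<ge> 0\<close>.\<close>

lemma positive_norming_functional:
  fixes g :: "'a::banach_lattice"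
  assumes "0 \<le> g"
  obtains f :: "'a \<Rightarrow> real"
  where "positive_operator f" "\<And>x. \<bar>f x\<bar> \<le> norm x" "f g = norm g"
proof -
  have "sublinear (\<lambda>x::'a. norm (pprt x))"
    unfolding sublinear_def
  proof (intro conjI allI impI)
    show "norm (pprt (x + y)) \<le> norm (pprt x) + norm (pprt y)" for x y :: 'a
      using norm_mono_pos[OF zero_le_pprt pprt_add_le, of x y]
        norm_triangle_ineq[of "pprt x" "pprt y"] by linarith
    show "norm (pprt (t *\<^sub>R x)) \<le> t * norm (pprt x)" if "0 < t" for t and x :: 'a
      using norm_mono_pos[OF zero_le_pprt pprt_scaleR_le, of t x] that by simp
  qed simp
  then obtain f where f: "linear f" "\<And>x. f x \<le> norm (pprt x)" "f g = norm (pprt g)"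
    using sublinear_supporting_functional[where g = g] by blast
  have le: "f x \<le> norm x" for x using f(2)[of x] norm_pprt_le[of x] by linarith
  show ?thesis
  proof (rule that)
    show "positive_operator f"
      unfolding positive_operator_def
    proof (intro conjI allI impI)
      fix x :: 'a assume "0 \<le> x"
      then show "0 \<le> f x" using f(2)[of "- x"] by (simp add: linear_neg[OF f(1)])
    qed (rule f(1))
    show "\<bar>f x\<bar> \<le> norm x" for x
      using le[of x] le[of "- x"] by (simp add: linear_neg[OF f(1)] abs_le_iff)
    show "f g = norm g" using f(3) assms by simp
  qed
qed

section \<open>Sequences bounded in \<open>l\<^sup>p\<close> and Minkowski's inequality\<close>

text \<open>The sequence \<open>a\<close> lies in the positive cone of \<open>l\<^sup>p\<close> and has norm at most \<open>K\<close>. Bounding the finite partial sums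
avoids summability conditions and makes sense over every index type.\<close>

definition lp_bounded :: "ennreal \<Rightarrow> real \<Rightarrow> ('i \<Rightarrow> real) \<Rightarrow> bool"
  where "lp_bounded p K a \<longleftrightarrow> 0 \<le> K \<and> (\<forall>i. 0 \<le> a i) \<and>
    (if p = \<infinity> then \<forall>i. a i \<le> K
     else \<forall>F. finite F \<longrightarrow> (\<Sum>i\<in>F. a i powr enn2real p) \<le> K powr enn2real p)"

lemma lp_boundedD: "lp_bounded p K a \<Longrightarrow> 0 \<le> K" "lp_bounded p K a \<Longrightarrow> 0 \<le> a i"
  by (auto simp: lp_bounded_def)

lemma enn2real_ge_1: "1 \<le> p \<Longrightarrow> p \<noteq> \<infinity> \<Longrightarrow> 1 \<le> enn2real p"
  by (cases p) (auto simp: ennreal_1[symmetric] simp del: ennreal_1)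

lemma lp_bounded_entry_le:
  assumes "1 \<le> p" "lp_bounded p K a"
  shows "a i \<le> K"
proof (cases "p = \<infinity>")
  case False
  then have q: "enn2real p > 0" using enn2real_ge_1[OF assms(1)] by linarith
  have "(\<Sum>i\<in>{i}. a i powr enn2real p) \<le> K powr enn2real p"
    using assms(2) False unfolding lp_bounded_def by (metis finite.emptyI finite_insert)
  then have le: "a i powr enn2real p \<le> K powr enn2real p" by simp
  show ?thesis
  proof (rule ccontr)
    assume "\<not> a i \<le> K"
    then have "K powr enn2real p < a i powr enn2real p"
      using q lp_boundedD(1)[OF assms(2)] by (intro powr_less_mono2) auto
    then show False using le by simp
  qed
qed (use assms(2) in \<open>auto simp: lp_bounded_def\<close>)

text \<open>Domination along an injection covers at once subsequences, shifts in both directions, and pointwise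
comparison.\<close>

lemma lp_bounded_reindex:
  assumes p: "1 \<le> p" and a: "lp_bounded p K a"
    and inj: "inj_on g {j. b j \<noteq> 0}"
    and b: "\<And>j. 0 \<le> b j" "\<And>j. b j \<noteq> 0 \<Longrightarrow> b j \<le> a (g j)"
  shows "lp_bounded p K b"
proof (cases "p = \<infinity>")
  case True
  have "b j \<le> K" for j
    using b(2)[of j] lp_bounded_entry_le[OF p a, of "g j"] lp_boundedD(1)[OF a] by fastforce
  then show ?thesis using True b(1) lp_boundedD(1)[OF a] by (auto simp: lp_bounded_def)
next
  case False
  define q where "q = enn2real p"
  have q: "q \<ge> 1" using enn2real_ge_1[OF p False] by (simp add: q_def)
  have "(\<Sum>j\<in>F. b j powr q) \<le> K powr q" if "finite F" for F
  proof -
    let ?G = "{j\<in>F. b j \<noteq> 0}"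
    have "(\<Sum>j\<in>F. b j powr q) = (\<Sum>j\<in>?G. b j powr q)"
      by (rule sum.mono_neutral_right) (use that in auto)
    also have "\<dots> \<le> (\<Sum>j\<in>?G. a (g j) powr q)"
      by (rule sum_mono) (use b q in \<open>auto intro!: powr_mono2\<close>)
    also have "\<dots> = (\<Sum>i\<in>g ` ?G. a i powr q)"
      by (subst sum.reindex) (use inj in \<open>auto simp: inj_on_def\<close>)
    also have "\<dots> \<le> K powr q"
      using a False that unfolding lp_bounded_def q_def by simp
    finally show ?thesis .
  qed
  then show ?thesis using False b(1) lp_boundedD(1)[OF a] by (simp add: lp_bounded_def q_def)
qed

lemma lp_bounded_mono:
  assumes "1 \<le> p" "lp_bounded p K a" "\<And>j. 0 \<le> b j" "\<And>j. b j \<le> a j"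
  shows "lp_bounded p K b"
  by (rule lp_bounded_reindex[where g = id, OF assms(1,2)]) (use assms in auto)

lemma lp_bounded_bound_mono:
  assumes "lp_bounded p K a" "K \<le> K'"
  shows "lp_bounded p K' a"
proof -
  have "K powr enn2real p \<le> K' powr enn2real p"
    using assms lp_boundedD(1)[OF assms(1)] by (intro powr_mono2) auto
  then show ?thesis using assms unfolding lp_bounded_def
    by (auto split: if_splits intro: order_trans)
qed

lemma lp_bounded_single:
  assumes "0 \<le> K"
  shows "lp_bounded p K (\<lambda>i. if i = m then K else 0)"
proof -
  have "(\<Sum>i\<in>F. (if i = m then K else 0) powr q) \<le> K powr q" if "finite F" for F and q :: real
  proof -
    have "(\<Sum>i\<in>F. (if i = m then K else 0) powr q) = (\<Sum>i\<in>F. if i = m then K powr q else 0)"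
      by (rule sum.cong) auto
    then show ?thesis using that by simp
  qed
  then show ?thesis using assms by (simp add: lp_bounded_def)
qed

lemma lp_bounded_scale:
  assumes "lp_bounded p K a" "0 \<le> c"
  shows "lp_bounded p (c * K) (\<lambda>i. c * a i)"
proof -
  have "(\<Sum>i\<in>F. (c * a i) powr q) = c powr q * (\<Sum>i\<in>F. a i powr q)" for F q
    using assms(2) lp_boundedD(2)[OF assms(1)] by (simp add: powr_mult sum_distrib_left)
  then show ?thesis
    using assms unfolding lp_bounded_def
    by (auto simp: powr_mult intro!: mult_left_mono split: if_splits)
qed

lemma powr_convex_nonneg:
  fixes x y s t :: real
  assumes q: "1 \<le> q" and st: "0 \<le> s" "0 \<le> t" "s + t = 1" and xy: "0 \<le> x" "0 \<le> y"
  shows "(s * x + t * y) powr q \<le> s * x powr q + t * y powr q"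
proof -
  have le: "t powr q \<le> t" if "0 \<le> t" "t \<le> 1" for t :: real
    using powr_mono'[OF q that] that by (cases "t = 0") auto
  consider "x = 0" | "y = 0" | "x > 0" "y > 0" using xy by linarith
  then show ?thesis
  proof cases
    case 1
    then show ?thesis using le[of t] st q by (simp add: powr_mult mult_right_mono)
  next
    case 2
    then show ?thesis using le[of s] st q by (simp add: powr_mult mult_right_mono)
  next
    case 3
    have s: "s = 1 - t" using st(3) by simp
    show ?thesis
      unfolding s using convex_onD[OF powr_convex[OF q], of t x y] st 3 by simp
  qed
qed

text \<open>Minkowski's inequality, from the convexity of \<open>x powr q\<close>: after division by \<open>K + L\<close> the sum is a convex combination
of \<open>a i / K\<close> and \<open>b i / L\<close>.\<close>

lemma lp_bounded_add:
  assumes p: "1 \<le> p" and a: "lp_bounded p K a" and b: "lp_bounded p L b"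
  shows "lp_bounded p (K + L) (\<lambda>i. a i + b i)"
proof (cases "p = \<infinity> \<or> K = 0 \<or> L = 0")
  case True
  then consider "p = \<infinity>" | "K = 0" | "L = 0" by blast
  then show ?thesis
  proof cases
    case 1
    then show ?thesis using a b by (auto simp: lp_bounded_def add_mono)
  next
    case 2
    then have "a i = 0" for i
      using lp_bounded_entry_le[OF p a, of i] lp_boundedD(2)[OF a, of i] by simp
    then show ?thesis using b 2 by simp
  next
    case 3
    then have "b i = 0" for i
      using lp_bounded_entry_le[OF p b, of i] lp_boundedD(2)[OF b, of i] by simp
    then show ?thesis using a 3 by simp
  qed
next
  case False
  define q where "q = enn2real p"
  have q: "q \<ge> 1" using enn2real_ge_1[OF p] False by (simp add: q_def)
  have K: "K > 0" and L: "L > 0"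
    using False lp_boundedD(1)[OF a] lp_boundedD(1)[OF b] by auto
  note nn = lp_boundedD(2)[OF a] lp_boundedD(2)[OF b]
  have conv: "(a i + b i) powr q
    \<le> (K + L) powr q * (K / (K + L) * (a i powr q / K powr q) + L / (K + L) * (b i powr q / L powr q))" for i
  proof -
    have eq: "K / (K + L) * (a i / K) + L / (K + L) * (b i / L) = (a i + b i) / (K + L)"
      using K L by (simp add: add_divide_distrib)
    have "(K / (K + L) * (a i / K) + L / (K + L) * (b i / L)) powr q
      \<le> K / (K + L) * (a i / K) powr q + L / (K + L) * (b i / L) powr q"
      by (rule powr_convex_nonneg[OF q]) (use K L nn[of i] in \<open>auto simp: add_divide_distrib[symmetric]\<close>)
    then have "((a i + b i) / (K + L)) powr q \<le>
       K / (K + L) * (a i / K) powr q + L / (K + L) * (b i / L) powr q"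
      unfolding eq .
    then show ?thesis using K L nn[of i] by (simp add: powr_divide pos_divide_le_eq mult.commute)
  qed
  have "(\<Sum>i\<in>F. (a i + b i) powr q) \<le> (K + L) powr q" if F: "finite F" for F
  proof -
    have sa: "(\<Sum>i\<in>F. a i powr q) \<le> K powr q" and sb: "(\<Sum>i\<in>F. b i powr q) \<le> L powr q"
      using a b F False unfolding lp_bounded_def q_def by simp_all
    have "(\<Sum>i\<in>F. (a i + b i) powr q)
      \<le> (\<Sum>i\<in>F. (K + L) powr q * (K / (K + L) * (a i powr q / K powr q) + L / (K + L) * (b i powr q / L powr q)))"
      by (rule sum_mono) (rule conv)
    also have "\<dots> = (K + L) powr q * (K / (K + L) * ((\<Sum>i\<in>F. a i powr q) / K powr q)
        + L / (K + L) * ((\<Sum>i\<in>F. b i powr q) / L powr q))"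
      by (simp only: sum_distrib_left[symmetric] sum.distrib sum_divide_distrib[symmetric])
    also have "\<dots> \<le> (K + L) powr q * (K / (K + L) * 1 + L / (K + L) * 1)"
      using K L sa sb by (intro mult_left_mono add_mono) (auto simp: pos_divide_le_eq)
    also have "K / (K + L) * 1 + L / (K + L) * 1 = 1"
      using K L by (simp add: add_divide_distrib[symmetric])
    finally show ?thesis by simp
  qed
  then show ?thesis using False K L nn unfolding lp_bounded_def q_def[symmetric] by auto
qed

text \<open>Minkowski's inequality for series: the closed unit ball of \<open>l\<^sup>p\<close> is closed under pointwise limits.\<close>

lemma lp_bounded_suminf:
  assumes p: "1 \<le> p" and f: "\<And>m. lp_bounded p (h m) (f m)" and h: "summable h"
    and g: "\<And>r. 0 \<le> g r" "\<And>r. g r \<le> (\<Sum>m. f m r)"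
  shows "lp_bounded p (suminf h) g"
proof -
  have h0: "0 \<le> h m" for m using lp_boundedD(1)[OF f] .
  have f0: "0 \<le> f m r" for m r using lp_boundedD(2)[OF f] .
  have sf: "summable (\<lambda>m. f m r)" for r
    by (rule summable_comparison_test'[OF h, of 0])
       (use lp_bounded_entry_le[OF p f] f0 in auto)
  have fin: "lp_bounded p (\<Sum>m<N. h m) (\<lambda>r. \<Sum>m<N. f m r)" for N :: nat
  proof (induction N)
    case 0
    then show ?case by (simp add: lp_bounded_def)
  next
    case (Suc N)
    then show ?case using lp_bounded_add[OF p Suc f[of N]] by simp
  qed
  have fin': "lp_bounded p (suminf h) (\<lambda>r. \<Sum>m<N. f m r)" for N :: nat
    by (rule lp_bounded_bound_mono[OF fin sum_le_suminf]) (use h h0 in auto)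
  have lim: "(\<lambda>N. \<Sum>m<N. f m r) \<longlonglongrightarrow> (\<Sum>m. f m r)" for r
    using sf by (rule summable_LIMSEQ)
  have nn: "0 \<le> (\<Sum>m. f m r)" for r by (rule suminf_nonneg[OF sf f0])
  have "lp_bounded p (suminf h) (\<lambda>r. \<Sum>m. f m r)"
  proof (cases "p = \<infinity>")
    case True
    have "(\<Sum>m. f m r) \<le> suminf h" for r
      by (rule suminf_le[OF lp_bounded_entry_le[OF p f] sf h])
    then show ?thesis using True nn suminf_nonneg[OF h h0] by (simp add: lp_bounded_def)
  next
    case False
    define q where "q = enn2real p"
    have q: "q \<ge> 1" using enn2real_ge_1[OF p] False by (simp add: q_def)
    have "(\<Sum>r\<in>F. (\<Sum>m. f m r) powr q) \<le> suminf h powr q" if F: "finite F" for F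
    proof (rule LIMSEQ_le_const2)
      show "(\<lambda>N. \<Sum>r\<in>F. (\<Sum>m<N. f m r) powr q) \<longlonglongrightarrow> (\<Sum>r\<in>F. (\<Sum>m. f m r) powr q)"
        by (intro tendsto_sum tendsto_powr' lim tendsto_const)
           (use q f0 in \<open>auto intro!: sum_nonneg always_eventually\<close>)
      show "\<exists>N. \<forall>n\<ge>N. (\<Sum>r\<in>F. (\<Sum>m<n. f m r) powr q) \<le> suminf h powr q"
        using fin' F False unfolding lp_bounded_def q_def by simp
    qed
    then show ?thesis
      using False nn suminf_nonneg[OF h h0] by (simp add: lp_bounded_def q_def)
  qed
  then show ?thesis by (rule lp_bounded_mono[OF p]) (use g in auto)
qed

lemma lp_bounded_summable:
  assumes "1 \<le> p" "summable h" "\<And>m. 0 \<le> h m"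
  shows "lp_bounded p (suminf h) (h :: nat \<Rightarrow> real)"
proof (rule lp_bounded_suminf[OF assms(1) _ assms(2) assms(3)])
  show "lp_bounded p (h m) (\<lambda>i. if i = m then h m else 0)" for m
    by (rule lp_bounded_single) (rule assms(3))
  show "h r \<le> (\<Sum>m. if r = m then h m else 0)" for r
    using suminf_finite[of "{r}" "\<lambda>m. if r = m then h m else 0"] by simp
qed

text \<open>Young's inequality for \<open>l\<^sup>1\<close> and \<open>l\<^sup>p\<close>, in a form where the second factor may vary with the summation index.\<close>

lemma lp_bounded_convolution:
  fixes h :: "nat \<Rightarrow> real"
  assumes p: "1 \<le> p" and h: "summable h" "\<And>i. 0 \<le> h i" and f: "\<And>i. lp_bounded p K (f i)"
  shows "lp_bounded p (suminf h * K) (\<lambda>r. \<Sum>i\<le>r. h i * f i (r - i))"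
proof -
  let ?F = "\<lambda>i r. if i \<le> r then h i * f i (r - i) else 0"
  have "lp_bounded p (\<Sum>i. h i * K) (\<lambda>r. \<Sum>i\<le>r. h i * f i (r - i))"
  proof (rule lp_bounded_suminf[OF p])
    show "lp_bounded p (h i * K) (?F i)" for i
      by (rule lp_bounded_reindex[OF p lp_bounded_scale[OF f h(2)], where g = "\<lambda>r. r - i"])
         (auto simp: inj_on_def h(2) lp_boundedD(2)[OF f] split: if_splits)
    show "summable (\<lambda>i. h i * K)" using h(1) by (rule summable_mult2)
    show "0 \<le> (\<Sum>i\<le>r. h i * f i (r - i))" for r
      by (intro sum_nonneg mult_nonneg_nonneg h(2) lp_boundedD(2)[OF f])
    show "(\<Sum>i\<le>r. h i * f i (r - i)) \<le> (\<Sum>i. ?F i r)" for r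
      using suminf_finite[of "{..r}" "\<lambda>i. ?F i r"] by simp
  qed
  then show ?thesis by (simp add: suminf_mult2[OF h(1)])
qed

section \<open>Coordinates that identify a Banach lattice with its \<open>l\<^sup>p\<close>-sum\<close>

text \<open>The maps \<open>\<rho> n\<close> are the entries of an isometric lattice isomorphism of \<open>'x\<close> onto the \<open>l\<^sup>p\<close>-sum of countably many copies
of \<open>'x\<close>. The bounds are stated by \<open>lp_bounded\<close>, so that estimates in coordinates do not distinguish \<open>p = \<infinity>\<close>.\<close>

locale lp_coordinates =
  fixes p :: ennreal and \<rho> :: "nat \<Rightarrow> 'x::banach_lattice \<Rightarrow> 'x"
  assumes p_ge_1: "1 \<le> p"
    and linear_coord: "linear (\<rho> n)"
    and bounded_coords: "lp_bounded p (norm x) (\<lambda>n. norm (\<rho> n x))"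
    and exists_coords: "lp_bounded p K (\<lambda>n. norm (s n)) \<Longrightarrow> \<exists>x. (\<forall>n. \<rho> n x = s n) \<and> norm x \<le> K"
    and nonneg_iff_coords: "0 \<le> x \<longleftrightarrow> (\<forall>n. 0 \<le> \<rho> n x)"
begin

lemma positive_coord: "positive_operator (\<rho> n)"
  unfolding positive_operator_def
proof (intro conjI allI impI)
  show "0 \<le> \<rho> n x" if "0 \<le> x" for x
    using nonneg_iff_coords[of x] that by blast
qed (rule linear_coord)

lemma norm_coord_le: "norm (\<rho> n x) \<le> norm x"
  using lp_bounded_entry_le[OF p_ge_1 bounded_coords] .

lemma coords_eqI:
  assumes "\<And>n. \<rho> n x = \<rho> n y"
  shows "x = y"
proof -
  have "\<rho> n (x - y) = 0" "\<rho> n (y - x) = 0" for n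
    using assms by (simp_all add: linear_diff[OF linear_coord])
  then have "0 \<le> x - y" "0 \<le> y - x"
    by (simp_all only: nonneg_iff_coords[of "x - y"] nonneg_iff_coords[of "y - x"]) auto
  then show ?thesis by (simp add: order.antisym)
qed

lemma norm_le_coords: "lp_bounded p K (\<lambda>n. norm (\<rho> n x)) \<Longrightarrow> norm x \<le> K"
  using exists_coords[of K "\<lambda>n. \<rho> n x"] coords_eqI by metis

definition assemble :: "(nat \<Rightarrow> 'x) \<Rightarrow> 'x"
  where "assemble s = (THE x. \<forall>n. \<rho> n x = s n)"

lemma coord_assemble:
  assumes "lp_bounded p K (\<lambda>n. norm (s n))"
  shows "\<rho> n (assemble s) = s n"
proof -
  obtain x where x: "\<forall>n. \<rho> n x = s n" using exists_coords[OF assms] by blast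
  have "assemble s = x"
    unfolding assemble_def
  proof (rule the_equality)
    show "y = x" if "\<forall>n. \<rho> n y = s n" for y
      by (rule coords_eqI) (simp add: x that)
  qed (rule x)
  then show ?thesis using x by simp
qed

text \<open>Positive operators into the space are constructed entrywise. Linearity and positivity are automatic, and only
membership in the \<open>l\<^sup>p\<close>-sum has to be checked, for each argument separately and without uniformity.\<close>

lemma positive_operator_assemble:
  fixes F :: "nat \<Rightarrow> 'z::{real_vector, ord} \<Rightarrow> 'x"
  assumes F: "\<And>n. positive_operator (F n)"
    and bounded: "\<And>z. \<exists>K. lp_bounded p K (\<lambda>n. norm (F n z))"
  shows "positive_operator (\<lambda>z. assemble (\<lambda>n. F n z))"
    "\<rho> n (assemble (\<lambda>n. F n z)) = F n z"
proof -
  show coord: "\<rho> n (assemble (\<lambda>n. F n z)) = F n z" for n z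
  proof -
    obtain K where "lp_bounded p K (\<lambda>n. norm (F n z))" using bounded by blast
    then show ?thesis by (rule coord_assemble)
  qed
  note lin = positive_operatorD(1)[OF F]
  show "positive_operator (\<lambda>z. assemble (\<lambda>n. F n z))"
    unfolding positive_operator_def
  proof (intro conjI allI impI linearI)
    fix z z' :: 'z and c
    show "assemble (\<lambda>n. F n (z + z')) = assemble (\<lambda>n. F n z) + assemble (\<lambda>n. F n z')"
      by (rule coords_eqI)
         (simp only: linear_add[OF linear_coord] coord, simp only: linear_add[OF lin])
    show "assemble (\<lambda>n. F n (c *\<^sub>R z)) = c *\<^sub>R assemble (\<lambda>n. F n z)"
      by (rule coords_eqI)
         (simp only: linear_scale[OF linear_coord] coord, simp only: linear_scale[OF lin])
  next
    fix z :: 'z assume "0 \<le> z"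
    then show "0 \<le> assemble (\<lambda>n. F n z)"
      by (subst nonneg_iff_coords) (simp add: coord positive_operatorD(2)[OF F])
  qed
qed

definition restrict :: "nat set \<Rightarrow> 'x \<Rightarrow> 'x"
  where "restrict M x = assemble (\<lambda>n. if n \<in> M then \<rho> n x else 0)"

lemma restrict:
  shows positive_operator_restrict: "positive_operator (restrict M)"
    and coord_restrict: "\<rho> n (restrict M x) = (if n \<in> M then \<rho> n x else 0)"
proof -
  let ?F = "\<lambda>n x. if n \<in> M then \<rho> n x else 0"
  have pos: "positive_operator (?F n)" for n
    using positive_coord[of n] by (cases "n \<in> M") (auto simp: positive_operator_def linear_zero)
  have bdd: "\<exists>K. lp_bounded p K (\<lambda>n. norm (?F n x))" for x
    by (rule exI, rule lp_bounded_mono[OF p_ge_1 bounded_coords[of x]]) auto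
  show "positive_operator (restrict M)"
    using positive_operator_assemble(1)[of ?F, OF pos bdd]
    by (simp add: restrict_def[abs_def])
  show "\<rho> n (restrict M x) = (if n \<in> M then \<rho> n x else 0)"
    using positive_operator_assemble(2)[of ?F, OF pos bdd, of n x] by (simp only: restrict_def)
qed

lemma norm_le_if_coords_le:
  assumes "\<And>n. norm (\<rho> n x) \<le> norm (\<rho> n y)"
  shows "norm x \<le> norm y"
  by (rule norm_le_coords, rule lp_bounded_mono[OF p_ge_1 bounded_coords]) (use assms in auto)

lemma norm_restrict_mono: "M \<subseteq> M' \<Longrightarrow> norm (restrict M x) \<le> norm (restrict M' x)"
  by (rule norm_le_if_coords_le) (auto simp: coord_restrict)

lemma norm_restrict_le: "norm (restrict M x) \<le> norm x"
  by (rule norm_le_if_coords_le) (auto simp: coord_restrict)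

lemma restrict_eq_self:
  assumes "\<And>n. n \<notin> M \<Longrightarrow> \<rho> n x = 0"
  shows "restrict M x = x"
  by (rule coords_eqI) (use assms in \<open>auto simp: coord_restrict\<close>)

text \<open>Along a bijection \<open>\<pi>\<close> the \<open>l\<^sup>p\<close>-sum becomes an \<open>l\<^sup>p\<close>-sum over pairs \<open>(n, j)\<close>. The \<open>n\<close>-th row is a sequence in
\<open>l\<^sup>p\<close> and so represents an element \<open>\<sigma> n x\<close> of the same space.\<close>

lemma lp_coordinates_regroup:
  assumes \<pi>: "bij \<pi>"
  shows "\<exists>\<sigma>. lp_coordinates p \<sigma> \<and> (\<forall>n j x. \<rho> j (\<sigma> n x) = \<rho> (\<pi> (n, j)) x)"
proof -
  define \<sigma> where "\<sigma> n x = assemble (\<lambda>j. \<rho> (\<pi> (n, j)) x)" for n x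
  have inj: "\<pi> (n, j) = \<pi> (n', j') \<longleftrightarrow> n = n' \<and> j = j'" for n j n' j'
    using bij_is_inj[OF \<pi>] by (auto simp: inj_eq)
  have row: "lp_bounded p (norm x) (\<lambda>j. norm (\<rho> (\<pi> (n, j)) x))" for n x
    by (rule lp_bounded_reindex[where g = "\<lambda>j. \<pi> (n, j)", OF p_ge_1 bounded_coords])
       (auto simp: inj_on_def inj)
  have row': "\<exists>K. lp_bounded p K (\<lambda>j. norm (\<rho> (\<pi> (n, j)) x))" for n x
    using row by blast
  have \<sigma>: "\<rho> j (\<sigma> n x) = \<rho> (\<pi> (n, j)) x" "positive_operator (\<sigma> n)" for n j x
    unfolding \<sigma>_def
    using positive_operator_assemble[of "\<lambda>j. \<rho> (\<pi> (n, j))", OF positive_coord row']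
    by auto
  have "lp_coordinates p \<sigma>"
  proof (rule lp_coordinates.intro)
    show "1 \<le> p" by (rule p_ge_1)
    show "linear (\<sigma> n)" for n using \<sigma>(2) by (rule positive_operatorD)
    show "0 \<le> x \<longleftrightarrow> (\<forall>n. 0 \<le> \<sigma> n x)" for x
    proof -
      have "(\<forall>m. 0 \<le> \<rho> m x) \<longleftrightarrow> (\<forall>n j. 0 \<le> \<rho> (\<pi> (n, j)) x)"
        using bij_is_surj[OF \<pi>] by (metis surj_def surj_pair)
      moreover have "0 \<le> \<sigma> n x \<longleftrightarrow> (\<forall>j. 0 \<le> \<rho> (\<pi> (n, j)) x)" for n
        using nonneg_iff_coords[of "\<sigma> n x"] by (simp only: \<sigma>(1))
      ultimately show ?thesis using nonneg_iff_coords[of x] by simp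
    qed
    have le: "norm (\<sigma> n x) \<le> K" if "lp_bounded p K (\<lambda>j. norm (\<rho> (\<pi> (n, j)) x))" for n x K
      by (rule norm_le_coords) (simp add: \<sigma>(1) that)
    show "lp_bounded p (norm x) (\<lambda>n. norm (\<sigma> n x))" for x
    proof (cases "p = \<infinity>")
      case True
      then show ?thesis using le[OF row] by (simp add: lp_bounded_def)
    next
      case False
      define q where "q = enn2real p"
      have q: "q \<ge> 1" using enn2real_ge_1[OF p_ge_1 False] by (simp add: q_def)
      let ?b = "\<lambda>m. norm (\<rho> m x) powr q"
      have approx: "\<exists>G. finite G \<and> norm (\<sigma> n x) powr q - e \<le> (\<Sum>j\<in>G. ?b (\<pi> (n, j)))"
        if e: "e > 0" for n and e :: real
      proof (rule ccontr)
        \<comment> \<open>Otherwise the row of \<open>n\<close> would have norm at most \<open>c powr (1/q)\<close>, which is less than its actual norm.\<close>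
        define c where "c = norm (\<sigma> n x) powr q - e"
        assume "\<not> ?thesis"
        then have c: "(\<Sum>j\<in>G. ?b (\<pi> (n, j))) < c" if "finite G" for G
          using that unfolding c_def by (meson not_le)
        have c0: "0 < c" using c[of "{}"] by simp
        have "(c powr (1/q)) powr q = c" using c0 q by (simp add: powr_powr)
        then have "lp_bounded p (c powr (1/q)) (\<lambda>j. norm (\<rho> (\<pi> (n, j)) x))"
          using False c by (auto simp: lp_bounded_def q_def[symmetric] intro: less_imp_le)
        then have "norm (\<sigma> n x) powr q \<le> (c powr (1/q)) powr q"
          using q by (intro powr_mono2 le) auto
        then show False using \<open>(c powr (1/q)) powr q = c\<close> e by (simp add: c_def)
      qed
      have "(\<Sum>n\<in>F. norm (\<sigma> n x) powr q) \<le> norm x powr q" if F: "finite F" for F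
      proof (rule field_le_epsilon)
        fix e :: real assume e: "0 < e"
        define e' where "e' = e / (real (card F) + 1)"
        have e': "e' > 0" using e by (simp add: e'_def)
        obtain G where G: "\<And>n. finite (G n)"
          "\<And>n. norm (\<sigma> n x) powr q - e' \<le> (\<Sum>j\<in>G n. ?b (\<pi> (n, j)))"
          using approx[OF e'] by metis
        have "(\<Sum>n\<in>F. norm (\<sigma> n x) powr q) \<le> (\<Sum>n\<in>F. (\<Sum>j\<in>G n. ?b (\<pi> (n, j))) + e')"
          by (intro sum_mono) (use G(2) in \<open>simp add: algebra_simps\<close>)
        also have "\<dots> = (\<Sum>nj\<in>Sigma F G. ?b (\<pi> nj)) + real (card F) * e'"
          using F G(1) by (simp add: sum.distrib sum.Sigma case_prod_unfold)
        also have "(\<Sum>nj\<in>Sigma F G. ?b (\<pi> nj)) = (\<Sum>m\<in>\<pi> ` Sigma F G. ?b m)"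
          using bij_is_inj[OF \<pi>] by (subst sum.reindex) (auto intro: inj_on_subset)
        also have "\<dots> \<le> norm x powr q"
          using bounded_coords[of x] False F G(1) by (simp add: lp_bounded_def q_def)
        also have "real (card F) * e' \<le> e"
          using e unfolding e'_def by (simp add: field_simps)
        finally show "(\<Sum>n\<in>F. norm (\<sigma> n x) powr q) \<le> norm x powr q + e" by simp
      qed
      then show ?thesis using False by (simp add: lp_bounded_def q_def)
    qed
    show "\<exists>x. (\<forall>n. \<sigma> n x = s n) \<and> norm x \<le> K" if s: "lp_bounded p K (\<lambda>n. norm (s n))" for s K
    proof -
      define t where "t m = \<rho> (snd (inv \<pi> m)) (s (fst (inv \<pi> m)))" for m
      have t\<pi>: "t (\<pi> (n, j)) = \<rho> j (s n)" for n j
        by (simp add: t_def inv_f_f[OF bij_is_inj[OF \<pi>]])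
      have "lp_bounded p K (\<lambda>m. norm (t m))"
      proof (cases "p = \<infinity>")
        case True
        have "norm (t m) \<le> K" for m
          unfolding t_def using lp_bounded_entry_le[OF p_ge_1 s] norm_coord_le by (meson order_trans)
        then show ?thesis using True lp_boundedD(1)[OF s] by (simp add: lp_bounded_def)
      next
        case False
        define q where "q = enn2real p"
        have "(\<Sum>m\<in>F. norm (t m) powr q) \<le> K powr q" if F: "finite F" for F
        proof -
          let ?I = "inv \<pi> ` F"
          have "(\<Sum>m\<in>F. norm (t m) powr q) = (\<Sum>(n,j)\<in>?I. norm (\<rho> j (s n)) powr q)"
            by (subst sum.reindex)
               (use bij_imp_bij_inv[OF \<pi>] in \<open>auto simp: t_def case_prod_unfold bij_def intro: inj_on_subset\<close>)
          also have "\<dots> \<le> (\<Sum>(n,j)\<in>fst ` ?I \<times> snd ` ?I. norm (\<rho> j (s n)) powr q)"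
            by (rule sum_mono2[OF _ subset_fst_snd]) (use F in auto)
          also have "\<dots> = (\<Sum>n\<in>fst ` ?I. \<Sum>j\<in>snd ` ?I. norm (\<rho> j (s n)) powr q)"
            by (simp add: sum.cartesian_product)
          also have "\<dots> \<le> (\<Sum>n\<in>fst ` ?I. norm (s n) powr q)"
            by (rule sum_mono) (use bounded_coords False F in \<open>simp add: lp_bounded_def q_def\<close>)
          also have "\<dots> \<le> K powr q"
            using s False F by (simp add: lp_bounded_def q_def)
          finally show ?thesis .
        qed
        then show ?thesis using False lp_boundedD(1)[OF s] by (simp add: lp_bounded_def q_def)
      qed
      then obtain x where x: "\<forall>m. \<rho> m x = t m" "norm x \<le> K" using exists_coords by blast
      have "\<sigma> n x = s n" for n
        by (rule coords_eqI) (simp add: \<sigma>(1) x(1) t\<pi>)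
      then show ?thesis using x(2) by blast
    qed
  qed
  then show ?thesis using \<sigma>(1) by blast
qed

end

section \<open>Coordinates from an order Pelczynski decomposition\<close>

lemma lp_bounded_iff_lp_sum:
  fixes s :: "nat \<Rightarrow> 'a::real_normed_vector"
  assumes p: "1 \<le> p" and s: "\<And>n. s n \<in> Xs n"
  shows "lp_bounded p K (\<lambda>n. norm (s n)) \<longleftrightarrow> 0 \<le> K \<and> s \<in> lp_sum p Xs \<and> lp_sum_norm p s \<le> K"
proof (cases "p = \<infinity>")
  case True
  have "(\<forall>n. norm (s n) \<le> K) \<longleftrightarrow> bdd_above (range (\<lambda>n. norm (s n))) \<and> (SUP n. norm (s n)) \<le> K"
  proof
    assume "\<forall>n. norm (s n) \<le> K"
    then show "bdd_above (range (\<lambda>n. norm (s n))) \<and> (SUP n. norm (s n)) \<le> K"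
      by (auto intro!: bdd_aboveI cSUP_least)
  next
    assume *: "bdd_above (range (\<lambda>n. norm (s n))) \<and> (SUP n. norm (s n)) \<le> K"
    then have "norm (s n) \<le> (SUP n. norm (s n))" for n
      by (intro cSUP_upper) auto
    then show "\<forall>n. norm (s n) \<le> K"
      using * by (meson order_trans)
  qed
  then show ?thesis using True s by (simp add: lp_bounded_def lp_sum_def lp_sum_norm_def)
next
  case False
  define q where "q = enn2real p"
  have q: "q \<ge> 1" using enn2real_ge_1[OF p False] by (simp add: q_def)
  let ?a = "\<lambda>n. norm (s n) powr q"
  have "(\<forall>F. finite F \<longrightarrow> sum ?a F \<le> K powr q) \<longleftrightarrow> summable ?a \<and> suminf ?a powr (1 / q) \<le> K"
    if K: "0 \<le> K"
  proof
    assume *: "\<forall>F. finite F \<longrightarrow> sum ?a F \<le> K powr q"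
    then have sum: "summable ?a"
      by (intro bounded_imp_summable[where B = "K powr q"]) auto
    then have "suminf ?a \<le> K powr q"
      using * by (intro suminf_le_const) auto
    then have "suminf ?a powr (1 / q) \<le> (K powr q) powr (1 / q)"
      using q by (intro powr_mono2 suminf_nonneg sum) auto
    also have "\<dots> = K" using q K by (simp add: powr_powr)
    finally show "summable ?a \<and> suminf ?a powr (1 / q) \<le> K" using sum by simp
  next
    assume *: "summable ?a \<and> suminf ?a powr (1 / q) \<le> K"
    then have "suminf ?a \<ge> 0" by (auto intro: suminf_nonneg)
    then have "suminf ?a = (suminf ?a powr (1 / q)) powr q"
      using q by (simp add: powr_powr)
    also have "\<dots> \<le> K powr q" using * q by (intro powr_mono2) auto
    finally have "suminf ?a \<le> K powr q" .
    moreover have "sum ?a F \<le> suminf ?a" if "finite F" for F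
      using * that by (intro sum_le_suminf) auto
    ultimately show "\<forall>F. finite F \<longrightarrow> sum ?a F \<le> K powr q"
      by (meson order_trans)
  qed
  then show ?thesis
    using False s unfolding lp_bounded_def lp_sum_def lp_sum_norm_def q_def[symmetric] by auto
qed

lemma lattice_embedding_nonneg_iff:
  fixes U :: "'a::lattice_ab_group_add \<Rightarrow> 'b::lattice"
  assumes "inj U" "\<And>x y. U (sup x y) = sup (U x) (U y)"
  shows "0 \<le> x \<longleftrightarrow> U 0 \<le> U x"
proof -
  have "0 \<le> x \<longleftrightarrow> sup 0 x = x" by (rule le_iff_sup)
  also have "\<dots> \<longleftrightarrow> U (sup 0 x) = U x" using assms(1) by (simp add: inj_eq)
  also have "\<dots> \<longleftrightarrow> U 0 \<le> U x" by (simp add: assms(2) le_iff_sup)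
  finally show ?thesis .
qed

text \<open>The entries of \<open>\<Phi> x\<close> are carried from the bands \<open>Xs n\<close> back to \<open>'x\<close> by the inverses of the lattice isomorphisms \<open>U n\<close>.\<close>

lemma order_pelczynski_coordinates:
  fixes Xs :: "nat \<Rightarrow> 'x::banach_lattice set"
  assumes p: "1 \<le> p" and X: "order_pelczynski_decomposition p Xs"
  shows "\<exists>\<rho>. lp_coordinates p (\<rho> :: nat \<Rightarrow> 'x \<Rightarrow> 'x)"
proof -
  from X obtain \<Phi> :: "'x \<Rightarrow> nat \<Rightarrow> 'x" where \<Phi>: "\<And>n. linear (\<lambda>x. \<Phi> x n)"
    "bij_betw \<Phi> UNIV (lp_sum p Xs)" "\<And>x. lp_sum_norm p (\<Phi> x) = norm x"
    "\<And>x y. \<Phi> (sup x y) = sup (\<Phi> x) (\<Phi> y)"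
    unfolding order_pelczynski_decomposition_def by blast
  from X have "\<forall>n. \<exists>U :: 'x \<Rightarrow> 'x. isometric_lattice_iso_onto U (Xs n)"
    unfolding order_pelczynski_decomposition_def by blast
  then obtain U :: "nat \<Rightarrow> 'x \<Rightarrow> 'x" where "\<forall>n. isometric_lattice_iso_onto (U n) (Xs n)"
    by metis
  then have U: "\<And>n. linear (U n)" "\<And>n. bij_betw (U n) UNIV (Xs n)" "\<And>n x. norm (U n x) = norm x"
    "\<And>n x y. U n (sup x y) = sup (U n x) (U n y)"
    unfolding isometric_lattice_iso_onto_def by blast+
  define \<rho> where "\<rho> n x = inv (U n) (\<Phi> x n)" for n x
  have \<Phi>_mem: "\<Phi> x \<in> lp_sum p Xs" for x using \<Phi>(2) by (auto simp: bij_betw_def)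
  then have \<Phi>_Xs: "\<Phi> x n \<in> Xs n" for x n by (auto simp: lp_sum_def)
  have U\<rho>: "U n (\<rho> n x) = \<Phi> x n" for n x
    unfolding \<rho>_def using U(2)[of n] \<Phi>_Xs[of x n] by (auto simp: bij_betw_def intro: f_inv_into_f)
  have U_inj: "U n x = U n y \<longleftrightarrow> x = y" for n x y
    using U(2)[of n] by (auto simp: bij_betw_def inj_eq)
  have \<Phi>_inj: "inj \<Phi>" using \<Phi>(2) by (auto simp: bij_betw_def)
  have norm_\<rho>: "norm (\<rho> n x) = norm (\<Phi> x n)" for n x
    using U(3)[of n "\<rho> n x"] by (simp add: U\<rho>)
  have "lp_coordinates p \<rho>"
  proof (rule lp_coordinates.intro)
    show "1 \<le> p" by (rule p)
    show "linear (\<rho> n)" for n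
    proof (rule linearI)
      show "\<rho> n (x + y) = \<rho> n x + \<rho> n y" for x y
        by (subst U_inj[of n, symmetric])
           (simp add: linear_add[OF U(1)] U\<rho> linear_add[OF \<Phi>(1)])
      show "\<rho> n (c *\<^sub>R x) = c *\<^sub>R \<rho> n x" for c x
        by (subst U_inj[of n, symmetric])
           (simp add: linear_scale[OF U(1)] U\<rho> linear_scale[OF \<Phi>(1)])
    qed
    show "lp_bounded p (norm x) (\<lambda>n. norm (\<rho> n x))" for x
      using lp_bounded_iff_lp_sum[OF p, of "\<Phi> x" Xs "norm x"] \<Phi>_Xs[of x] \<Phi>_mem[of x] \<Phi>(3)[of x]
      by (simp add: norm_\<rho>)
    show "\<exists>x. (\<forall>n. \<rho> n x = s n) \<and> norm x \<le> K" if "lp_bounded p K (\<lambda>n. norm (s n))" for s K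
    proof -
      define t where "t n = U n (s n)" for n
      have tX: "t n \<in> Xs n" for n using U(2)[of n] by (auto simp: t_def bij_betw_def)
      have "lp_bounded p K (\<lambda>n. norm (t n))" using that by (simp add: t_def U(3))
      then have t: "t \<in> lp_sum p Xs" "lp_sum_norm p t \<le> K"
        using lp_bounded_iff_lp_sum[OF p, of t Xs K] tX by auto
      then obtain x where x: "\<Phi> x = t"
        using \<Phi>(2) unfolding bij_betw_def by (metis imageE)
      have "\<rho> n x = s n" for n
        by (subst U_inj[of n, symmetric]) (simp add: U\<rho> x t_def)
      moreover have "norm x \<le> K" using t(2) \<Phi>(3)[of x] x by simp
      ultimately show ?thesis by blast
    qed
    show "0 \<le> x \<longleftrightarrow> (\<forall>n. 0 \<le> \<rho> n x)" for x
    proof -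
      have "0 \<le> \<rho> n x \<longleftrightarrow> 0 \<le> \<Phi> x n" for n
        using lattice_embedding_nonneg_iff[of "U n" "\<rho> n x"] U(4) U_inj linear_0[OF U(1)]
        by (simp add: U\<rho> inj_def)
      moreover have "0 \<le> x \<longleftrightarrow> (\<forall>n. 0 \<le> \<Phi> x n)"
        using lattice_embedding_nonneg_iff[OF \<Phi>_inj \<Phi>(4), of x] linear_0[OF \<Phi>(1)]
        by (simp add: le_fun_def)
      ultimately show ?thesis by simp
    qed
  qed
  then show ?thesis by blast
qed

section \<open>Regrouping coordinates along small tails\<close>

text \<open>Starting with all of \<open>\<nat>\<close>, one passes repeatedly to an infinite good subset whose relative complement is still
infinite; the blocks are these complements. Leaving out \<open>n\<close> in step \<open>n\<close> makes the intersection of the sets empty, so that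
the blocks cover \<open>\<nat>\<close>.\<close>

lemma partition_into_infinite_sets:
  fixes good :: "nat \<Rightarrow> nat set \<Rightarrow> bool"
  assumes good: "\<And>n M. infinite M \<Longrightarrow> \<exists>M'\<subseteq>M. infinite M' \<and> good n M'"
    and mono: "\<And>n M M'. good n M \<Longrightarrow> M' \<subseteq> M \<Longrightarrow> good n M'"
  shows "\<exists>\<pi> :: nat \<times> nat \<Rightarrow> nat. bij \<pi> \<and> (\<forall>n. good n {\<pi> (m, j) | m j. n < m})"
proof -
  have step: "\<exists>M'. infinite M' \<and> (M' \<subseteq> M \<and> infinite (M - M') \<and> good n M' \<and> n \<notin> M')"
    if M: "infinite M" for M and n :: nat
  proof -
    obtain L :: "nat \<Rightarrow> nat set" where L: "pairwise (\<lambda>i j. disjnt (L i) (L j)) UNIV"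
      "(\<Union>i. L i) \<subseteq> M" "\<And>i. infinite (L i)"
      using infinite_infinite_partition[OF M] by metis
    have "infinite (L 0 - {n})" using L(3) by simp
    then obtain M' where M': "M' \<subseteq> L 0 - {n}" "infinite M'" "good n M'" using good by blast
    \<comment> \<open>The second part is kept out of the good subset, so that the complement remains infinite.\<close>
    have "disjnt (L 0) (L 1)" using L(1) by (rule pairwiseD) auto
    then have "L 1 \<subseteq> M - M'" using L(2) M'(1) unfolding disjnt_def by blast
    then have "infinite (M - M')" using L(3) finite_subset by blast
    then show ?thesis using M' L(2) by blast
  qed
  obtain M where M: "M 0 = UNIV" "\<And>n. infinite (M n)"
    "\<And>n. M (Suc n) \<subseteq> M n \<and> infinite (M n - M (Suc n)) \<and> good n (M (Suc n)) \<and> n \<notin> M (Suc n)"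
  proof -
    have "\<exists>f. \<forall>n. (infinite (f n) \<and> (n = 0 \<longrightarrow> f n = UNIV)) \<and>
        (f (Suc n) \<subseteq> f n \<and> infinite (f n - f (Suc n)) \<and> good n (f (Suc n)) \<and> n \<notin> f (Suc n))"
      by (rule dependent_nat_choice[where P = "\<lambda>n A. infinite A \<and> (n = 0 \<longrightarrow> A = UNIV)"])
         (use step in auto)
    then obtain f where f: "\<And>n. infinite (f n) \<and> (n = 0 \<longrightarrow> f n = UNIV)"
      "\<And>n. f (Suc n) \<subseteq> f n \<and> infinite (f n - f (Suc n)) \<and> good n (f (Suc n)) \<and> n \<notin> f (Suc n)"
      by metis
    show ?thesis by (rule that[of f]) (simp_all only: f not_False_eq_True simp_thms)
  qed
  have anti: "M n \<subseteq> M m" if "m \<le> n" for m n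
    by (rule lift_Suc_antimono_le[of M, OF _ that]) (use M(3) in blast)
  define N where "N n = M n - M (Suc n)" for n
  have N_inf: "infinite (N n)" for n using M(3) by (auto simp: N_def)
  have disj: "m = n" if "x \<in> N m" "x \<in> N n" for x m n
  proof (rule ccontr)
    assume "m \<noteq> n"
    then have "Suc m \<le> n \<or> Suc n \<le> m" by linarith
    then show False using that anti unfolding N_def by blast
  qed
  have cover: "\<exists>n. x \<in> N n" for x
  proof -
    have ex: "\<exists>n. x \<notin> M (Suc n)" using M(3) by blast
    define n where "n = (LEAST n. x \<notin> M (Suc n))"
    have "x \<notin> M (Suc n)" using LeastI_ex[OF ex] by (simp add: n_def)
    moreover have "x \<in> M n"
    proof (cases n)
      case (Suc k)
      then show ?thesis using not_less_Least[of k "\<lambda>n. x \<notin> M (Suc n)"] by (auto simp: n_def)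
    qed (simp add: M(1))
    ultimately show ?thesis by (auto simp: N_def)
  qed
  define \<pi> where "\<pi> nj = enumerate (N (fst nj)) (snd nj)" for nj
  have mem: "\<pi> (n, j) \<in> N n" for n j by (simp add: \<pi>_def enumerate_in_set[OF N_inf])
  show ?thesis
  proof (rule exI[of _ \<pi>], intro conjI allI)
    show "bij \<pi>"
    proof (rule bijI)
      show "inj \<pi>"
      proof (rule injI)
        fix x y assume eq: "\<pi> x = \<pi> y"
        then have "fst x = fst y" using mem[of "fst x" "snd x"] mem[of "fst y" "snd y"] disj by simp
        moreover from this have "snd x = snd y"
          using eq strict_mono_enumerate[OF N_inf] by (simp add: \<pi>_def strict_mono_eq)
        ultimately show "x = y" by (rule prod_eqI)
      qed
      show "surj \<pi>"
      proof (rule surjI)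
        fix x
        obtain n where n: "x \<in> N n" using cover by blast
        then obtain j where "enumerate (N n) j = x"
          using range_enumerate[OF N_inf[of n]] by (metis rangeE)
        then have "\<pi> (n, j) = x" by (simp add: \<pi>_def)
        then show "\<pi> (inv \<pi> x) = x" by (metis f_inv_into_f rangeI)
      qed
    qed
    show "good n {\<pi> (m, j) | m j. n < m}" for n
    proof (rule mono)
      show "good n (M (Suc n))" using M(3) by blast
      have "\<pi> (m, j) \<in> M (Suc n)" if "n < m" for m j
        using mem[of m j] anti[of "Suc n" m] that unfolding N_def by auto
      then show "{\<pi> (m, j) | m j. n < m} \<subseteq> M (Suc n)" by blast
    qed
  qed
qed

context lp_coordinates
begin

lemma restrict_restrict: "restrict M (restrict M' x) = restrict (M \<inter> M') x"
  by (rule coords_eqI) (simp add: coord_restrict)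

lemma restrict_add_disjoint:
  assumes "M \<inter> M' = {}"
  shows "restrict (M \<union> M') x = restrict M x + restrict M' x"
  by (rule coords_eqI) (use assms in \<open>auto simp: coord_restrict linear_add[OF linear_coord]\<close>)

lemma norm_restrict_singleton_le: "norm (restrict {n} x) \<le> norm (\<rho> n x)"
proof (rule norm_le_coords)
  have "(\<lambda>i. norm (\<rho> i (restrict {n} x))) = (\<lambda>i. if i = n then norm (\<rho> n x) else 0)"
    by (auto simp: coord_restrict)
  then show "lp_bounded p (norm (\<rho> n x)) (\<lambda>i. norm (\<rho> i (restrict {n} x)))"
    by (simp add: lp_bounded_single)
qed

text \<open>After regrouping, all entries with index greater than \<open>n\<close> come from one set that is good for \<open>n\<close>. The two conclusions about
this set serve for smallness of rows and of columns, respectively.\<close>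

lemma regroup_with_small_tails:
  fixes good :: "nat \<Rightarrow> nat set \<Rightarrow> bool"
  assumes good: "\<And>n M. infinite M \<Longrightarrow> \<exists>M'\<subseteq>M. infinite M' \<and> good n M'"
    and mono: "\<And>n M M'. good n M \<Longrightarrow> M' \<subseteq> M \<Longrightarrow> good n M'"
  shows "\<exists>\<sigma>. lp_coordinates p \<sigma> \<and> (\<forall>n. \<exists>M. good n M
      \<and> (\<forall>x. norm (\<sigma> (Suc n) x) \<le> norm (restrict M x))
      \<and> (\<forall>x. (\<forall>j\<le>n. \<sigma> j x = 0) \<longrightarrow> restrict M x = x))"
proof -
  have "\<exists>\<pi> :: nat \<times> nat \<Rightarrow> nat. bij \<pi> \<and> (\<forall>n. good n {\<pi> (m, j) | m j. n < m})"
  proof (rule partition_into_infinite_sets)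
    show "\<exists>M'\<subseteq>M. infinite M' \<and> good n M'" if "infinite M" for n M using that by (rule good)
    show "good n M'" if "good n M" "M' \<subseteq> M" for n M M' using that by (rule mono)
  qed
  then obtain \<pi> :: "nat \<times> nat \<Rightarrow> nat"
    where \<pi>: "bij \<pi>" "\<And>n. good n {\<pi> (m, j) | m j. n < m}"
    by (elim exE conjE) (rule that, assumption, erule spec)
  obtain \<sigma> where \<sigma>: "lp_coordinates p \<sigma>" "\<And>n j x. \<rho> j (\<sigma> n x) = \<rho> (\<pi> (n, j)) x"
    using lp_coordinates_regroup[OF \<pi>(1)] by blast
  show ?thesis
  proof (rule exI[of _ \<sigma>], intro conjI allI)
    show "lp_coordinates p \<sigma>" by (rule \<sigma>(1))
    fix n
    let ?M = "{\<pi> (m, j) | m j. n < m}"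
    have "norm (\<sigma> (Suc n) x) \<le> norm (restrict ?M x)" for x
    proof (rule norm_le_coords)
      have inj: "inj (\<lambda>j. \<pi> (Suc n, j))"
        using bij_is_inj[OF \<pi>(1)] unfolding inj_def by blast
      have le: "norm (\<rho> j (\<sigma> (Suc n) x)) \<le> norm (\<rho> (\<pi> (Suc n, j)) (restrict ?M x))" for j
      proof -
        have "\<pi> (Suc n, j) \<in> ?M" by blast
        then show ?thesis by (simp only: \<sigma>(2) coord_restrict if_True order_refl)
      qed
      show "lp_bounded p (norm (restrict ?M x)) (\<lambda>j. norm (\<rho> j (\<sigma> (Suc n) x)))"
        by (rule lp_bounded_reindex[OF p_ge_1 bounded_coords inj_on_subset[OF inj subset_UNIV]])
           (rule norm_ge_zero, rule le)
    qed
    moreover have "restrict ?M x = x" if x: "\<forall>j\<le>n. \<sigma> j x = 0" for x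
    proof (rule restrict_eq_self)
      fix i assume i: "i \<notin> ?M"
      obtain m j where mj: "\<pi> (m, j) = i"
        using surj_f_inv_f[OF bij_is_surj[OF \<pi>(1)], of i] by (cases "inv \<pi> i") auto
      have "m \<le> n"
      proof (rule ccontr)
        assume "\<not> m \<le> n"
        then have "n < m" by simp
        then have "\<pi> (m, j) \<in> ?M" by blast
        then show False using i mj by simp
      qed
      then have "\<rho> j (\<sigma> m x) = 0" using x linear_0[OF linear_coord] by simp
      then show "\<rho> i x = 0" by (simp only: \<sigma>(2) mj)
    qed
    ultimately show "\<exists>M. good n M \<and> (\<forall>x. norm (\<sigma> (Suc n) x) \<le> norm (restrict M x))
      \<and> (\<forall>x. (\<forall>j\<le>n. \<sigma> j x = 0) \<longrightarrow> restrict M x = x)"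
      by (intro exI[of _ ?M] conjI allI impI \<pi>(2)) assumption+
  qed
qed

end

section \<open>Order continuity makes restrictions small\<close>

context lp_coordinates
begin

text \<open>The tails of \<open>u\<close> decrease to \<open>0\<close>, since a lower bound of all tails has no positive entry.\<close>

lemma order_continuous_norm_small_restriction:
  assumes oc: "order_continuous_norm (norm :: 'x \<Rightarrow> real)"
    and u: "0 \<le> u" and e: "0 < e" and M: "infinite M"
  shows "\<exists>M'\<subseteq>M. infinite M' \<and> norm (restrict M' u) < e"
proof -
  define D where "D = range (\<lambda>n. restrict {n..} u)"
  have \<rho>u: "0 \<le> \<rho> j u" for j using u nonneg_iff_coords[of u] by blast
  have anti: "restrict {n..} u \<le> restrict {m..} u" if "m \<le> n" for m n
  proof -
    have "0 \<le> \<rho> j (restrict {m..} u - restrict {n..} u)" for j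
      using \<rho>u[of j] that by (auto simp: linear_diff[OF linear_coord] coord_restrict)
    then have "0 \<le> restrict {m..} u - restrict {n..} u"
      using nonneg_iff_coords[of "restrict {m..} u - restrict {n..} u"] by blast
    then show ?thesis by simp
  qed
  have "\<exists>x\<in>D. \<forall>y\<in>D. y \<le> x \<longrightarrow> norm y < e"
  proof (rule oc[unfolded order_continuous_norm_def, rule_format])
    show "0 < e" by (rule e)
    have "\<exists>z\<in>D. z \<le> x \<and> z \<le> y" if "x \<in> D" "y \<in> D" for x y
    proof -
      from that obtain m n where "x = restrict {m..} u" "y = restrict {n..} u" by (auto simp: D_def)
      then show ?thesis
        using anti[of m "max m n"] anti[of n "max m n"] by (auto simp: D_def)
    qed
    moreover have "0 \<le> x" if "x \<in> D" for x
      using that positive_operatorD(2)[OF positive_operator_restrict u] by (auto simp: D_def)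
    moreover have "l \<le> 0" if l: "\<forall>x\<in>D. l \<le> x" for l
    proof -
      have "0 \<le> \<rho> j (- l)" for j
      proof -
        have "0 \<le> restrict {Suc j..} u - l" using l by (simp add: D_def)
        then have "0 \<le> \<rho> j (restrict {Suc j..} u - l)"
          using nonneg_iff_coords[of "restrict {Suc j..} u - l"] by blast
        then show ?thesis
          by (simp add: linear_diff[OF linear_coord] linear_neg[OF linear_coord] coord_restrict)
      qed
      then have "0 \<le> - l" using nonneg_iff_coords[of "- l"] by blast
      then show ?thesis by simp
    qed
    ultimately show "D \<noteq> {} \<and> (\<forall>x\<in>D. \<forall>y\<in>D. \<exists>z\<in>D. z \<le> x \<and> z \<le> y) \<and> (\<forall>x\<in>D. 0 \<le> x) \<and>
        (\<forall>l. (\<forall>x\<in>D. l \<le> x) \<longrightarrow> l \<le> 0)"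
      by (auto simp: D_def)
  qed
  then obtain n where n: "norm (restrict {n..} u) < e" by (auto simp: D_def)
  have "M - {..<n} \<subseteq> {n..}" by auto
  then have "norm (restrict (M - {..<n}) u) < e"
    using norm_restrict_mono n by (meson le_less_trans)
  moreover have "infinite (M - {..<n})" using M by simp
  ultimately show ?thesis by blast
qed

text \<open>Split \<open>M\<close> into disjoint infinite sets \<open>L n\<close> and restrict \<open>\<phi>\<close> to the tails \<open>R n\<close> of this sequence of sets. These
functionals decrease, and subtracting their pointwise limit \<open>\<psi>\<close> gives functionals \<open>\<eta> n\<close> that decrease to \<open>0\<close>, hence in
norm. The limit itself need not vanish: for \<open>p = \<infinity>\<close> it may be a Banach limit. But
\<open>\<phi>\<close> restricted to \<open>L n\<close> is a difference of consecutive terms and is dominated by \<open>\<eta> n\<close>.\<close>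

lemma dual_order_continuous_norm_small_restriction:
  fixes \<phi> :: "'x \<Rightarrow> real"
  assumes oc: "order_continuous_norm (norm :: ('x \<Rightarrow>\<^sub>L real) \<Rightarrow> real)"
    and \<phi>: "positive_operator \<phi>" and e: "0 < e" and M: "infinite M"
  shows "\<exists>M'\<subseteq>M. infinite M' \<and> (\<forall>x\<ge>0. \<phi> (restrict M' x) \<le> e * norm x)"
proof -
  obtain L :: "nat \<Rightarrow> nat set" where L: "pairwise (\<lambda>i j. disjnt (L i) (L j)) UNIV"
    "(\<Union>i. L i) \<subseteq> M" "\<And>i. infinite (L i)"
    using infinite_infinite_partition[OF M] by metis
  define R where "R n = (\<Union>j\<in>{n..}. L j)" for n
  define \<phi>n where "\<phi>n n x = \<phi> (restrict (R n) x)" for n x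
  have pos: "positive_operator (\<phi>n n)" for n
    unfolding \<phi>n_def[abs_def] by (rule positive_operator_comp[OF positive_operator_restrict \<phi>])
  note lin = positive_operatorD(1)[OF pos]
  have split: "\<phi>n n x = \<phi> (restrict (L n) x) + \<phi>n (Suc n) x" for n x
  proof -
    have R: "R n = L n \<union> R (Suc n)"
    proof -
      have "{n..} = insert n {Suc n..}" by auto
      then show ?thesis by (simp add: R_def)
    qed
    have "L n \<inter> R (Suc n) = {}"
    proof -
      have "L n \<inter> L j = {}" if "Suc n \<le> j" for j
        using pairwiseD[OF L(1), of n j] that by (simp add: disjnt_def)
      then show ?thesis by (auto simp: R_def)
    qed
    then show ?thesis
      by (simp add: \<phi>n_def R restrict_add_disjoint linear_add[OF positive_operatorD(1)[OF \<phi>]])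
  qed
  have step: "\<phi>n (Suc n) x \<le> \<phi>n n x" if "0 \<le> x" for n x
    using split[of n x] positive_operatorD(2)[OF \<phi> positive_operatorD(2)[OF positive_operator_restrict that]]
    by simp
  have dec: "decseq (\<lambda>n. \<phi>n n x)" if "0 \<le> x" for x
    using step[OF that] by (rule decseq_SucI)
  have conv_pos: "convergent (\<lambda>n. \<phi>n n x)" if "0 \<le> x" for x
    using decseq_convergent[OF dec[OF that], of 0] positive_operatorD(2)[OF pos that]
    by (metis convergentI)
  have conv: "convergent (\<lambda>n. \<phi>n n x)" for x
  proof -
    have x: "x = pprt x - pprt (- x)" using prts[of x] pprt_neg[of x] by simp
    have "\<phi>n n x = \<phi>n n (pprt x) - \<phi>n n (pprt (- x))" for n
      by (subst x) (rule linear_diff[OF lin])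
    then show ?thesis
      using convergent_diff[OF conv_pos[of "pprt x"] conv_pos[of "pprt (- x)"]] by simp
  qed
  define \<psi> where "\<psi> x = lim (\<lambda>n. \<phi>n n x)" for x
  have lim: "(\<lambda>n. \<phi>n n x) \<longlonglongrightarrow> \<psi> x" for x
    using conv[of x] by (simp add: \<psi>_def convergent_LIMSEQ_iff)
  have "linear \<psi>"
  proof (rule linearI)
    show "\<psi> (x + y) = \<psi> x + \<psi> y" for x y
      using LIMSEQ_unique[OF lim[of "x + y"]] tendsto_add[OF lim[of x] lim[of y]]
      by (simp add: linear_add[OF lin])
    show "\<psi> (c *\<^sub>R x) = c *\<^sub>R \<psi> x" for c x
      using LIMSEQ_unique[OF lim[of "c *\<^sub>R x"]] tendsto_scaleR[OF tendsto_const[of c] lim[of x]]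
      by (simp add: linear_scale[OF lin])
  qed
  define \<eta> where "\<eta> n x = \<phi>n n x - \<psi> x" for n x
  have \<psi>_le: "\<psi> x \<le> \<phi>n n x" if "0 \<le> x" for n x
    by (rule decseq_ge[OF dec[OF that] lim])
  have "positive_operator (\<eta> n)" for n
    using lin[of n] \<open>linear \<psi>\<close> \<psi>_le
    by (auto simp: positive_operator_def \<eta>_def[abs_def] intro: linear_compose_sub)
  then have \<eta>_apply: "blinfun_apply (Blinfun (\<eta> n)) x = \<eta> n x" for n x
    by (simp add: bounded_linear_Blinfun_apply positive_operator_bounded)
  have \<eta>_anti: "\<eta> n x \<le> \<eta> m x" if "m \<le> n" "0 \<le> x" for m n x
    using decseqD[OF dec[OF that(2)] that(1)] by (simp add: \<eta>_def)
  have \<eta>_lim: "(\<lambda>n. \<eta> n x) \<longlonglongrightarrow> 0" for x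
    unfolding \<eta>_def using lim[of x] by (simp add: LIM_zero)
  define D where "D = range (\<lambda>n. Blinfun (\<eta> n))"
  have "\<exists>x\<in>D. \<forall>y\<in>D. y \<le> x \<longrightarrow> norm y < e"
  proof (rule oc[unfolded order_continuous_norm_def, rule_format])
    show "0 < e" by (rule e)
    have "\<exists>h\<in>D. h \<le> f \<and> h \<le> g" if "f \<in> D" "g \<in> D" for f g
    proof -
      from that obtain m n where "f = Blinfun (\<eta> m)" "g = Blinfun (\<eta> n)" by (auto simp: D_def)
      then have "Blinfun (\<eta> (max m n)) \<le> f \<and> Blinfun (\<eta> (max m n)) \<le> g"
        by (simp add: less_eq_blinfun_def \<eta>_apply \<eta>_anti)
      then show ?thesis by (auto simp: D_def)
    qed
    moreover have "0 \<le> f" if "f \<in> D" for f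
      using that \<psi>_le by (auto simp: D_def less_eq_blinfun_def \<eta>_apply \<eta>_def)
    moreover have "l \<le> 0" if l: "\<forall>f\<in>D. l \<le> f" for l
      unfolding less_eq_blinfun_def
    proof (intro allI impI)
      fix x :: 'x assume "0 \<le> x"
      then have "blinfun_apply l x \<le> \<eta> n x" for n
        using l by (auto simp: D_def less_eq_blinfun_def \<eta>_apply)
      then show "blinfun_apply l x \<le> blinfun_apply 0 x"
        using LIMSEQ_le_const[OF \<eta>_lim[of x]] by simp
    qed
    ultimately show "D \<noteq> {} \<and> (\<forall>x\<in>D. \<forall>y\<in>D. \<exists>z\<in>D. z \<le> x \<and> z \<le> y) \<and> (\<forall>x\<in>D. 0 \<le> x) \<and>
        (\<forall>l. (\<forall>x\<in>D. l \<le> x) \<longrightarrow> l \<le> 0)"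
      by (auto simp: D_def)
  qed
  then obtain n where n: "norm (Blinfun (\<eta> n)) < e" by (auto simp: D_def)
  have "\<phi> (restrict (L n) x) \<le> e * norm x" if x: "0 \<le> x" for x
  proof -
    have "\<phi> (restrict (L n) x) \<le> \<eta> n x"
      using split[of n x] \<psi>_le[OF x, of "Suc n"] by (simp add: \<eta>_def)
    also have "\<dots> \<le> norm (Blinfun (\<eta> n)) * norm x"
      using norm_blinfun[of "Blinfun (\<eta> n)" x] by (simp add: \<eta>_apply)
    also have "\<dots> \<le> e * norm x" using n by (intro mult_right_mono) auto
    finally show ?thesis .
  qed
  then show ?thesis using L(2,3) by blast
qed

end

section \<open>Weighted shifts and the telescoping identity\<close>

text \<open>Elements of the sum \<open>Y \<oplus> X\<close> are treated as sequences in \<open>X\<close> with the entry \<open>S (fst z)\<close> in front. Since \<open>S\<close> has the bounded left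
inverse \<open>T\<close>, these entries determine the element and its norm up to constants.\<close>

locale commutator_setting = lp_coordinates p \<rho>
  for p and \<rho> :: "nat \<Rightarrow> 'x::banach_lattice \<Rightarrow> 'x" +
  fixes S :: "'y::banach_lattice \<Rightarrow> 'x" and T :: "'x \<Rightarrow> 'y" and C :: "'y \<times> 'x \<Rightarrow> 'y \<times> 'x"
  assumes S: "positive_operator S" and T: "positive_operator T" and TS: "T (S y) = y"
    and C: "positive_operator C"
begin

definition coord :: "nat \<Rightarrow> 'y \<times> 'x \<Rightarrow> 'x"
  where "coord n z = (case n of 0 \<Rightarrow> S (fst z) | Suc m \<Rightarrow> \<rho> m (snd z))"

lemma coord_simps [simp]: "coord 0 z = S (fst z)" "coord (Suc n) z = \<rho> n (snd z)"
  by (simp_all add: coord_def)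

lemma positive_operator_coord: "positive_operator (coord n)"
proof (cases n)
  case 0
  then show ?thesis using positive_operator_comp[OF positive_operator_fst S]
    by (simp add: coord_def[abs_def])
next
  case (Suc m)
  then show ?thesis using positive_operator_comp[OF positive_operator_snd positive_coord]
    by (simp add: coord_def[abs_def])
qed

lemma coord_eqI:
  assumes "\<And>n. coord n z = coord n z'"
  shows "z = z'"
proof (rule prod_eqI)
  show "fst z = fst z'" using assms[of 0] TS by (metis coord_simps(1))
  show "snd z = snd z'" by (rule coords_eqI) (metis assms coord_simps(2))
qed

lemma coords_bounded:
  obtains c where "0 < c" "\<And>z. lp_bounded p (c * norm z) (\<lambda>n. norm (coord n z))"
proof -
  obtain s where s: "s > 0" "\<And>y. norm (S y) \<le> norm y * s"
    using bounded_linear.pos_bounded[OF positive_operator_bounded[OF S]] by blast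
  have "lp_bounded p ((s + 1) * norm z) (\<lambda>n. norm (coord n z))" for z
  proof -
    \<comment> \<open>The entry in front and the remaining entries are bounded separately.\<close>
    let ?a = "\<lambda>n. if n = 0 then s * norm z else 0"
    let ?b = "\<lambda>n. if n = 0 then 0 else norm (\<rho> (n - 1) (snd z))"
    have "lp_bounded p (s * norm z) ?a" by (rule lp_bounded_single) (use s in simp)
    moreover have "lp_bounded p (norm z) ?b"
      by (rule lp_bounded_reindex[OF p_ge_1 lp_bounded_bound_mono[OF bounded_coords norm_components_le(2)], where g = "\<lambda>n. n - 1"])
         (auto simp: inj_on_def split: if_splits)
    ultimately have "lp_bounded p (s * norm z + norm z) (\<lambda>n. ?a n + ?b n)"
      by (rule lp_bounded_add[OF p_ge_1])
    then have "lp_bounded p (s * norm z + norm z) (\<lambda>n. norm (coord n z))"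
    proof (rule lp_bounded_mono[OF p_ge_1])
      show "norm (coord n z) \<le> ?a n + ?b n" for n
      proof (cases n)
        case 0
        have "norm (S (fst z)) \<le> norm (fst z) * s" by (rule s(2))
        also have "\<dots> \<le> norm z * s" using s(1) norm_components_le(1)[of z] by (intro mult_right_mono) auto
        finally show ?thesis using 0 by (simp add: mult.commute)
      qed simp
    qed simp
    then show ?thesis by (simp add: distrib_right)
  qed
  then show ?thesis using s(1) by (intro that[of "s + 1"]) auto
qed

lemma norm_le_coord_bound:
  obtains c where "0 < c" "\<And>z K. lp_bounded p K (\<lambda>n. norm (coord n z)) \<Longrightarrow> norm z \<le> c * K"
proof -
  obtain t where t: "t > 0" "\<And>x. norm (T x) \<le> norm x * t"
    using bounded_linear.pos_bounded[OF positive_operator_bounded[OF T]] by blast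
  have "norm z \<le> (t + 1) * K" if K: "lp_bounded p K (\<lambda>n. norm (coord n z))" for z K
  proof -
    have "norm (fst z) \<le> norm (S (fst z)) * t" using t(2)[of "S (fst z)"] by (simp add: TS)
    also have "\<dots> \<le> K * t"
      using lp_bounded_entry_le[OF p_ge_1 K, of 0] t(1) by (intro mult_right_mono) auto
    finally have "norm (fst z) \<le> K * t" .
    moreover have "norm (snd z) \<le> K"
      by (rule norm_le_coords, rule lp_bounded_reindex[OF p_ge_1 K, where g = Suc]) auto
    ultimately show ?thesis
      using norm_Pair_le[of "fst z" "snd z"] by (simp add: algebra_simps)
  qed
  then show ?thesis using t(1) by (intro that[of "t + 1"]) auto
qed

end

locale weighted_shift = commutator_setting p \<rho> S T C
  for p and \<rho> :: "nat \<Rightarrow> 'x::banach_lattice \<Rightarrow> 'x" and S :: "'y::banach_lattice \<Rightarrow> 'x" and T C +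
  fixes \<beta> :: "nat \<Rightarrow> real"
  assumes \<beta>_pos: "0 < \<beta> n" and \<beta>_ratio: "\<beta> n / \<beta> (Suc n) \<le> 4"
begin

text \<open>The backward shift that multiplies by \<open>\<beta> n / \<beta> (n + 1)\<close> when it moves an entry from index \<open>n + 1\<close> to index \<open>n\<close>.\<close>

definition W :: "'y \<times> 'x \<Rightarrow> 'y \<times> 'x"
  where "W z = ((\<beta> 0 / \<beta> 1) *\<^sub>R T (\<rho> 0 (snd z)),
    assemble (\<lambda>n. (\<beta> (Suc n) / \<beta> (Suc (Suc n))) *\<^sub>R \<rho> (Suc n) (snd z)))"

lemma \<beta>_ratio_nonneg: "0 \<le> \<beta> m / \<beta> n"
  using \<beta>_pos[of m] \<beta>_pos[of n] by simp

lemma abs_\<beta> [simp]: "\<bar>\<beta> n\<bar> = \<beta> n"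
  using \<beta>_pos[of n] by simp

lemma W_components:
  shows positive_operator_W: "positive_operator W"
    and coord_0_W: "coord 0 (W z) = (\<beta> 0 / \<beta> 1) *\<^sub>R S (T (coord 1 z))"
    and coord_Suc_W: "coord (Suc n) (W z) = (\<beta> (Suc n) / \<beta> (Suc (Suc n))) *\<^sub>R coord (Suc (Suc n)) z"
proof -
  let ?F = "\<lambda>n z. (\<beta> (Suc n) / \<beta> (Suc (Suc n))) *\<^sub>R \<rho> (Suc n) (snd (z :: 'y \<times> 'x))"
  have pos: "positive_operator (?F n)" for n
    by (rule positive_operator_scale[OF positive_operator_comp[OF positive_operator_snd positive_coord] \<beta>_ratio_nonneg])
  have bdd: "\<exists>K. lp_bounded p K (\<lambda>n. norm (?F n z))" for z
  proof (rule exI)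
    have "lp_bounded p (norm (snd z)) (\<lambda>n. norm (\<rho> (Suc n) (snd z)))"
      by (rule lp_bounded_reindex[OF p_ge_1 bounded_coords, where g = Suc]) auto
    then have "lp_bounded p (4 * norm (snd z)) (\<lambda>n. 4 * norm (\<rho> (Suc n) (snd z)))"
      by (rule lp_bounded_scale) simp
    then show "lp_bounded p (4 * norm (snd z)) (\<lambda>n. norm (?F n z))"
    proof (rule lp_bounded_mono[OF p_ge_1])
      show "norm (?F n z) \<le> 4 * norm (\<rho> (Suc n) (snd z))" for n
        using \<beta>_ratio[of "Suc n"] \<beta>_ratio_nonneg[of "Suc n" "Suc (Suc n)"]
        by (simp only: norm_scaleR abs_of_nonneg) (rule mult_right_mono, auto)
    qed (rule norm_ge_zero)
  qed
  note asm = positive_operator_assemble[of ?F, OF pos bdd]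
  show "positive_operator W"
    unfolding W_def[abs_def]
    by (rule positive_operator_Pair[OF positive_operator_scale asm(1)],
        rule positive_operator_comp[OF positive_operator_comp[OF positive_operator_snd positive_coord] T],
        rule \<beta>_ratio_nonneg)
  show "coord 0 (W z) = (\<beta> 0 / \<beta> 1) *\<^sub>R S (T (coord 1 z))"
    by (simp add: W_def linear_scale[OF positive_operatorD(1)[OF S]])
  show "coord (Suc n) (W z) = (\<beta> (Suc n) / \<beta> (Suc (Suc n))) *\<^sub>R coord (Suc (Suc n)) z"
    using asm(2)[of n z] by (simp add: W_def)
qed

lemma coord_Suc_W_power:
  "coord (Suc n) ((W ^^ k) z) = (\<beta> (Suc n) / \<beta> (Suc n + k)) *\<^sub>R coord (Suc n + k) z"
proof (induction k arbitrary: n)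
  case 0
  then show ?case using \<beta>_pos[of "Suc n"] by simp
next
  case (Suc k)
  have "coord (Suc n) ((W ^^ Suc k) z) = (\<beta> (Suc n) / \<beta> (Suc (Suc n))) *\<^sub>R coord (Suc (Suc n)) ((W ^^ k) z)"
    by (simp only: funpow.simps o_apply coord_Suc_W)
  also have "\<dots> = (\<beta> (Suc n) / \<beta> (Suc (Suc n)) * (\<beta> (Suc (Suc n)) / \<beta> (Suc (Suc n) + k))) *\<^sub>R coord (Suc (Suc n) + k) z"
    by (simp only: Suc scaleR_scaleR)
  also have "\<beta> (Suc n) / \<beta> (Suc (Suc n)) * (\<beta> (Suc (Suc n)) / \<beta> (Suc (Suc n) + k)) = \<beta> (Suc n) / \<beta> (Suc (Suc n) + k)"
    using \<beta>_pos[of "Suc (Suc n)"] by simp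
  finally show ?case by simp
qed

text \<open>The weights along a path multiply to a quotient of two values of \<open>\<beta>\<close>. The constant \<open>M\<close> is due to the operator \<open>S T\<close>,
which acts only on entries that arrive at index \<open>0\<close>, and hence at most once.\<close>

lemma norm_coord_W_power_le:
  obtains M where "1 \<le> M"
    "\<And>n k z. norm (coord n ((W ^^ k) z)) \<le> M * (\<beta> n / \<beta> (n + k)) * norm (coord (n + k) z)"
proof -
  obtain s where s: "s > 0" "\<And>x. norm (S (T x)) \<le> norm x * s"
    using bounded_linear.pos_bounded[OF positive_operator_bounded[OF positive_operator_comp[OF T S]]]
    by blast
  have "norm (coord n ((W ^^ k) z)) \<le> (s + 1) * (\<beta> n / \<beta> (n + k)) * norm (coord (n + k) z)"
    for n k z
  proof (cases n)
    case (Suc m)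
    have "norm (coord n ((W ^^ k) z)) = 1 * ((\<beta> n / \<beta> (n + k)) * norm (coord (n + k) z))"
      using coord_Suc_W_power[of m k z] \<beta>_ratio_nonneg[of n "n + k"] Suc by simp
    also have "\<dots> \<le> (s + 1) * ((\<beta> n / \<beta> (n + k)) * norm (coord (n + k) z))"
      using s(1) by (intro mult_right_mono mult_nonneg_nonneg \<beta>_ratio_nonneg) auto
    finally show ?thesis by (simp only: mult.assoc)
  next
    case n: 0
    show ?thesis
    proof (cases k)
      case 0
      then show ?thesis using n s(1) \<beta>_pos[of 0] by (simp add: mult_le_cancel_right1)
    next
      case (Suc j)
      have "coord n ((W ^^ k) z) = (\<beta> 0 / \<beta> 1) *\<^sub>R S (T (coord (Suc 0) ((W ^^ j) z)))"
        unfolding n Suc using coord_0_W[of "(W ^^ j) z"] by simp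
      also have "\<dots> = (\<beta> 0 / \<beta> 1 * (\<beta> 1 / \<beta> k)) *\<^sub>R S (T (coord k z))"
        unfolding coord_Suc_W_power using Suc
        by (simp add: linear_scale[OF positive_operatorD(1)[OF positive_operator_comp[OF T S]]])
      also have "\<beta> 0 / \<beta> 1 * (\<beta> 1 / \<beta> k) = \<beta> 0 / \<beta> k" using \<beta>_pos[of 1] by simp
      finally have "norm (coord n ((W ^^ k) z)) = (\<beta> 0 / \<beta> k) * norm (S (T (coord k z)))"
        using \<beta>_ratio_nonneg[of 0 k] by simp
      also have "\<dots> \<le> (\<beta> 0 / \<beta> k) * ((s + 1) * norm (coord k z))"
        using s(2)[of "coord k z"] by (intro mult_left_mono \<beta>_ratio_nonneg) (simp add: algebra_simps add_increasing)
      finally show ?thesis using n by (simp add: mult_ac)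
    qed
  qed
  then show ?thesis using s(1) by (intro that[of "s + 1"]) auto
qed

text \<open>This is the entry with index \<open>r + 1\<close> of \<open>\<Sum>k. V ^ (k + 1) (C (W ^ k z))\<close>, where \<open>V\<close> is the weighted forward shift that is right
inverse to \<open>W\<close>: only the entry with index \<open>r - k\<close> of \<open>C (W ^ k z)\<close> arrives there, with the weight \<open>\<beta> (r + 1) / \<beta> (r - k)\<close>.\<close>

definition B_coord :: "nat \<Rightarrow> 'y \<times> 'x \<Rightarrow> 'x"
  where "B_coord r z = (\<Sum>k\<le>r. (\<beta> (Suc r) / \<beta> (r - k)) *\<^sub>R coord (r - k) (C ((W ^^ k) z)))"

lemma norm_B_coord_le:
  "norm (B_coord r z) \<le> (\<Sum>k\<le>r. (\<beta> (Suc r) / \<beta> (r - k)) * norm (coord (r - k) (C ((W ^^ k) z))))"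
  unfolding B_coord_def
  by (rule order_trans[OF norm_sum]) (simp add: abs_of_pos \<beta>_pos)

text \<open>The telescoping identity \<open>W B - B W = C\<close>, verified entry by entry: \<open>W\<close> cancels one forward shift, and the terms
of \<open>B (W z)\<close> are those of \<open>W (B z)\<close> with the index \<open>k\<close> shifted by one.\<close>

lemma commutator_if_bounded:
  assumes bounded: "\<And>z. \<exists>K. lp_bounded p K (\<lambda>r. norm (B_coord r z))"
  shows "\<exists>A B. positive_operator A \<and> positive_operator B \<and> C = (\<lambda>z. A (B z) - B (A z))"
proof -
  have pos: "positive_operator (B_coord r)" for r
    unfolding B_coord_def[abs_def]
    by (intro positive_operator_sum positive_operator_scale \<beta>_ratio_nonneg
        positive_operator_comp[OF positive_operator_comp[OF positive_operator_power[OF positive_operator_W] C] positive_operator_coord])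
  define B where "B z = (0 :: 'y, assemble (\<lambda>r. B_coord r z))" for z
  note asm = positive_operator_assemble[of B_coord, OF pos bounded]
  have B: "positive_operator B"
    unfolding B_def[abs_def] by (rule positive_operator_Pair[OF positive_operator_zero asm(1)])
  have coord_B: "coord 0 (B z) = 0" "coord (Suc r) (B z) = B_coord r z" for r z
    using asm(2)[of r z] linear_0[OF positive_operatorD(1)[OF S]] by (simp_all add: B_def)
  have "C z = W (B z) - B (W z)" for z
  proof (rule coord_eqI)
    fix n
    have diff: "coord n (W (B z) - B (W z)) = coord n (W (B z)) - coord n (B (W z))"
      by (rule linear_diff[OF positive_operatorD(1)[OF positive_operator_coord]])
    have "coord n (W (B z)) - coord n (B (W z)) = coord n (C z)"
    proof (cases n)
      case 0
      have "coord 0 (W (B z)) = (\<beta> 0 / \<beta> 1) *\<^sub>R S (T (coord (Suc 0) (B z)))"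
        using coord_0_W[of "B z"] by simp
      also have "\<dots> = (\<beta> 0 / \<beta> 1) *\<^sub>R S (T ((\<beta> 1 / \<beta> 0) *\<^sub>R S (fst (C z))))"
        by (simp only: coord_B) (simp add: B_coord_def)
      also have "\<dots> = S (fst (C z))"
        using \<beta>_pos[of 0] \<beta>_pos[of 1]
        by (simp add: linear_scale[OF positive_operatorD(1)[OF S]] linear_scale[OF positive_operatorD(1)[OF T]] TS)
      finally show ?thesis using coord_B(1) 0 by simp
    next
      case (Suc m)
      let ?t = "\<lambda>k. (\<beta> n / \<beta> (n - k)) *\<^sub>R coord (n - k) (C ((W ^^ k) z))"
      have "coord n (W (B z)) = (\<beta> n / \<beta> (Suc n)) *\<^sub>R B_coord n z"
        using coord_Suc_W[of m "B z"] Suc by (simp only: coord_B)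
      also have "\<dots> = (\<Sum>k\<le>n. ?t k)"
        using \<beta>_pos[of "Suc n"] by (simp add: B_coord_def scaleR_right.sum)
      also have "\<dots> = ?t 0 + (\<Sum>k\<le>m. ?t (Suc k))"
        unfolding Suc by (rule sum.atMost_Suc_shift)
      also have "(\<Sum>k\<le>m. ?t (Suc k)) = coord n (B (W z))"
        unfolding Suc coord_B(2) B_coord_def by (simp add: funpow_swap1)
      finally show ?thesis using \<beta>_pos[of n] by simp
    qed
    then show "coord n (C z) = coord n (W (B z) - B (W z))" by (simp only: diff)
  qed
  then show ?thesis using B positive_operator_W by blast
qed

end

section \<open>Summability of the commutator series\<close>

definition invsq :: "nat \<Rightarrow> real"
  where "invsq n = 1 / (real n + 1)\<^sup>2"

lemma invsq_pos: "0 < invsq n" by (simp add: invsq_def add_pos_pos)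

lemma summable_invsq: "summable invsq"
  using inverse_squares_sums by (simp add: invsq_def[abs_def] sums_iff add.commute)

lemma invsq_antimono: "m \<le> n \<Longrightarrow> invsq n \<le> invsq m"
  by (auto simp: invsq_def intro!: divide_left_mono power_mono)

text \<open>Since \<open>(a + b) / (a b) = 1 / a + 1 / b\<close>. This is the estimate for which quadratic weights are chosen.\<close>

lemma invsq_conv_bound: "invsq i * invsq k / invsq (i + k + 1) \<le> 2 * (invsq i + invsq k)"
proof -
  define a b where "a = real i + 1" and "b = real k + 1"
  have ab: "a > 0" "b > 0" by (simp_all add: a_def b_def)
  have "real (i + k + 1) + 1 = a + b" by (simp add: a_def b_def)
  then have "invsq i * invsq k / invsq (i + k + 1) = (a + b)\<^sup>2 / (a\<^sup>2 * b\<^sup>2)"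
    by (simp add: invsq_def a_def b_def)
  also have "\<dots> \<le> (2 * (a\<^sup>2 + b\<^sup>2)) / (a\<^sup>2 * b\<^sup>2)"
    using sum_squares_bound[of a b] ab
    by (intro divide_right_mono) (auto simp: power2_sum)
  also have "\<dots> = 2 * (1 / a\<^sup>2 + 1 / b\<^sup>2)" using ab by (simp add: field_simps)
  finally show ?thesis by (simp add: invsq_def a_def b_def)
qed

context commutator_setting
begin

text \<open>With decreasing weights \<open>\<beta> n = 1 / (n + 1)\<^sup>2\<close> the forward shift makes up for the growth of the powers of \<open>W\<close>: the
sequence \<open>invsq k * \<parallel>W ^ k z\<parallel>\<close> is dominated by a sequence \<open>g\<close> in \<open>l\<^sup>p\<close>. The decay of the rows then bounds the entries
of \<open>B z\<close> by the convolution of \<open>g\<close> with a geometric sequence.\<close>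

lemma commutator_if_rows_decay:
  assumes D: "0 \<le> D" "\<And>i z. norm (coord i (C z)) \<le> D * ((1/2) ^ i * invsq i) * norm z"
  shows "\<exists>A B. positive_operator A \<and> positive_operator B \<and> C = (\<lambda>z. A (B z) - B (A z))"
proof -
  have ratio: "invsq n / invsq (Suc n) \<le> 4" for n
  proof -
    have "invsq n / invsq (Suc n) = ((real n + 2) / (real n + 1))\<^sup>2"
      by (simp add: invsq_def power_divide add.commute)
    also have "\<dots> \<le> 2\<^sup>2" by (intro power_mono) (auto simp: divide_le_eq)
    finally show ?thesis by simp
  qed
  interpret weighted_shift p \<rho> S T C invsq
    by unfold_locales (rule invsq_pos, rule ratio)
  obtain M where M: "1 \<le> M"
    "\<And>n k z. norm (coord n ((W ^^ k) z)) \<le> M * (invsq n / invsq (n + k)) * norm (coord (n + k) z)"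
    using norm_coord_W_power_le by blast
  obtain c where c: "0 < c" "\<And>z K. lp_bounded p K (\<lambda>n. norm (coord n z)) \<Longrightarrow> norm z \<le> c * K"
    using norm_le_coord_bound by blast
  obtain c' where c': "0 < c'" "\<And>z. lp_bounded p (c' * norm z) (\<lambda>n. norm (coord n z))"
    using coords_bounded by blast
  have "\<exists>K. lp_bounded p K (\<lambda>r. norm (B_coord r z))" for z
  proof -
    define a where "a n = norm (coord n z)" for n
    define A where "A = c' * norm z"
    have a: "lp_bounded p A a" using c'(2)[of z] by (simp add: a_def[abs_def] A_def)
    have a0: "0 \<le> a n" for n by (simp add: a_def)
    have A0: "0 \<le> A" using lp_boundedD(1)[OF a] .
    have a_shift: "lp_bounded p A (\<lambda>n. a (n + k))" "lp_bounded p A (\<lambda>n. a (k + n))" for k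
      by (rule lp_bounded_reindex[OF p_ge_1 a, where g = "\<lambda>n. n + k"], auto simp: a0)
         (rule lp_bounded_reindex[OF p_ge_1 a, where g = "\<lambda>n. k + n"], auto simp: a0)
    have a_le: "a n \<le> A" for n by (rule lp_bounded_entry_le[OF p_ge_1 a])
    have sum_a: "summable (\<lambda>m. invsq m * a (m + k))" for k
      by (rule summable_comparison_test'[OF summable_mult2[OF summable_invsq, of A], of 0])
         (use a0 a_le invsq_pos in \<open>auto intro!: mult_mono simp: less_imp_le\<close>)
    define g where "g k = c * (2 * M) * (invsq k * A + (\<Sum>m. invsq m * a (m + k)))" for k
    have W_le: "invsq k * norm ((W ^^ k) z) \<le> g k" for k
    proof -
      have "norm (coord m (invsq k *\<^sub>R (W ^^ k) z)) \<le> 2 * M * (invsq k * a (m + k) + invsq m * a (m + k))" for m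
      proof -
        have "norm (coord m (invsq k *\<^sub>R (W ^^ k) z)) = invsq k * norm (coord m ((W ^^ k) z))"
          using invsq_pos[of k] by (simp only: linear_scale[OF positive_operatorD(1)[OF positive_operator_coord]]) simp
        also have "\<dots> \<le> invsq k * (M * (invsq m / invsq (m + k)) * a (m + k))"
          unfolding a_def by (intro mult_left_mono M(2) less_imp_le invsq_pos)
        also have "\<dots> = M * (invsq m * invsq k / invsq (m + k)) * a (m + k)" by simp
        also have "\<dots> \<le> M * (invsq m * invsq k / invsq (m + k + 1)) * a (m + k)"
          using M(1) invsq_pos by (intro mult_right_mono mult_left_mono a0 divide_left_mono invsq_antimono)
             (auto simp: less_imp_le)
        also have "\<dots> \<le> M * (2 * (invsq m + invsq k)) * a (m + k)"
          using M(1) by (intro mult_right_mono mult_left_mono invsq_conv_bound a0) auto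
        finally show ?thesis by (simp add: algebra_simps)
      qed
      moreover have "lp_bounded p (2 * M * (invsq k * A + (\<Sum>m. invsq m * a (m + k))))
          (\<lambda>m. 2 * M * (invsq k * a (m + k) + invsq m * a (m + k)))"
        using M(1) invsq_pos a0
        by (intro lp_bounded_scale lp_bounded_add p_ge_1 a_shift lp_bounded_summable sum_a)
           (auto simp: less_imp_le)
      ultimately have "lp_bounded p (2 * M * (invsq k * A + (\<Sum>m. invsq m * a (m + k))))
          (\<lambda>m. norm (coord m (invsq k *\<^sub>R (W ^^ k) z)))"
        by (rule lp_bounded_mono[OF p_ge_1, rotated 2]) (rule norm_ge_zero)
      then have "norm (invsq k *\<^sub>R (W ^^ k) z) \<le> c * (2 * M * (invsq k * A + (\<Sum>m. invsq m * a (m + k))))"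
        by (rule c(2))
      then show ?thesis using invsq_pos[of k] by (simp add: g_def mult.assoc)
    qed
    have g: "lp_bounded p (c * (2 * M) * (suminf invsq * A + suminf invsq * A)) g"
    proof -
      have "lp_bounded p (suminf invsq * A) (\<lambda>k. invsq k * A)"
        using lp_bounded_scale[OF lp_bounded_summable[OF p_ge_1 summable_invsq] A0] invsq_pos
        by (simp add: less_imp_le mult.commute)
      moreover have "lp_bounded p (\<Sum>m. invsq m * A) (\<lambda>k. \<Sum>m. invsq m * a (m + k))"
      proof (rule lp_bounded_suminf[OF p_ge_1])
        show "lp_bounded p (invsq m * A) (\<lambda>k. invsq m * a (m + k))" for m
          by (rule lp_bounded_scale[OF a_shift(2) less_imp_le[OF invsq_pos]])
        show "0 \<le> (\<Sum>m. invsq m * a (m + k))" for k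
          using invsq_pos a0 by (intro suminf_nonneg sum_a) (auto simp: less_imp_le)
      qed (auto intro: summable_mult2[OF summable_invsq])
      ultimately show ?thesis
        unfolding g_def[abs_def] suminf_mult2[OF summable_invsq, symmetric] using M(1) c(1)
        by (intro lp_bounded_scale lp_bounded_add p_ge_1) auto
    qed
    have "lp_bounded p (suminf (\<lambda>i. (1/2) ^ i) * (c * (2 * M) * (suminf invsq * A + suminf invsq * A)))
        (\<lambda>r. \<Sum>i\<le>r. (1/2) ^ i * g (r - i))"
      by (rule lp_bounded_convolution[OF p_ge_1 _ _ g]) (auto simp: summable_geometric)
    then have conv: "lp_bounded p (D * (suminf (\<lambda>i. (1/2) ^ i) * (c * (2 * M) * (suminf invsq * A + suminf invsq * A))))
        (\<lambda>r. D * (\<Sum>i\<le>r. (1/2) ^ i * g (r - i)))"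
      by (rule lp_bounded_scale) (rule D(1))
    have "norm (B_coord r z) \<le> D * (\<Sum>i\<le>r. (1/2) ^ i * g (r - i))" for r
    proof -
      have "norm (B_coord r z) \<le> (\<Sum>k\<le>r. (invsq (Suc r) / invsq (r - k)) * norm (coord (r - k) (C ((W ^^ k) z))))"
        by (rule norm_B_coord_le)
      also have "\<dots> \<le> (\<Sum>k\<le>r. D * ((1/2) ^ (r - k) * g k))"
      proof (rule sum_mono)
        fix k assume "k \<in> {..r}"
        let ?n = "norm ((W ^^ k) z)"
        have "(invsq (Suc r) / invsq (r - k)) * norm (coord (r - k) (C ((W ^^ k) z)))
          \<le> (invsq (Suc r) / invsq (r - k)) * (D * ((1/2) ^ (r - k) * invsq (r - k)) * ?n)"
          by (intro mult_left_mono D(2) \<beta>_ratio_nonneg)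
        also have "\<dots> = D * ((1/2) ^ (r - k) * (invsq (Suc r) * ?n))"
          using invsq_pos[of "r - k"] by simp
        also have "invsq (Suc r) * ?n \<le> invsq k * ?n"
          using \<open>k \<in> {..r}\<close> by (intro mult_right_mono invsq_antimono) auto
        also have "invsq k * ?n \<le> g k" by (rule W_le)
        finally show "(invsq (Suc r) / invsq (r - k)) * norm (coord (r - k) (C ((W ^^ k) z)))
          \<le> D * ((1/2) ^ (r - k) * g k)"
          using D(1) by (simp add: mult_left_mono)
      qed
      also have "\<dots> = (\<Sum>i\<le>r. D * ((1/2) ^ i * g (r - i)))"
        by (subst sum.atLeastAtMost_rev[of _ 0, simplified atMost_atLeast0[symmetric]])
           (auto intro!: sum.cong)
      finally show ?thesis by (simp add: sum_distrib_left)
    qed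
    then show ?thesis
      using lp_bounded_mono[OF p_ge_1 conv, of "\<lambda>r. norm (B_coord r z)"] by auto
  qed
  then show ?thesis by (rule commutator_if_bounded)
qed

definition proj :: "nat \<Rightarrow> 'y \<times> 'x \<Rightarrow> 'y \<times> 'x"
  where "proj m z = (case m of 0 \<Rightarrow> (fst z, 0) | Suc n \<Rightarrow> (0, restrict {n} (snd z)))"

text \<open>With increasing weights \<open>\<beta> n = (n + 1)\<^sup>2\<close> the powers of \<open>W\<close> decay and the forward shift grows. Here the columns
are summed last: for fixed \<open>m\<close>, the entries \<open>e m k i\<close> of the \<open>m\<close>-th column, normalized to \<open>f m k i\<close>, are
bounded in \<open>l\<^sup>p\<close> both as sequences in \<open>i\<close> and as sequences in \<open>k\<close>. The kernel estimate
splits the sum into two convolutions, one for each of these bounds, and the geometric factor \<open>(1/2)\<^sup>m\<close> sums the columns.\<close>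

lemma commutator_if_columns_decay:
  assumes D: "0 \<le> D" "\<And>m z. norm (C (proj m z)) \<le> D * ((1/2) ^ m * invsq m) * norm (coord m z)"
    and sums: "\<And>z. (\<lambda>m. C (proj m z)) sums C z"
  shows "\<exists>A B. positive_operator A \<and> positive_operator B \<and> C = (\<lambda>z. A (B z) - B (A z))"
proof -
  have ratio: "(1 / invsq n) / (1 / invsq (Suc n)) \<le> 4" for n
    using invsq_antimono[of n "Suc n"] invsq_pos[of n] by (simp add: divide_le_eq)
  interpret weighted_shift p \<rho> S T C "\<lambda>n. 1 / invsq n"
    by unfold_locales (simp add: invsq_pos, rule ratio)
  obtain M where M: "1 \<le> M"
    "\<And>n k z. norm (coord n ((W ^^ k) z)) \<le> M * ((1 / invsq n) / (1 / invsq (n + k))) * norm (coord (n + k) z)"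
    using norm_coord_W_power_le by blast
  obtain c where c: "0 < c" "\<And>z. lp_bounded p (c * norm z) (\<lambda>n. norm (coord n z))"
    using coords_bounded by blast
  have "\<exists>K. lp_bounded p K (\<lambda>r. norm (B_coord r z))" for z
  proof -
    define a where "a n = norm (coord n z)" for n
    define A where "A = c * norm z"
    have a: "lp_bounded p A a" using c(2)[of z] by (simp add: a_def[abs_def] A_def)
    have a0: "0 \<le> a n" for n by (simp add: a_def)
    have A0: "0 \<le> A" using lp_boundedD(1)[OF a] .
    have a_le: "a n \<le> A" for n by (rule lp_bounded_entry_le[OF p_ge_1 a])
    define e where "e m k i = norm (coord i (C (proj m ((W ^^ k) z))))" for m k i
    \<comment> \<open>The factor removes the decay of the \<open>m\<close>-th column and of \<open>W ^ k\<close>.\<close>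
    define f where "f m k i = 2 ^ m / invsq k * e m k i" for m k i
    define E where "E = c * D * M"
    have E0: "0 \<le> E" using c(1) D(1) M(1) by (simp add: E_def)
    have f0: "0 \<le> f m k i" for m k i
      using invsq_pos[of k] by (simp add: f_def e_def)
    have e_eq: "e m k i = (1/2) ^ m * invsq k * f m k i" for m k i
      using invsq_pos[of k] by (simp add: f_def power_divide)
    have f_row: "lp_bounded p (E * a (m + k)) (f m k)" for m k
    proof -
      have "norm (C (proj m ((W ^^ k) z))) \<le> D * ((1/2) ^ m * invsq m) * norm (coord m ((W ^^ k) z))"
        by (rule D(2))
      also have "\<dots> \<le> D * ((1/2) ^ m * invsq m) * (M * ((1 / invsq m) / (1 / invsq (m + k))) * a (m + k))"
        unfolding a_def using D(1) invsq_pos[of m] by (intro mult_left_mono M(2)) simp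
      also have "\<dots> = D * M * (1/2) ^ m * (invsq (m + k) * a (m + k))"
        using invsq_pos[of m] by simp
      also have "\<dots> \<le> D * M * (1/2) ^ m * (invsq k * a (m + k))"
        using D(1) M(1) by (intro mult_left_mono mult_right_mono invsq_antimono a0) auto
      finally have "c * norm (C (proj m ((W ^^ k) z))) \<le> E * ((1/2) ^ m * (invsq k * a (m + k)))"
        using c(1) by (simp add: E_def mult.assoc mult_left_mono)
      then have "lp_bounded p (E * ((1/2) ^ m * (invsq k * a (m + k)))) (e m k)"
        unfolding e_def[abs_def] by (rule lp_bounded_bound_mono[OF c(2)])
      then have "lp_bounded p (2 ^ m / invsq k * (E * ((1/2) ^ m * (invsq k * a (m + k))))) (\<lambda>i. 2 ^ m / invsq k * e m k i)"
        by (rule lp_bounded_scale) (use invsq_pos[of k] in simp)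
      then show ?thesis
        using invsq_pos[of k] by (simp add: f_def[abs_def] power_divide)
    qed
    have f_le: "f m k i \<le> E * a (m + k)" for m k i
      by (rule lp_bounded_entry_le[OF p_ge_1 f_row])
    have EA: "E * a n \<le> E * A" for n using a_le E0 by (rule mult_left_mono)
    define G where "G m r = 2 * ((\<Sum>k\<le>r. invsq k * f m k (r - k)) + (\<Sum>i\<le>r. invsq i * f m (r - i) i))" for m r
    have G: "lp_bounded p (2 * (suminf invsq * (E * A) + suminf invsq * (E * A))) (G m)" for m
    proof -
      have "lp_bounded p (suminf invsq * (E * A)) (\<lambda>r. \<Sum>k\<le>r. invsq k * f m k (r - k))"
        by (rule lp_bounded_convolution[OF p_ge_1 summable_invsq less_imp_le[OF invsq_pos]
              lp_bounded_bound_mono[OF f_row EA]])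
      moreover have "lp_bounded p (E * A) (\<lambda>k. f m k i)" for i
        by (rule lp_bounded_reindex[OF p_ge_1 lp_bounded_scale[OF a E0], where g = "\<lambda>k. m + k"])
           (auto simp: inj_on_def f0 f_le)
      then have "lp_bounded p (suminf invsq * (E * A)) (\<lambda>r. \<Sum>i\<le>r. invsq i * f m (r - i) i)"
        by (rule lp_bounded_convolution[OF p_ge_1 summable_invsq less_imp_le[OF invsq_pos],
              where f = "\<lambda>i k. f m k i"])
      ultimately show ?thesis
        unfolding G_def[abs_def] by (intro lp_bounded_scale lp_bounded_add p_ge_1) auto
    qed
    have geo: "summable (\<lambda>m. (1/2::real) ^ m)" by (simp add: summable_geometric)
    define KG where "KG = 2 * (suminf invsq * (E * A) + suminf invsq * (E * A))"
    have "lp_bounded p (\<Sum>m. (1/2) ^ m * KG) (\<lambda>r. norm (B_coord r z))"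
    proof (rule lp_bounded_suminf[OF p_ge_1])
      show "lp_bounded p ((1/2) ^ m * KG) (\<lambda>r. (1/2) ^ m * G m r)" for m
        unfolding KG_def by (rule lp_bounded_scale[OF G]) simp
      show "summable (\<lambda>m. (1/2) ^ m * KG)" using geo by (rule summable_mult2)
      show "norm (B_coord r z) \<le> (\<Sum>m. (1/2) ^ m * G m r)" for r
      proof -
        have sum_e: "summable (\<lambda>m. e m k i)" for k i
        proof (rule summable_comparison_test'[OF summable_mult2[OF geo, of "invsq k * (E * A)"], of 0])
          fix m
          have "e m k i \<le> (1/2) ^ m * invsq k * (E * A)"
            unfolding e_eq using invsq_pos[of k] f_le[of m k i] EA[of "m + k"]
            by (intro mult_left_mono) auto
          then show "norm (e m k i) \<le> (1/2) ^ m * (invsq k * (E * A))"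
            by (simp add: e_def mult.assoc)
        qed
        have coord_C: "norm (coord i (C w)) \<le> (\<Sum>m. norm (coord i (C (proj m w))))"
          if "summable (\<lambda>m. norm (coord i (C (proj m w))))" for i w
        proof -
          have "(\<lambda>m. coord i (C (proj m w))) sums coord i (C w)"
            by (rule bounded_linear.sums[OF positive_operator_bounded[OF positive_operator_coord] sums])
          then show ?thesis using summable_norm[OF that] by (simp add: sums_iff)
        qed
        let ?w = "\<lambda>k. (1 / invsq (Suc r)) / (1 / invsq (r - k))"
        have "norm (B_coord r z) \<le> (\<Sum>k\<le>r. ?w k * norm (coord (r - k) (C ((W ^^ k) z))))"
          by (rule norm_B_coord_le)
        also have "\<dots> \<le> (\<Sum>k\<le>r. ?w k * (\<Sum>m. e m k (r - k)))"
          unfolding e_def using sum_e[unfolded e_def]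
          by (intro sum_mono mult_left_mono \<beta>_ratio_nonneg coord_C)
        also have "\<dots> = (\<Sum>k\<le>r. \<Sum>m. ?w k * e m k (r - k))"
          by (simp only: suminf_mult[OF sum_e])
        also have "\<dots> = (\<Sum>m. \<Sum>k\<le>r. ?w k * e m k (r - k))"
          by (rule suminf_sum[symmetric]) (rule summable_mult[OF sum_e])
        also have "\<dots> \<le> (\<Sum>m. (1/2) ^ m * G m r)"
        proof (rule suminf_le)
          show "(\<Sum>k\<le>r. ?w k * e m k (r - k)) \<le> (1/2) ^ m * G m r" for m
          proof -
            have "(\<Sum>k\<le>r. ?w k * e m k (r - k))
              \<le> (\<Sum>k\<le>r. (1/2) ^ m * (2 * (invsq k + invsq (r - k)) * f m k (r - k)))"
            proof (rule sum_mono)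
              fix k assume "k \<in> {..r}"
              then have "invsq (r - k) * invsq k / invsq (Suc r) \<le> 2 * (invsq k + invsq (r - k))"
                using invsq_conv_bound[of "r - k" k] by (simp add: add.commute)
              then have "(1/2) ^ m * (invsq (r - k) * invsq k / invsq (Suc r) * f m k (r - k))
                \<le> (1/2) ^ m * (2 * (invsq k + invsq (r - k)) * f m k (r - k))"
                by (intro mult_left_mono mult_right_mono f0) auto
              then show "?w k * e m k (r - k) \<le> (1/2) ^ m * (2 * (invsq k + invsq (r - k)) * f m k (r - k))"
                by (simp add: e_eq mult_ac)
            qed
            also have "\<dots> = (1/2) ^ m * (2 * ((\<Sum>k\<le>r. invsq k * f m k (r - k)) + (\<Sum>k\<le>r. invsq (r - k) * f m k (r - k))))"
              by (simp only: sum_distrib_left[symmetric] distrib_right mult.assoc sum.distrib)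
            also have "(\<Sum>k\<le>r. invsq (r - k) * f m k (r - k)) = (\<Sum>i\<le>r. invsq i * f m (r - i) i)"
              by (subst sum.atLeastAtMost_rev[of _ 0, simplified atMost_atLeast0[symmetric]])
                 (auto intro!: sum.cong)
            finally show ?thesis by (simp add: G_def)
          qed
          show "summable (\<lambda>m. \<Sum>k\<le>r. ?w k * e m k (r - k))"
            by (intro summable_sum summable_mult sum_e)
          show "summable (\<lambda>m. (1/2) ^ m * G m r)"
          proof (rule summable_comparison_test'[OF summable_mult2[OF geo, of KG], of 0])
            show "norm ((1/2) ^ m * G m r) \<le> (1/2) ^ m * KG" for m
              using lp_bounded_entry_le[OF p_ge_1 G, of m r] lp_boundedD(2)[OF G, of m r]
              by (simp add: KG_def abs_mult)
          qed
        qed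
        finally show ?thesis .
      qed
    qed simp
    then show ?thesis by blast
  qed
  then show ?thesis by (rule commutator_if_bounded)
qed

end

section \<open>The norm of the direct sum\<close>

text \<open>The direct sum of two spaces is an \<open>l\<^sup>p\<close>-sum over the two-element index type \<open>bool\<close>, which makes Minkowski's
inequality available for its norm.\<close>

lemma psum_norm_le_iff:
  fixes z :: "'a::real_normed_vector \<times> 'b::real_normed_vector"
  assumes p: "1 \<le> p"
  shows "lp_bounded p K (\<lambda>b. if b then norm (fst z) else norm (snd z)) \<longleftrightarrow> 0 \<le> K \<and> psum_norm p z \<le> K"
proof (cases "p = \<infinity>")
  case True
  then show ?thesis by (auto simp: lp_bounded_def psum_norm_def all_bool_eq)
next
  case False
  define q where "q = enn2real p"
  have q: "q \<ge> 1" using enn2real_ge_1[OF p False] by (simp add: q_def)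
  let ?a = "\<lambda>b. if b then norm (fst z) else norm (snd z)"
  define s where "s = norm (fst z) powr q + norm (snd z) powr q"
  have s0: "0 \<le> s" by (simp add: s_def)
  have UNIV: "(\<Sum>b\<in>UNIV. ?a b powr q) = s"
    by (simp add: UNIV_bool s_def add.commute)
  have "(\<forall>F. finite F \<longrightarrow> (\<Sum>b\<in>F. ?a b powr q) \<le> K powr q) \<longleftrightarrow> s \<le> K powr q"
  proof
    assume "\<forall>F. finite F \<longrightarrow> (\<Sum>b\<in>F. ?a b powr q) \<le> K powr q"
    then show "s \<le> K powr q" using UNIV finite[of "UNIV :: bool set"] by metis
  next
    assume "s \<le> K powr q"
    then show "\<forall>F. finite F \<longrightarrow> (\<Sum>b\<in>F. ?a b powr q) \<le> K powr q"
      unfolding UNIV[symmetric] using sum_mono2[of UNIV _ "\<lambda>b. ?a b powr q"]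
      by (meson finite order_trans powr_ge_zero subset_UNIV)
  qed
  also have "s \<le> K powr q \<longleftrightarrow> s powr (1 / q) \<le> K" if K: "0 \<le> K"
  proof
    assume "s \<le> K powr q"
    then have "s powr (1 / q) \<le> (K powr q) powr (1 / q)"
      using q s0 by (intro powr_mono2) auto
    then show "s powr (1 / q) \<le> K" using q K by (simp add: powr_powr)
  next
    assume "s powr (1 / q) \<le> K"
    then have "(s powr (1 / q)) powr q \<le> K powr q" using q by (intro powr_mono2) auto
    then show "s \<le> K powr q" using q s0 by (simp add: powr_powr)
  qed
  finally have "0 \<le> K \<Longrightarrow> (\<forall>F. finite F \<longrightarrow> (\<Sum>b\<in>F. ?a b powr q) \<le> K powr q) \<longleftrightarrow> psum_norm p z \<le> K"
    using False by (simp add: psum_norm_def s_def q_def)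
  then show ?thesis using False unfolding lp_bounded_def q_def[symmetric] by auto
qed

lemma psum_norm_nonneg: "0 \<le> psum_norm p z"
  by (simp add: psum_norm_def le_max_iff_disj)

lemma psum_norm_bounded:
  assumes "1 \<le> p"
  shows "lp_bounded p (psum_norm p z) (\<lambda>b. if b then norm (fst z) else norm (snd z))"
  using psum_norm_le_iff[OF assms, of "psum_norm p z" z] psum_norm_nonneg[of p z] by simp

lemma norm_components_le_psum_norm:
  assumes "1 \<le> p"
  shows "norm (fst z) \<le> psum_norm p z" "norm (snd z) \<le> psum_norm p z"
  using lp_bounded_entry_le[OF assms psum_norm_bounded[OF assms, of z], of True]
    lp_bounded_entry_le[OF assms psum_norm_bounded[OF assms, of z], of False] by simp_all

lemma norm_le_psum_norm:
  assumes "1 \<le> p"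
  shows "norm z \<le> 2 * psum_norm p z"
  using norm_components_le_psum_norm[OF assms, of z] norm_Pair_le[of "fst z" "snd z"] by simp

lemma psum_norm_le_norm:
  assumes p: "1 \<le> p"
  shows "psum_norm p z \<le> 2 * norm z"
proof -
  have "lp_bounded p (norm (fst z) + norm (snd z))
      (\<lambda>b. (if b = True then norm (fst z) else 0) + (if b = False then norm (snd z) else 0))"
    by (intro lp_bounded_add p lp_bounded_single norm_ge_zero)
  also have "(\<lambda>b. (if b = True then norm (fst z) else 0) + (if b = False then norm (snd z) else 0))
      = (\<lambda>b. if b then norm (fst z) else norm (snd z))" by auto
  finally have "psum_norm p z \<le> norm (fst z) + norm (snd z)"
    using psum_norm_le_iff[OF p] by blast
  then show ?thesis using norm_components_le[of z] by linarith
qed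

lemma psum_norm_triangle:
  assumes p: "1 \<le> p"
  shows "psum_norm p (x + y) \<le> psum_norm p x + psum_norm p y"
proof -
  have "lp_bounded p (psum_norm p x + psum_norm p y)
      (\<lambda>b. if b then norm (fst (x + y)) else norm (snd (x + y)))"
    by (rule lp_bounded_mono[OF p lp_bounded_add[OF p psum_norm_bounded[OF p, of x] psum_norm_bounded[OF p, of y]]])
       (auto simp: norm_triangle_ineq)
  then show ?thesis using psum_norm_le_iff[OF p] by blast
qed

lemma psum_norm_minus_commute: "psum_norm p (x - y) = psum_norm p (y - x)"
  by (simp add: psum_norm_def norm_minus_commute)

lemma psum_norm_eq_0: "1 \<le> p \<Longrightarrow> psum_norm p z = 0 \<longleftrightarrow> z = 0"
  using norm_le_psum_norm[of p z] psum_norm_le_norm[of p z] psum_norm_nonneg[of p z] by auto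

lemma relatively_compact_finite_net:
  fixes A :: "('a::real_normed_vector \<times> 'b::real_normed_vector) set"
  assumes p: "1 \<le> p" and A: "relatively_compact (psum_norm p) A" and e: "0 < e"
  obtains F where "finite F" "\<And>a. a \<in> A \<Longrightarrow> \<exists>v\<in>F. norm (a - v) < e"
proof -
  interpret Metric_space UNIV "\<lambda>x y::'a \<times> 'b. psum_norm p (x - y)"
  proof
    show "0 \<le> psum_norm p (x - y)" for x y :: "'a \<times> 'b" by (rule psum_norm_nonneg)
    show "psum_norm p (x - y) = psum_norm p (y - x)" for x y :: "'a \<times> 'b"
      by (rule psum_norm_minus_commute)
    show "psum_norm p (x - y) = 0 \<longleftrightarrow> x = y" for x y :: "'a \<times> 'b"
      by (simp add: psum_norm_eq_0[OF p])
    show "psum_norm p (x - z) \<le> psum_norm p (x - y) + psum_norm p (y - z)" for x y z :: "'a \<times> 'b"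
      using psum_norm_triangle[OF p, of "x - y" "y - z"] by simp
  qed
  have "compactin mtopology (mtopology closure_of A)"
    using A by (simp add: relatively_compact_def Let_def)
  then have "mtotally_bounded (mtopology closure_of A)"
    by (rule compactin_imp_mtotally_bounded)
  moreover have "0 < e / 2" using e by simp
  ultimately obtain F where F: "finite F" "mtopology closure_of A \<subseteq> (\<Union>x\<in>F. mball x (e / 2))"
    unfolding mtotally_bounded_def by blast
  show ?thesis
  proof (rule that[OF F(1)])
    fix a assume "a \<in> A"
    then have "a \<in> mtopology closure_of A"
      using closure_of_subset[of A mtopology] by auto
    then obtain v where v: "v \<in> F" "psum_norm p (v - a) < e / 2"
      using F(2) by auto
    have "norm (a - v) < e"
      using norm_le_psum_norm[OF p, of "a - v"] v(2) psum_norm_minus_commute[of p v a] by linarith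
    then show "\<exists>v\<in>F. norm (a - v) < e" using v(1) by blast
  qed
qed

text \<open>Passage from the unit ball of \<open>psum_norm p\<close> to all of a cone \<open>P\<close>, with the product norm; the factor \<open>2\<close> compares the
two norms.\<close>

lemma norm_le_of_le_on_psum_ball:
  fixes h :: "'a::real_normed_vector \<times> 'b::real_normed_vector \<Rightarrow> 'c::real_normed_vector"
  assumes p: "1 \<le> p" and h: "linear h" and P: "\<And>(t::real) z. P z \<Longrightarrow> 0 \<le> t \<Longrightarrow> P (t *\<^sub>R z)"
    and le: "\<And>z. P z \<Longrightarrow> psum_norm p z \<le> 1 \<Longrightarrow> norm (h z) \<le> d" and z: "P z"
  shows "norm (h z) \<le> 2 * d * norm z"
proof (cases "z = 0")
  case True
  then show ?thesis by (simp add: linear_0[OF h])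
next
  case False
  \<comment> \<open>The factor \<open>2\<close> puts \<open>w\<close> into the unit ball of \<open>psum_norm p\<close>.\<close>
  define w where "w = (1 / (2 * norm z)) *\<^sub>R z"
  have "psum_norm p w \<le> 2 * norm w" by (rule psum_norm_le_norm[OF p])
  also have "\<dots> = 1" using False by (simp add: w_def)
  finally have "norm (h w) \<le> d" using P[OF z] by (intro le) (simp_all add: w_def)
  moreover have "h w = (1 / (2 * norm z)) *\<^sub>R h z" by (simp add: w_def linear_scale[OF h])
  ultimately show ?thesis using False by (simp add: field_simps)
qed

section \<open>Consequences of semi-compactness and compactness\<close>

text \<open>The image of the unit ball is almost order bounded in the second component. The first
component is represented by a single entry of the sequence and imposes no decay.\<close>

definition range_nearly_order_bounded ::
    "ennreal \<Rightarrow> ('a::banach_lattice \<times> 'b::banach_lattice \<Rightarrow> 'a \<times> 'b) \<Rightarrow> bool"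
  where "range_nearly_order_bounded p C \<longleftrightarrow> (\<forall>\<epsilon>>0. \<exists>u\<ge>0. \<forall>z. psum_norm p z \<le> 1 \<longrightarrow>
    (\<exists>v b. snd (C z) = v + b \<and> \<bar>v\<bar> \<le> u \<and> norm b \<le> \<epsilon>))"

lemma semi_compact_range_nearly_order_bounded:
  fixes C :: "'a::banach_lattice \<times> 'b::banach_lattice \<Rightarrow> 'a \<times> 'b"
  assumes p: "1 \<le> p" and C: "semi_compact (psum_norm p) C"
  shows "range_nearly_order_bounded p C"
  unfolding range_nearly_order_bounded_def
proof (intro allI impI)
  fix \<epsilon> :: real assume "0 < \<epsilon>"
  then obtain u where u: "0 \<le> u" "C ` {z. psum_norm p z \<le> 1}
      \<subseteq> {v + \<epsilon> *\<^sub>R b |v b. v \<in> {- u..u} \<and> psum_norm p b \<le> 1}"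
    using C unfolding semi_compact_def almost_order_bounded_def by blast
  show "\<exists>u\<ge>0. \<forall>z. psum_norm p z \<le> 1 \<longrightarrow> (\<exists>v b. snd (C z) = v + b \<and> \<bar>v\<bar> \<le> u \<and> norm b \<le> \<epsilon>)"
  proof (rule exI[of _ "snd u"], intro conjI allI impI)
    show "0 \<le> snd u" using u(1) by (simp add: less_eq_prod_def)
    fix z :: "'a \<times> 'b" assume "psum_norm p z \<le> 1"
    then have "C z \<in> {v + \<epsilon> *\<^sub>R b |v b. v \<in> {- u..u} \<and> psum_norm p b \<le> 1}" using u(2) by blast
    then obtain v b where vb: "C z = v + \<epsilon> *\<^sub>R b" "v \<in> {- u..u}" "psum_norm p b \<le> 1" by blast
    have "snd v \<le> snd u" "- snd u \<le> snd v" using vb(2) by (auto simp: less_eq_prod_def)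
    then have "\<bar>snd v\<bar> \<le> snd u" by (intro abs_leI) (simp_all add: minus_le_iff)
    moreover have "norm (\<epsilon> *\<^sub>R snd b) \<le> \<epsilon>"
      using norm_components_le_psum_norm(2)[OF p, of b] vb(3) \<open>0 < \<epsilon>\<close>
      by (simp add: mult_left_le)
    ultimately show "\<exists>v b. snd (C z) = v + b \<and> \<bar>v\<bar> \<le> snd u \<and> norm b \<le> \<epsilon>"
      using vb(1) by (metis snd_add snd_scaleR)
  qed
qed

text \<open>A finite \<open>\<epsilon>\<close>-net \<open>F\<close> is dominated by the sum of the moduli of its elements.\<close>

lemma compact_range_nearly_order_bounded:
  fixes C :: "'a::banach_lattice \<times> 'b::banach_lattice \<Rightarrow> 'a \<times> 'b"
  assumes p: "1 \<le> p" and C: "compact_operator (psum_norm p) C"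
  shows "range_nearly_order_bounded p C"
  unfolding range_nearly_order_bounded_def
proof (intro allI impI)
  fix \<epsilon> :: real assume "0 < \<epsilon>"
  then obtain F where F: "finite F" "\<And>a. a \<in> C ` {z. psum_norm p z \<le> 1} \<Longrightarrow> \<exists>v\<in>F. norm (a - v) < \<epsilon>"
    using relatively_compact_finite_net[OF p C[unfolded compact_operator_def]] by metis
  let ?u = "\<Sum>v\<in>F. \<bar>snd v\<bar>"
  show "\<exists>u\<ge>0. \<forall>z. psum_norm p z \<le> 1 \<longrightarrow> (\<exists>v b. snd (C z) = v + b \<and> \<bar>v\<bar> \<le> u \<and> norm b \<le> \<epsilon>)"
  proof (rule exI[of _ ?u], intro conjI allI impI)
    show "0 \<le> ?u" by (intro sum_nonneg abs_ge_zero)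
    fix z :: "'a \<times> 'b" assume "psum_norm p z \<le> 1"
    then obtain v where v: "v \<in> F" "norm (C z - v) < \<epsilon>" using F(2) by blast
    have "\<bar>snd v\<bar> \<le> ?u"
      using sum_mono2[OF F(1), of "{v}" "\<lambda>v. \<bar>snd v\<bar>"] v(1) by simp
    moreover have "norm (snd (C z - v)) \<le> \<epsilon>" using norm_components_le(2)[of "C z - v"] v(2) by linarith
    ultimately show "\<exists>v b. snd (C z) = v + b \<and> \<bar>v\<bar> \<le> ?u \<and> norm b \<le> \<epsilon>"
      by (intro exI[of _ "snd v"] exI[of _ "snd (C z - v)"]) simp
  qed
qed

text \<open>A form of semi-compactness of the adjoint that refers only to the positive cone and to a single functional for each \<open>\<epsilon>\<close>.\<close>

definition norm_nearly_dominated ::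
    "ennreal \<Rightarrow> ('a::banach_lattice \<times> 'b::banach_lattice \<Rightarrow> 'a \<times> 'b) \<Rightarrow> bool"
  where "norm_nearly_dominated p C \<longleftrightarrow> (\<forall>\<epsilon>>0. \<exists>\<phi> :: 'a \<times> 'b \<Rightarrow> real. positive_operator \<phi> \<and>
    (\<forall>z\<ge>0. psum_norm p z \<le> 1 \<longrightarrow> norm (C z) \<le> \<phi> z + \<epsilon>))"

text \<open>The supremum in \<open>dual_norm\<close> is a supremum of a bounded set, since \<open>psum_norm p\<close> is equivalent to the product norm.\<close>

lemma dual_norm_apply_le:
  fixes b :: "('a::real_normed_vector \<times> 'b::real_normed_vector) \<Rightarrow>\<^sub>L real"
  assumes p: "1 \<le> p" and b: "dual_norm (psum_norm p) b \<le> 1" and z: "psum_norm p z \<le> 1"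
  shows "\<bar>blinfun_apply b z\<bar> \<le> 1"
proof -
  have "bdd_above ((\<lambda>z. \<bar>blinfun_apply b z\<bar>) ` {z. psum_norm p z \<le> 1})"
  proof (rule bdd_aboveI2)
    fix x assume "x \<in> {z :: 'a \<times> 'b. psum_norm p z \<le> 1}"
    then have "norm x \<le> 2" using norm_le_psum_norm[OF p, of x] by simp
    then have "norm b * norm x \<le> norm b * 2" by (intro mult_left_mono) auto
    then show "\<bar>blinfun_apply b x\<bar> \<le> norm b * 2" using norm_blinfun[of b x] by simp
  qed
  then have "\<bar>blinfun_apply b z\<bar> \<le> dual_norm (psum_norm p) b"
    unfolding dual_norm_def using z by (intro cSUP_upper) auto
  then show ?thesis using b by simp
qed

text \<open>For \<open>z \<ge> 0\<close> a positive functional \<open>f\<close> attains the norm at \<open>C z\<close>, and \<open>f (C z)\<close> is the value at \<open>z\<close> of the adjoint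
applied to \<open>f\<close>, which is almost dominated by the functional \<open>u\<close>. The functional is halved because its norm is \<open>1\<close> only
with respect to the product norm.\<close>

lemma adjoint_semi_compact_norm_nearly_dominated:
  fixes C :: "'a::banach_lattice \<times> 'b::banach_lattice \<Rightarrow> 'a \<times> 'b"
  assumes p: "1 \<le> p" and C: "positive_operator C"
    and adj: "semi_compact (dual_norm (psum_norm p)) (adjoint_operator C)"
  shows "norm_nearly_dominated p C"
  unfolding norm_nearly_dominated_def
proof (intro allI impI)
  fix \<epsilon> :: real assume \<epsilon>: "0 < \<epsilon>"
  then have "0 < \<epsilon> / 2" by simp
  then obtain u where u: "0 \<le> u" "adjoint_operator C ` {f. dual_norm (psum_norm p) f \<le> 1}
      \<subseteq> {v + (\<epsilon> / 2) *\<^sub>R b |v b. v \<in> {- u..u} \<and> dual_norm (psum_norm p) b \<le> 1}"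
    using adj unfolding semi_compact_def almost_order_bounded_def by blast
  define \<phi> where "\<phi> z = 2 * blinfun_apply u z" for z
  have "positive_operator \<phi>"
    using u(1) unfolding positive_operator_def \<phi>_def[abs_def]
    by (auto simp: less_eq_blinfun_def linear_iff blinfun.add_right blinfun.scaleR_right algebra_simps)
  moreover have "norm (C z) \<le> \<phi> z + \<epsilon>" if z: "0 \<le> z" "psum_norm p z \<le> 1" for z
  proof -
    obtain f :: "'a \<times> 'b \<Rightarrow> real" where f: "positive_operator f" "\<And>x. \<bar>f x\<bar> \<le> norm x"
      "f (C z) = norm (C z)"
      using positive_norming_functional[OF positive_operatorD(2)[OF C z(1)]] by blast
    have blf: "bounded_linear f" by (rule positive_operator_bounded[OF f(1)])
    define g where "g = (1/2) *\<^sub>R Blinfun f"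
    have g: "blinfun_apply g x = f x / 2" for x
      by (simp add: g_def blinfun.scaleR_left bounded_linear_Blinfun_apply[OF blf])
    have "dual_norm (psum_norm p) g \<le> 1"
      unfolding dual_norm_def
    proof (rule cSUP_least)
      have "psum_norm p (0 :: 'a \<times> 'b) \<le> 1" by (simp add: psum_norm_def)
      then show "{z :: 'a \<times> 'b. psum_norm p z \<le> 1} \<noteq> {}" by blast
      fix x assume "x \<in> {z :: 'a \<times> 'b. psum_norm p z \<le> 1}"
      then have "norm x \<le> 2" using norm_le_psum_norm[OF p, of x] by simp
      then show "\<bar>blinfun_apply g x\<bar> \<le> 1" using f(2)[of x] by (simp add: g)
    qed
    then have "adjoint_operator C g \<in> {v + (\<epsilon> / 2) *\<^sub>R b |v b. v \<in> {- u..u} \<and> dual_norm (psum_norm p) b \<le> 1}"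
      using u(2) by blast
    then obtain v b where vb: "adjoint_operator C g = v + (\<epsilon> / 2) *\<^sub>R b" "v \<le> u"
      "dual_norm (psum_norm p) b \<le> 1" by auto
    have "norm (C z) / 2 = blinfun_apply (adjoint_operator C g) z"
      by (simp add: adjoint_operator_apply[OF positive_operator_bounded[OF C]] g f(3))
    also have "\<dots> = blinfun_apply v z + \<epsilon> / 2 * blinfun_apply b z"
      by (simp add: vb(1) blinfun.add_left blinfun.scaleR_left)
    also have "\<dots> \<le> blinfun_apply u z + \<epsilon> / 2 * 1"
    proof (intro add_mono mult_left_mono)
      show "blinfun_apply v z \<le> blinfun_apply u z"
        using vb(2) z(1) unfolding less_eq_blinfun_def by blast
      show "blinfun_apply b z \<le> 1" using dual_norm_apply_le[OF p vb(3) z(2)] by simp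
    qed (use \<epsilon> in simp)
    finally show ?thesis by (simp add: \<phi>_def)
  qed
  ultimately show "\<exists>\<phi> :: 'a \<times> 'b \<Rightarrow> real. positive_operator \<phi> \<and>
      (\<forall>z\<ge>0. psum_norm p z \<le> 1 \<longrightarrow> norm (C z) \<le> \<phi> z + \<epsilon>)" by blast
qed

text \<open>Finitely many positive functionals, one norming the positive part of each point of a finite net, almost norm all positive
elements in the image of the ball. Their sum composed with \<open>C\<close> is the required functional; this replaces the compactness of
the adjoint.\<close>

lemma compact_norm_nearly_dominated:
  fixes C :: "'a::banach_lattice \<times> 'b::banach_lattice \<Rightarrow> 'a \<times> 'b"
  assumes p: "1 \<le> p" and C: "positive_operator C" and cpt: "compact_operator (psum_norm p) C"
  shows "norm_nearly_dominated p C"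
  unfolding norm_nearly_dominated_def
proof (intro allI impI)
  fix \<epsilon> :: real assume "0 < \<epsilon>"
  then have "0 < \<epsilon> / 2" by simp
  then obtain F where F: "finite F"
    "\<And>a. a \<in> C ` {z. psum_norm p z \<le> 1} \<Longrightarrow> \<exists>v\<in>F. norm (a - v) < \<epsilon> / 2"
    using relatively_compact_finite_net[OF p cpt[unfolded compact_operator_def]] by metis
  have "\<exists>f :: 'a \<times> 'b \<Rightarrow> real. positive_operator f \<and> (\<forall>x. \<bar>f x\<bar> \<le> norm x) \<and> f (pprt v) = norm (pprt v)" for v
    using positive_norming_functional[OF zero_le_pprt[of v]] by metis
  then obtain f :: "'a \<times> 'b \<Rightarrow> 'a \<times> 'b \<Rightarrow> real" where f: "\<And>v. positive_operator (f v)"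
    "\<And>v x. \<bar>f v x\<bar> \<le> norm x" "\<And>v. f v (pprt v) = norm (pprt v)"
    by metis
  define \<phi> where "\<phi> z = (\<Sum>v\<in>F. f v (C z))" for z
  have "positive_operator \<phi>"
    unfolding \<phi>_def[abs_def] by (intro positive_operator_sum) (rule positive_operator_comp[OF C f(1)])
  moreover have "norm (C z) \<le> \<phi> z + \<epsilon>" if z: "0 \<le> z" "psum_norm p z \<le> 1" for z
  proof -
    obtain v where v: "v \<in> F" "norm (C z - v) < \<epsilon> / 2" using F(2) z(2) by blast
    have Cz: "0 \<le> C z" by (rule positive_operatorD(2)[OF C z(1)])
    have d: "norm (pprt v - C z) \<le> \<epsilon> / 2"
      using norm_pprt_diff_le[OF Cz, of v] v(2) by (simp add: norm_minus_commute)
    have "f v (C z) \<le> \<phi> z"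
      unfolding \<phi>_def using sum_mono2[OF F(1), of "{v}" "\<lambda>v. f v (C z)"] v(1) positive_operatorD(2)[OF f(1) Cz]
      by simp
    moreover have "f v (pprt v) - f v (C z) \<le> \<epsilon> / 2"
      using f(2)[of v "pprt v - C z"] d linear_diff[OF positive_operatorD(1)[OF f(1)], of v "pprt v" "C z"]
      by linarith
    moreover have "norm (C z) \<le> norm (pprt v) + \<epsilon> / 2"
      using norm_triangle_ineq2[of "C z" "pprt v"] d by (simp add: norm_minus_commute)
    ultimately show ?thesis using f(3)[of v] by simp
  qed
  ultimately show "\<exists>\<phi> :: 'a \<times> 'b \<Rightarrow> real. positive_operator \<phi> \<and>
      (\<forall>z\<ge>0. psum_norm p z \<le> 1 \<longrightarrow> norm (C z) \<le> \<phi> z + \<epsilon>)" by blast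
qed

section \<open>Decay of the matrix of the operator\<close>

text \<open>The bound required from the regrouping at index \<open>n\<close>: a geometric factor for summation over the index, and a
quadratic factor that cancels the weight.\<close>

definition decay :: "nat \<Rightarrow> real"
  where "decay n = (1/2) ^ n * invsq n"

lemma decay_pos: "0 < decay n"
  by (simp add: decay_def invsq_pos)

lemma decay_initial: "n < 2 \<Longrightarrow> 1 / 8 \<le> decay n"
  by (auto simp: decay_def invsq_def less_2_cases_iff power2_eq_square)

context lp_coordinates
begin

lemma small_restriction_of_range:
  fixes C :: "'y::banach_lattice \<times> 'x \<Rightarrow> 'y \<times> 'x"
  assumes oc: "order_continuous_norm (norm :: 'x \<Rightarrow> real)" and C: "positive_operator C"
    and range: "range_nearly_order_bounded p C" and e: "0 < e" and M: "infinite M"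
  shows "\<exists>M'\<subseteq>M. infinite M' \<and> (\<forall>z. norm (restrict M' (snd (C z))) \<le> e * norm z)"
proof -
  have e4: "0 < e / 4" using e by simp
  then obtain u where u: "0 \<le> u" "\<And>z. psum_norm p z \<le> 1 \<Longrightarrow>
      \<exists>v b. snd (C z) = v + b \<and> \<bar>v\<bar> \<le> u \<and> norm b \<le> e / 4"
    using range unfolding range_nearly_order_bounded_def by meson
  obtain M' where M': "M' \<subseteq> M" "infinite M'" "norm (restrict M' u) < e / 4"
    using order_continuous_norm_small_restriction[OF oc u(1) e4 M] by blast
  have "norm (restrict M' (snd (C z))) \<le> 2 * (e / 2) * norm z" for z
  proof (rule norm_le_of_le_on_psum_ball[OF p_ge_1, where P = "\<lambda>_. True"])
    show "linear (\<lambda>z. restrict M' (snd (C z)))"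
      by (rule positive_operatorD(1))
         (rule positive_operator_comp[OF positive_operator_comp[OF C positive_operator_snd] positive_operator_restrict])
    fix z :: "'y \<times> 'x" assume "psum_norm p z \<le> 1"
    then obtain v b where vb: "snd (C z) = v + b" "\<bar>v\<bar> \<le> u" "norm b \<le> e / 4" using u(2) by blast
    have "norm (restrict M' v) \<le> norm (restrict M' u)"
    proof (rule norm_le_if_abs_le)
      show "\<bar>restrict M' v\<bar> \<le> restrict M' u"
        using abs_positive_operator_le[OF positive_operator_restrict, of M' v]
          positive_operator_mono[OF positive_operator_restrict vb(2), of M'] by (rule order_trans)
    qed
    moreover have "norm (restrict M' b) \<le> e / 4" using norm_restrict_le[of M' b] vb(3) by linarith
    moreover have "restrict M' (snd (C z)) = restrict M' v + restrict M' b"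
      unfolding vb(1) by (rule linear_add[OF positive_operatorD(1)[OF positive_operator_restrict]])
    ultimately show "norm (restrict M' (snd (C z))) \<le> e / 2"
      using M'(3) norm_triangle_ineq[of "restrict M' v" "restrict M' b"] by simp
  qed simp_all
  then show ?thesis using M' by auto
qed

lemma small_on_restriction:
  fixes C :: "'y::banach_lattice \<times> 'x \<Rightarrow> 'y \<times> 'x"
  assumes oc: "order_continuous_norm (norm :: ('x \<Rightarrow>\<^sub>L real) \<Rightarrow> real)" and C: "positive_operator C"
    and dom: "norm_nearly_dominated p C" and e: "0 < e" and M: "infinite M"
  shows "\<exists>M'\<subseteq>M. infinite M' \<and> (\<forall>x. norm (C (0, restrict M' x)) \<le> e * norm x)"
proof -
  have e4: "0 < e / 4" using e by simp
  then obtain \<phi> :: "'y \<times> 'x \<Rightarrow> real" where \<phi>: "positive_operator \<phi>"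
    "\<And>z. 0 \<le> z \<Longrightarrow> psum_norm p z \<le> 1 \<Longrightarrow> norm (C z) \<le> \<phi> z + e / 4"
    using dom unfolding norm_nearly_dominated_def by meson
  have incl: "positive_operator (\<lambda>x. (0 :: 'y, x :: 'x))"
    by (auto simp: positive_operator_def less_eq_prod_def linear_iff)
  obtain M' where M': "M' \<subseteq> M" "infinite M'" "\<And>x. 0 \<le> x \<Longrightarrow> \<phi> (0, restrict M' x) \<le> e / 4 * norm x"
    using dual_order_continuous_norm_small_restriction[OF oc positive_operator_comp[OF incl \<phi>(1)] e4 M]
    by blast
  define R where "R z = C (0 :: 'y, restrict M' (snd z))" for z :: "'y \<times> 'x"
  have R: "positive_operator R"
    unfolding R_def[abs_def]
    by (rule positive_operator_comp[OF positive_operator_comp[OF positive_operator_comp[OF positive_operator_snd positive_operator_restrict] incl] C])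
  have le: "norm (R z) \<le> 2 * (e / 2) * norm z" if "0 \<le> z" for z
  proof (rule norm_le_of_le_on_psum_ball[OF p_ge_1 positive_operatorD(1)[OF R], where P = "\<lambda>z. 0 \<le> z"])
    show "0 \<le> t *\<^sub>R z" if "0 \<le> z" "0 \<le> t" for t and z :: "'y \<times> 'x"
      using that by (simp add: scaleR_nonneg_nonneg)
    fix z :: "'y \<times> 'x" assume z: "0 \<le> z" "psum_norm p z \<le> 1"
    let ?w = "(0 :: 'y, restrict M' (snd z))"
    have snd: "0 \<le> snd z" using z(1) by (simp add: less_eq_prod_def)
    have nsnd: "norm (snd z) \<le> 1" using norm_components_le_psum_norm(2)[OF p_ge_1, of z] z(2) by linarith
    have w: "0 \<le> ?w"
      using positive_operatorD(2)[OF positive_operator_restrict snd] by (simp add: less_eq_prod_def)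
    have "lp_bounded p 1 (\<lambda>b. if b = False then norm (snd ?w) else 0)"
      using lp_bounded_single[OF norm_ge_zero, of p "snd ?w" False] norm_restrict_le[of M' "snd z"] nsnd
      by (auto intro: lp_bounded_bound_mono)
    also have "(\<lambda>b. if b = False then norm (snd ?w) else 0) = (\<lambda>b. if b then norm (fst ?w) else norm (snd ?w))"
      by auto
    finally have "psum_norm p ?w \<le> 1" using psum_norm_le_iff[OF p_ge_1] by blast
    then have "norm (R z) \<le> \<phi> ?w + e / 4" unfolding R_def by (rule \<phi>(2)[OF w])
    also have "\<phi> ?w \<le> e / 4 * norm (snd z)" by (rule M'(3)[OF snd])
    also have "\<dots> \<le> e / 4 * 1" using nsnd e4 by (intro mult_left_mono) auto
    finally show "norm (R z) \<le> e / 2" by simp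
  qed (rule that)
  have "norm (C (0, restrict M' x)) \<le> e * norm x" for x
  proof -
    have "norm (R (0, x)) \<le> norm (R \<bar>(0, x)\<bar>)" by (rule norm_positive_operator_le[OF R])
    also have "\<dots> \<le> 2 * (e / 2) * norm \<bar>(0 :: 'y, x)\<bar>" by (rule le) simp
    finally show ?thesis by (simp add: R_def norm_abs_banach_lattice)
  qed
  then show ?thesis using M' by blast
qed

end

section \<open>Positive commutators\<close>

text \<open>A set is good for \<open>n\<close> if the image of the unit ball is small on it. Entries with index \<open>n + 2\<close> of \<open>C z\<close> belong to
such a set; the two remaining entries are absorbed by the constant \<open>D\<close>.\<close>

lemma commutator_if_range_nearly_order_bounded:
  fixes \<rho> :: "nat \<Rightarrow> 'x::banach_lattice \<Rightarrow> 'x"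
    and S :: "'y::banach_lattice \<Rightarrow> 'x" and T :: "'x \<Rightarrow> 'y" and C :: "'y \<times> 'x \<Rightarrow> 'y \<times> 'x"
  assumes \<rho>: "lp_coordinates p \<rho>"
    and ST: "positive_operator S" "positive_operator T" "\<And>y. T (S y) = y"
    and C: "positive_operator C"
    and oc: "order_continuous_norm (norm :: 'x \<Rightarrow> real)" and range: "range_nearly_order_bounded p C"
  shows "\<exists>A B. positive_operator A \<and> positive_operator B \<and> C = (\<lambda>z. A (B z) - B (A z))"
proof -
  interpret base: lp_coordinates p \<rho> by (rule \<rho>)
  define good where "good n M \<longleftrightarrow> (\<forall>z. norm (base.restrict M (snd (C z))) \<le> decay (n + 2) * norm z)" for n M
  have "\<exists>\<sigma>. lp_coordinates p \<sigma> \<and> (\<forall>n. \<exists>M. good n M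
      \<and> (\<forall>x. norm (\<sigma> (Suc n) x) \<le> norm (base.restrict M x))
      \<and> (\<forall>x. (\<forall>j\<le>n. \<sigma> j x = 0) \<longrightarrow> base.restrict M x = x))"
  proof (rule base.regroup_with_small_tails)
    show "\<exists>M'\<subseteq>M. infinite M' \<and> good n M'" if "infinite M" for n M
      using base.small_restriction_of_range[OF oc C range decay_pos that] by (simp add: good_def)
    show "good n M'" if "good n M" "M' \<subseteq> M" for n M M'
      using that base.norm_restrict_mono[of M' M] unfolding good_def by (meson order_trans)
  qed
  then obtain \<sigma> where \<sigma>: "lp_coordinates p \<sigma>"
    "\<And>n. \<exists>M. good n M \<and> (\<forall>x. norm (\<sigma> (Suc n) x) \<le> norm (base.restrict M x))
      \<and> (\<forall>x. (\<forall>j\<le>n. \<sigma> j x = 0) \<longrightarrow> base.restrict M x = x)"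
    by blast
  interpret commutator_setting p \<sigma> S T C
    by (intro commutator_setting.intro commutator_setting_axioms.intro \<sigma>(1) ST C)
  obtain c where c: "0 < c" "\<And>z. lp_bounded p (c * norm z) (\<lambda>n. norm (coord n z))"
    using coords_bounded by blast
  obtain K where K: "K > 0" "\<And>z. norm (C z) \<le> norm z * K"
    using bounded_linear.pos_bounded[OF positive_operator_bounded[OF C]] by blast
  \<comment> \<open>The factor \<open>8\<close> compensates the least value \<open>1 / 8\<close> of \<open>decay\<close> at the indices \<open>0\<close> and \<open>1\<close>.\<close>
  define D where "D = 8 * (c * K) + 1"
  have D: "1 \<le> D" "c * K \<le> D * (1 / 8)" using c(1) K(1) by (simp_all add: D_def)
  show ?thesis
  proof (rule commutator_if_rows_decay)
    show "0 \<le> D" using D(1) by simp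
    fix i z
    show "norm (coord i (C z)) \<le> D * ((1/2) ^ i * invsq i) * norm z"
    proof (cases "i < 2")
      case True
      have "norm (coord i (C z)) \<le> c * norm (C z)" by (rule lp_bounded_entry_le[OF p_ge_1 c(2)])
      also have "\<dots> \<le> c * (norm z * K)" using c(1) K(2) by (intro mult_left_mono) auto
      also have "\<dots> = (c * K) * norm z" by simp
      also have "\<dots> \<le> D * decay i * norm z"
        using D decay_initial[OF True] by (intro mult_right_mono order_trans[OF D(2)] mult_left_mono) auto
      finally show ?thesis by (simp add: decay_def)
    next
      case False
      then obtain n where i: "i = Suc (Suc n)" by (metis add_2_eq_Suc le_Suc_ex not_less)
      obtain M where M: "good n M" "\<forall>x. norm (\<sigma> (Suc n) x) \<le> norm (base.restrict M x)"
        using \<sigma>(2)[of n] by blast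
      have "norm (coord i (C z)) \<le> norm (base.restrict M (snd (C z)))" using M(2) by (simp add: i)
      also have "\<dots> \<le> decay i * norm z" using M(1)[unfolded good_def, rule_format, of z] by (simp add: i)
      also have "\<dots> \<le> D * decay i * norm z"
        using D(1) decay_pos[of i] by (intro mult_right_mono) auto
      finally show ?thesis by (simp add: decay_def)
    qed
  qed
qed

text \<open>A set is good for \<open>n\<close> if \<open>C\<close> is small on the elements supported in it. This bounds the columns with index \<open>n + 2\<close> and also
shows that \<open>C z\<close> is the sum of its columns; for \<open>p = \<infinity>\<close> the latter is not automatic, since \<open>z\<close> need not be the norm limit of
its truncations.\<close>

lemma commutator_if_norm_nearly_dominated:
  fixes \<rho> :: "nat \<Rightarrow> 'x::banach_lattice \<Rightarrow> 'x"
    and S :: "'y::banach_lattice \<Rightarrow> 'x" and T :: "'x \<Rightarrow> 'y" and C :: "'y \<times> 'x \<Rightarrow> 'y \<times> 'x"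
  assumes \<rho>: "lp_coordinates p \<rho>"
    and ST: "positive_operator S" "positive_operator T" "\<And>y. T (S y) = y"
    and C: "positive_operator C"
    and oc: "order_continuous_norm (norm :: ('x \<Rightarrow>\<^sub>L real) \<Rightarrow> real)" and dom: "norm_nearly_dominated p C"
  shows "\<exists>A B. positive_operator A \<and> positive_operator B \<and> C = (\<lambda>z. A (B z) - B (A z))"
proof -
  interpret base: lp_coordinates p \<rho> by (rule \<rho>)
  define good where "good n M \<longleftrightarrow> (\<forall>x. norm (C (0, base.restrict M x)) \<le> decay (n + 2) * norm x)" for n M
  have "\<exists>\<sigma>. lp_coordinates p \<sigma> \<and> (\<forall>n. \<exists>M. good n M
      \<and> (\<forall>x. norm (\<sigma> (Suc n) x) \<le> norm (base.restrict M x))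
      \<and> (\<forall>x. (\<forall>j\<le>n. \<sigma> j x = 0) \<longrightarrow> base.restrict M x = x))"
  proof (rule base.regroup_with_small_tails)
    show "\<exists>M'\<subseteq>M. infinite M' \<and> good n M'" if "infinite M" for n M
      using base.small_on_restriction[OF oc C dom decay_pos that] by (simp add: good_def)
    show "good n M'" if M: "good n M" "M' \<subseteq> M" for n M M'
      unfolding good_def
    proof
      fix x
      have "base.restrict M' x = base.restrict M (base.restrict M' x)"
        using M(2) by (simp add: base.restrict_restrict Int_absorb1)
      then have "norm (C (0, base.restrict M' x)) \<le> decay (n + 2) * norm (base.restrict M' x)"
        using M(1) unfolding good_def by metis
      also have "\<dots> \<le> decay (n + 2) * norm x"
        using decay_pos[of "n + 2"] base.norm_restrict_le by (intro mult_left_mono) auto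
      finally show "norm (C (0, base.restrict M' x)) \<le> decay (n + 2) * norm x" .
    qed
  qed
  then obtain \<sigma> where \<sigma>: "lp_coordinates p \<sigma>"
    "\<And>n. \<exists>M. good n M \<and> (\<forall>x. norm (\<sigma> (Suc n) x) \<le> norm (base.restrict M x))
      \<and> (\<forall>x. (\<forall>j\<le>n. \<sigma> j x = 0) \<longrightarrow> base.restrict M x = x)"
    by blast
  interpret commutator_setting p \<sigma> S T C
    by (intro commutator_setting.intro commutator_setting_axioms.intro \<sigma>(1) ST C)
  have tail: "norm (C (0, x)) \<le> decay (n + 2) * norm x" if "\<And>j. j \<le> n \<Longrightarrow> \<sigma> j x = 0" for n x
    using \<sigma>(2)[of n] that unfolding good_def by metis
  obtain t where t: "t > 0" "\<And>x. norm (T x) \<le> norm x * t"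
    using bounded_linear.pos_bounded[OF positive_operator_bounded[OF T]] by blast
  obtain K where K: "K > 0" "\<And>z. norm (C z) \<le> norm z * K"
    using bounded_linear.pos_bounded[OF positive_operator_bounded[OF C]] by blast
  \<comment> \<open>The constant covers the columns \<open>0\<close> and \<open>1\<close>, where \<open>decay\<close> is at least \<open>1 / 8\<close>.\<close>
  define D where "D = 8 * ((t + 1) * K) + 1"
  have D: "1 \<le> D" "(t + 1) * K \<le> D * (1 / 8)" using t(1) K(1) by (simp_all add: D_def)
  note linC = positive_operatorD(1)[OF C]
  show ?thesis
  proof (rule commutator_if_columns_decay)
    show "0 \<le> D" using D(1) by simp
    show "norm (C (proj m z)) \<le> D * ((1/2) ^ m * invsq m) * norm (coord m z)" for m z
    proof (cases "m < 2")
      case True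
      have "norm (proj m z) \<le> (t + 1) * norm (coord m z)"
      proof (cases "m = 0")
        case True
        have "norm (fst z) \<le> norm (S (fst z)) * t" using t(2)[of "S (fst z)"] by (simp add: TS)
        then show ?thesis using True by (simp add: proj_def algebra_simps add_increasing)
      next
        case False
        then have m: "m = Suc 0" using \<open>m < 2\<close> by simp
        have "norm (restrict {0} (snd z)) \<le> 1 * norm (\<sigma> 0 (snd z))"
          using norm_restrict_singleton_le[of 0 "snd z"] by simp
        also have "\<dots> \<le> (t + 1) * norm (\<sigma> 0 (snd z))" using t(1) by (intro mult_right_mono) auto
        finally show ?thesis by (simp add: m proj_def)
      qed
      then have "norm (proj m z) * K \<le> (t + 1) * norm (coord m z) * K"
        using K(1) by (intro mult_right_mono) auto
      then have "norm (C (proj m z)) \<le> (t + 1) * norm (coord m z) * K"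
        using K(2)[of "proj m z"] by linarith
      also have "\<dots> = (t + 1) * K * norm (coord m z)" by simp
      also have "\<dots> \<le> D * decay m * norm (coord m z)"
        using D decay_initial[OF True] by (intro mult_right_mono order_trans[OF D(2)] mult_left_mono) auto
      finally show ?thesis by (simp add: decay_def)
    next
      case False
      then obtain n where m: "m = Suc (Suc n)" by (metis add_2_eq_Suc le_Suc_ex not_less)
      let ?x = "restrict {Suc n} (snd z)"
      have "norm (C (proj m z)) = norm (C (0, ?x))" by (simp add: proj_def m)
      also have "\<dots> \<le> decay m * norm ?x"
        using tail[of n ?x] by (simp add: coord_restrict m)
      also have "\<dots> \<le> decay m * norm (coord m z)"
        using norm_restrict_singleton_le[of "Suc n" "snd z"] decay_pos[of m]
        by (intro mult_left_mono) (simp_all add: m)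
      also have "\<dots> \<le> D * decay m * norm (coord m z)"
        using D(1) decay_pos[of m] by (intro mult_right_mono) auto
      finally show ?thesis by (simp add: decay_def)
    qed
    show "(\<lambda>m. C (proj m z)) sums C z" for z
    proof -
      have partial: "(\<Sum>m<Suc n. proj m z) = (fst z, restrict {..<n} (snd z))" for n
      proof (induction n)
        case 0
        have "restrict {} (snd z) = 0"
          by (rule coords_eqI) (simp add: coord_restrict linear_0[OF linear_coord])
        then show ?case by (simp add: proj_def)
      next
        case (Suc n)
        have "restrict {..<n} (snd z) + restrict {n} (snd z) = restrict {..<Suc n} (snd z)"
          by (subst restrict_add_disjoint[symmetric]) (auto simp: lessThan_Suc Un_commute)
        then show ?case using Suc by (simp add: proj_def)
      qed
      have rest: "(fst z, restrict {..<n} (snd z)) + (0, restrict {n..} (snd z)) = z" for n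
      proof -
        have "restrict {..<n} (snd z) + restrict {n..} (snd z) = restrict UNIV (snd z)"
          by (subst restrict_add_disjoint[symmetric]) (auto intro: arg_cong[where f = "\<lambda>M. restrict M (snd z)"])
        also have "\<dots> = snd z" by (rule restrict_eq_self) simp
        finally show ?thesis by (simp add: prod_eq_iff)
      qed
      have "norm (C z - (\<Sum>m<n + 2. C (proj m z))) \<le> (1/2) ^ n * norm z" for n
      proof -
        have "C z = (\<Sum>m<n + 2. C (proj m z)) + C (0, restrict {Suc n..} (snd z))"
          using rest[of "Suc n"] partial[of "Suc n"]
          by (metis linear_add[OF linC] linear_sum[OF linC] add_2_eq_Suc')
        then have "norm (C z - (\<Sum>m<n + 2. C (proj m z))) = norm (C (0, restrict {Suc n..} (snd z)))" by simp
        also have "\<dots> \<le> decay (n + 2) * norm (restrict {Suc n..} (snd z))"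
          by (rule tail) (simp add: coord_restrict)
        also have "\<dots> \<le> (1/2) ^ n * norm z"
        proof (rule mult_mono)
          have "invsq (n + 2) \<le> 1" using invsq_antimono[of 0 "n + 2"] by (simp add: invsq_def)
          then show "decay (n + 2) \<le> (1/2) ^ n"
            unfolding decay_def using invsq_pos[of "n + 2"]
            by (simp add: power_add mult_le_one field_simps)
          show "norm (restrict {Suc n..} (snd z)) \<le> norm z"
            using norm_restrict_le norm_components_le(2) by (rule order_trans)
        qed auto
        finally show ?thesis .
      qed
      then have "eventually (\<lambda>n. norm ((\<Sum>m<n + 2. C (proj m z)) - C z) \<le> (1/2) ^ n * norm z) sequentially"
        by (simp only: norm_minus_commute[of _ "C z"] eventually_True)
      moreover have "(\<lambda>n. (1/2) ^ n * norm z) \<longlonglongrightarrow> 0"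
        by (intro tendsto_mult_left_zero LIMSEQ_power_zero) simp
      ultimately have "(\<lambda>n. (\<Sum>m<n + 2. C (proj m z)) - C z) \<longlonglongrightarrow> 0"
        by (rule Lim_null_comparison)
      then have "(\<lambda>n. \<Sum>m<n + 2. C (proj m z)) \<longlonglongrightarrow> C z" by (rule LIM_zero_cancel)
      then show ?thesis unfolding sums_def by (rule LIMSEQ_offset)
    qed
  qed
qed

theorem theorem5p3:
  fixes p :: ennreal
    and Xs :: "nat \<Rightarrow> 'x::banach_lattice set"
    and S :: "'y::banach_lattice \<Rightarrow> 'x" and T :: "'x \<Rightarrow> 'y"
    and C :: "'y \<times> 'x \<Rightarrow> 'y \<times> 'x"
  assumes "1 \<le> p"
    and "order_pelczynski_decomposition p Xs"
    and "positive_operator S" and "positive_operator T"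
    and "onorm S = 1" and "T \<circ> S = id"
    and "positive_operator C"
    and "semi_compact (psum_norm p) C
           \<and> order_continuous_norm (norm :: 'x \<Rightarrow> real)
           \<and> order_continuous_norm (norm :: ('x \<Rightarrow>\<^sub>L real) \<Rightarrow> real)
       \<or> semi_compact (psum_norm p) C
           \<and> AM_compact (dual_norm (psum_norm p)) (adjoint_operator C)
           \<and> order_continuous_norm (norm :: 'x \<Rightarrow> real)
       \<or> AM_compact (psum_norm p) C
           \<and> semi_compact (dual_norm (psum_norm p)) (adjoint_operator C)
           \<and> order_continuous_norm (norm :: ('x \<Rightarrow>\<^sub>L real) \<Rightarrow> real)
       \<or> compact_operator (psum_norm p) C
           \<and> (order_continuous_norm (norm :: 'x \<Rightarrow> real)
              \<or> order_continuous_norm (norm :: ('x \<Rightarrow>\<^sub>L real) \<Rightarrow> real))"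
  shows "\<exists>A B :: 'y \<times> 'x \<Rightarrow> 'y \<times> 'x.
    positive_operator A \<and> positive_operator B \<and> C = (\<lambda>z. A (B z) - B (A z))"
proof -
  note p = assms(1) and C = assms(7)
  obtain \<rho> :: "nat \<Rightarrow> 'x \<Rightarrow> 'x" where \<rho>: "lp_coordinates p \<rho>"
    using order_pelczynski_coordinates[OF p assms(2)] by blast
  have TS: "T (S y) = y" for y using assms(6) by (metis comp_apply id_apply)
  from assms(8) consider
    "order_continuous_norm (norm :: 'x \<Rightarrow> real)" "range_nearly_order_bounded p C"
  | "order_continuous_norm (norm :: ('x \<Rightarrow>\<^sub>L real) \<Rightarrow> real)" "norm_nearly_dominated p C"
    using semi_compact_range_nearly_order_bounded[OF p] compact_range_nearly_order_bounded[OF p]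
      adjoint_semi_compact_norm_nearly_dominated[OF p C] compact_norm_nearly_dominated[OF p C]
    by metis
  then show ?thesis
  proof cases
    case 1
    then show ?thesis
      by (rule commutator_if_range_nearly_order_bounded[OF \<rho> assms(3,4) TS C])
  next
    case 2
    then show ?thesis
      by (rule commutator_if_norm_nearly_dominated[OF \<rho> assms(3,4) TS C])
  qed
qed

end
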